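(* There exists an $m\in\mathbb{N}$ such that every graph $G$ which does not contain $K_{2,4}$ as a minor does not contain an agile set of size $m$.
   Context: Graphs are simple and undirected. A pair $(X_1,X_2)$ of disjoint vertex sets of a graph $G$ is independent if there are two disjoint trees $T_1,T_2$ in $G$ such that $X_1\subseteq V(T_1)$ and $X_2\subseteq V(T_2)$ (partition classes may be empty, and if $X_i=\emptyset$ the corresponding $T_i$ may be taken empty). A set $X\subseteq V(G)$ is agile (in $G$) if for every partition $X=X_1\,\dot\cup\,X_2$ the pair $(X_1,X_2)$ is independent. *)

theory Defs
  imports Main
begin

text \<open>
  Graphs are pairs of a vertex set and a set of two-element edges. Vertex sets are not assumed to be
  finite.
\<close>

type_synonym 'a ugraph = "'a set \<times> 'a set set"

abbreviation verts :: "'a ugraph \<Rightarrow> 'a set" where "verts \<equiv> fst"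
abbreviation edges :: "'a ugraph \<Rightarrow> 'a set set" where "edges \<equiv> snd"

definition simple_graph :: "'a ugraph \<Rightarrow> bool" where
  "simple_graph G \<longleftrightarrow> (\<forall>e\<in>edges G. \<exists>u\<in>verts G. \<exists>v\<in>verts G. u \<noteq> v \<and> e = {u, v})"

definition subgraph :: "'a ugraph \<Rightarrow> 'a ugraph \<Rightarrow> bool" where
  "subgraph H G \<longleftrightarrow> simple_graph H \<and> verts H \<subseteq> verts G \<and> edges H \<subseteq> edges G"

definition induced :: "'a ugraph \<Rightarrow> 'a set \<Rightarrow> 'a ugraph" where
  "induced G U = (verts G \<inter> U, {e \<in> edges G. e \<subseteq> U})"

definition adjacent :: "'a ugraph \<Rightarrow> 'a \<Rightarrow> 'a \<Rightarrow> bool" where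
  "adjacent G u v \<longleftrightarrow> {u, v} \<in> edges G"

definition walk :: "'a ugraph \<Rightarrow> 'a list \<Rightarrow> bool" where
  "walk G p \<longleftrightarrow> p \<noteq> [] \<and> set p \<subseteq> verts G \<and> successively (adjacent G) p"

text \<open>The empty graph is not connected, and hence not a tree.\<close>

definition graph_connected :: "'a ugraph \<Rightarrow> bool" where
  "graph_connected G \<longleftrightarrow> verts G \<noteq> {} \<and>
     (\<forall>u\<in>verts G. \<forall>v\<in>verts G. \<exists>p. walk G p \<and> hd p = u \<and> last p = v)"

text \<open>A cycle is listed without repeating its first vertex at the end.\<close>

definition is_cycle :: "'a ugraph \<Rightarrow> 'a list \<Rightarrow> bool" where
  "is_cycle G p \<longleftrightarrow> walk G p \<and> distinct p \<and> 3 \<le> length p \<and> adjacent G (last p) (hd p)"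

definition tree :: "'a ugraph \<Rightarrow> bool" where
  "tree T \<longleftrightarrow> simple_graph T \<and> graph_connected T \<and> (\<nexists>p. is_cycle T p)"

text \<open>
  \<open>minor H G\<close> means that \<open>H\<close> is a minor of \<open>G\<close>: the branch sets \<open>\<beta> x\<close> are connected (in particular
  nonempty) and pairwise disjoint, and contracting them yields all edges of \<open>H\<close>, possibly after
  deleting vertices and edges.
\<close>

definition minor :: "'b ugraph \<Rightarrow> 'a ugraph \<Rightarrow> bool" where
  "minor H G \<longleftrightarrow> (\<exists>\<beta>.
     (\<forall>x\<in>verts H. \<beta> x \<subseteq> verts G \<and> graph_connected (induced G (\<beta> x))) \<and>
     (\<forall>x\<in>verts H. \<forall>y\<in>verts H. x \<noteq> y \<longrightarrow> \<beta> x \<inter> \<beta> y = {}) \<and>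
     (\<forall>x\<in>verts H. \<forall>y\<in>verts H. adjacent H x y \<longrightarrow> (\<exists>u\<in>\<beta> x. \<exists>v\<in>\<beta> y. adjacent G u v)))"

definition complete_bipartite :: "nat \<Rightarrow> nat \<Rightarrow> (nat + nat) ugraph" where
  "complete_bipartite m n =
     (Inl ` {..<m} \<union> Inr ` {..<n}, {{Inl i, Inr j} | i j. i < m \<and> j < n})"

text \<open>The graph \<open>T\<^sub>i\<close> is allowed to be empty only when \<open>X\<^sub>i\<close> is.\<close>

definition independent_pair :: "'a ugraph \<Rightarrow> 'a set \<Rightarrow> 'a set \<Rightarrow> bool" where
  "independent_pair G X\<^sub>1 X\<^sub>2 \<longleftrightarrow>
     X\<^sub>1 \<subseteq> verts G \<and> X\<^sub>2 \<subseteq> verts G \<and> X\<^sub>1 \<inter> X\<^sub>2 = {} \<and>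
     (\<exists>T\<^sub>1 T\<^sub>2. subgraph T\<^sub>1 G \<and> subgraph T\<^sub>2 G \<and>
        (tree T\<^sub>1 \<or> X\<^sub>1 = {} \<and> verts T\<^sub>1 = {}) \<and>
        (tree T\<^sub>2 \<or> X\<^sub>2 = {} \<and> verts T\<^sub>2 = {}) \<and>
        verts T\<^sub>1 \<inter> verts T\<^sub>2 = {} \<and> X\<^sub>1 \<subseteq> verts T\<^sub>1 \<and> X\<^sub>2 \<subseteq> verts T\<^sub>2)"

definition agile :: "'a ugraph \<Rightarrow> 'a set \<Rightarrow> bool" where
  "agile G X \<longleftrightarrow> X \<subseteq> verts G \<and>
     (\<forall>X\<^sub>1 X\<^sub>2. X\<^sub>1 \<union> X\<^sub>2 = X \<and> X\<^sub>1 \<inter> X\<^sub>2 = {} \<longrightarrow> independent_pair G X\<^sub>1 X\<^sub>2)"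

text \<open>
  Every graph with vertices in the type \<open>'a\<close> and without a \<open>K\<^sub>2\<^sub>,\<^sub>4\<close> minor has no agile set of size
  \<open>m\<close>. HOL cannot quantify over the vertex type inside a formula, so the type is a parameter here. A
  bound for \<open>nat\<close> is a bound for all finite (and all countable) graphs up to isomorphism; that one
  and the same \<open>m\<close> serves every vertex type is expressed by saying that each bound for \<open>nat\<close> is also
  a bound for an arbitrary type.
\<close>

definition excludes_agile_size :: "'a itself \<Rightarrow> nat \<Rightarrow> bool" where
  "excludes_agile_size (_ :: 'a itself) m \<longleftrightarrow>
     (\<forall>G :: 'a ugraph. simple_graph G \<and> \<not> minor (complete_bipartite 2 4) G \<longrightarrow>
        \<not> (\<exists>X. finite X \<and> card X = m \<and> agile G X))"

end

theory Submission
  imports Defs "HOL-Library.Disjoint_Sets"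
begin

text \<open>
  A connected set with many marked vertices contains either a vertex with many disjoint marked legs
  or a long chain of marked connected pieces. If every mark is adjacent to a connected set outside,
  a star with four legs is a \<open>K\<^sub>2\<^sub>,\<^sub>4\<close> minor with that set as one of the two hubs, so only
  chains remain.

  Applied to a large agile set, this gives connected sets \<open>S\<close> and \<open>E\<close> partitioning the vertices and
  many disjoint connected blocks in \<open>S\<close>, each with two vertices of the agile set and each adjacent
  to \<open>E\<close>. Agility provides a second partition into connected sets (colours) that meets every block
  and \<open>E\<close> in both parts. If the monochromatic parts of \<open>S\<close> have few components, then two of
  these components and \<open>E\<close> are three hubs touching each other so often that one can be cut into four
  pieces. Otherwise all monochromatic components are contracted, \<open>S\<close> becomes a long chain, and two
  parts of the chain can only be linked within a colour through vertices of \<open>E\<close> (hops). At every cut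
  of the chain a hop of each colour crosses, but at most three hops do. Two cuts with hops that are
  not shared with each other then yield the minor, like two crossings in a ladder.
\<close>

section \<open>Connected sets, components and chains\<close>

text \<open>The combinatorics is done for a bare symmetric relation because adjacency of sets,
  \<open>adjS\<close>, is again one: contracting disjoint connected sets means passing from
  \<open>adj\<close> to \<open>adjS\<close>, and every result about vertices then holds for
  contracted pieces. Irreflexivity is not assumed, since a set with an inner edge is
  \<open>adjS\<close> to itself. Finite vertex sets are enough: agility of a finite set is witnessed
  by finitely many trees, each of which can be cut down to a finite one.

  The obstacle is that colour classes do not respect the chain. One hop may cross very many cuts,
  and the hops found at different cuts may coincide. But a hop touches fewer than ten blocks, so one
  that crosses many cuts leaves a long run of blocks untouched, and there the other hops can be
  controlled by counting. This is what makes hops private to their cuts.\<close>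

locale symrel =
  fixes adj :: "'v \<Rightarrow> 'v \<Rightarrow> bool"
  assumes sym: "adj x y \<Longrightarrow> adj y x"
begin

text \<open>Connectedness by cuts instead of walks: for unions and quotients it then suffices to
  take one subset and find one edge leaving it.\<close>

definition conn :: "'v set \<Rightarrow> bool" where
  "conn S \<longleftrightarrow> S \<noteq> {} \<and> (\<forall>A. A \<subseteq> S \<longrightarrow> A \<noteq> {} \<longrightarrow> A \<noteq> S \<longrightarrow> (\<exists>a\<in>A. \<exists>b\<in>S - A. adj a b))"

definition adjS :: "'v set \<Rightarrow> 'v set \<Rightarrow> bool" where
  "adjS A B \<longleftrightarrow> (\<exists>a\<in>A. \<exists>b\<in>B. adj a b)"

definition cc :: "'v set \<Rightarrow> 'v \<Rightarrow> 'v set" where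
  "cc S v = \<Union>{C. C \<subseteq> S \<and> conn C \<and> v \<in> C}"

text \<open>Pieces that are not consecutive may be adjacent as well, so this is a partition laid out
  along a path and not an induced path.\<close>

definition chain :: "'v set \<Rightarrow> nat \<Rightarrow> (nat \<Rightarrow> 'v set) \<Rightarrow> bool" where
  "chain S n D \<longleftrightarrow> (\<forall>i<n. conn (D i)) \<and> disjoint_family_on D {..<n} \<and> (\<Union>i<n. D i) = S \<and>
     (\<forall>i. Suc i < n \<longrightarrow> adjS (D i) (D (Suc i)))"

text \<open>The branch sets of the minor: two hubs \<open>A\<close>, \<open>B\<close> and four
  middle pieces.\<close>

definition K24 :: "'v set \<Rightarrow> bool" where
  "K24 V \<longleftrightarrow> (\<exists>A B \<M>. conn A \<and> conn B \<and> A \<subseteq> V \<and> B \<subseteq> V \<and> A \<inter> B = {} \<and> card \<M> = 4 \<and> disjoint \<M> \<and>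
     (\<forall>M\<in>\<M>. conn M \<and> M \<subseteq> V \<and> M \<inter> A = {} \<and> M \<inter> B = {} \<and> adjS M A \<and> adjS M B))"

lemma adjS_commute: "adjS A B \<longleftrightarrow> adjS B A"
  unfolding adjS_def using sym by blast

lemma adjS_mono: "adjS A B \<Longrightarrow> A \<subseteq> A' \<Longrightarrow> B \<subseteq> B' \<Longrightarrow> adjS A' B'"
  unfolding adjS_def by blast

lemma adjSI: "adj a b \<Longrightarrow> a \<in> A \<Longrightarrow> b \<in> B \<Longrightarrow> adjS A B"
  unfolding adjS_def by blast

lemma conn_nonempty: "conn S \<Longrightarrow> S \<noteq> {}"
  unfolding conn_def by blast

lemma conn_cut: "conn S \<Longrightarrow> A \<subseteq> S \<Longrightarrow> A \<noteq> {} \<Longrightarrow> A \<noteq> S \<Longrightarrow> adjS A (S - A)"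
  unfolding conn_def adjS_def by blast

lemma conn_sing: "conn {v}"
  unfolding conn_def by auto

lemma conn_Un:
  assumes "conn A" "conn B" "A \<inter> B \<noteq> {} \<or> adjS A B"
  shows "conn (A \<union> B)"
  unfolding conn_def
proof (intro conjI allI impI)
  show "A \<union> B \<noteq> {}" using assms(1) conn_nonempty by auto
  fix C assume C: "C \<subseteq> A \<union> B" "C \<noteq> {}" "C \<noteq> A \<union> B"
  consider "C \<inter> A \<noteq> {}" "C \<inter> A \<noteq> A" | "C \<inter> B \<noteq> {}" "C \<inter> B \<noteq> B" | "A \<subseteq> C" "C \<inter> B = {}" | "B \<subseteq> C" "C \<inter> A = {}"
    using C by blast
  then show "\<exists>a\<in>C. \<exists>b\<in>A \<union> B - C. adj a b"
  proof cases
    case 1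
    then obtain a b where "a \<in> C \<inter> A" "b \<in> A - C \<inter> A" "adj a b"
      using conn_cut[OF assms(1), of "C \<inter> A"] unfolding adjS_def by auto
    then show ?thesis by blast
  next
    case 2
    then obtain a b where "a \<in> C \<inter> B" "b \<in> B - C \<inter> B" "adj a b"
      using conn_cut[OF assms(2), of "C \<inter> B"] unfolding adjS_def by auto
    then show ?thesis by blast
  next
    case 3
    with assms(3) show ?thesis unfolding adjS_def by blast
  next
    case 4
    with assms(3) show ?thesis unfolding adjS_def using sym by blast
  qed
qed

text \<open>A set that cuts the union also cuts \<open>A\<close> or one of the sets
  \<open>A \<union> F i\<close>, which are connected by \<open>conn_Un\<close>.\<close>

lemma conn_UN:
  assumes "conn A" "\<And>i. i \<in> I \<Longrightarrow> conn (F i)" "\<And>i. i \<in> I \<Longrightarrow> A \<inter> F i \<noteq> {} \<or> adjS A (F i)"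
  shows "conn (A \<union> (\<Union>i\<in>I. F i))"
  unfolding conn_def
proof (intro conjI allI impI)
  show "A \<union> (\<Union>i\<in>I. F i) \<noteq> {}" using assms(1) conn_nonempty by auto
  fix C assume C: "C \<subseteq> A \<union> (\<Union>i\<in>I. F i)" "C \<noteq> {}" "C \<noteq> A \<union> (\<Union>i\<in>I. F i)"
  have "\<exists>B. conn B \<and> B \<subseteq> A \<union> (\<Union>i\<in>I. F i) \<and> C \<inter> B \<noteq> {} \<and> C \<inter> B \<noteq> B"
  proof (cases "A \<subseteq> C")
    case True
    with C obtain i where i: "i \<in> I" "\<not> F i \<subseteq> C" by blast
    have "C \<inter> (A \<union> F i) \<noteq> {}" using True assms(1) conn_nonempty by blast
    with i conn_Un[OF assms(1) assms(2) assms(3), of i] show ?thesis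
      by (intro exI[of _ "A \<union> F i"]) auto
  next
    case False
    show ?thesis
    proof (cases "A \<inter> C = {}")
      case True
      with C obtain i where i: "i \<in> I" "F i \<inter> C \<noteq> {}" by blast
      with False conn_Un[OF assms(1) assms(2) assms(3), of i] show ?thesis
        by (intro exI[of _ "A \<union> F i"]) auto
    next
      case False
      with \<open>\<not> A \<subseteq> C\<close> assms(1) show ?thesis by (intro exI[of _ A]) auto
    qed
  qed
  then obtain B where B: "conn B" "B \<subseteq> A \<union> (\<Union>i\<in>I. F i)" "C \<inter> B \<noteq> {}" "C \<inter> B \<noteq> B" by blast
  then obtain a b where "a \<in> C \<inter> B" "b \<in> B - C \<inter> B" "adj a b"
    using conn_cut[OF B(1), of "C \<inter> B"] unfolding adjS_def by auto
  then show "\<exists>a\<in>C. \<exists>b\<in>A \<union> (\<Union>i\<in>I. F i) - C. adj a b" using B(2) by blast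
qed

section \<open>Components, and bipartitions into connected sets\<close>

lemma cc_subset: "cc S v \<subseteq> S"
  unfolding cc_def by blast

lemma cc_self: "v \<in> S \<Longrightarrow> v \<in> cc S v"
  unfolding cc_def using conn_sing[of v] by blast

lemma conn_cc: "v \<in> S \<Longrightarrow> conn (cc S v)"
proof -
  assume "v \<in> S"
  have "conn ({v} \<union> (\<Union>C\<in>{C. C \<subseteq> S \<and> conn C \<and> v \<in> C}. C))"
    by (rule conn_UN) (auto simp: conn_sing)
  moreover have "{v} \<union> (\<Union>C\<in>{C. C \<subseteq> S \<and> conn C \<and> v \<in> C}. C) = cc S v"
    using cc_self[OF \<open>v \<in> S\<close>] unfolding cc_def by auto
  ultimately show ?thesis by simp
qed

lemma cc_max: "v \<in> S \<Longrightarrow> conn C \<Longrightarrow> C \<subseteq> S \<Longrightarrow> C \<inter> cc S v \<noteq> {} \<or> adjS (cc S v) C \<Longrightarrow> C \<subseteq> cc S v"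
proof -
  assume a: "v \<in> S" "conn C" "C \<subseteq> S" "C \<inter> cc S v \<noteq> {} \<or> adjS (cc S v) C"
  have "conn (cc S v \<union> C)" using a conn_Un[OF conn_cc[OF a(1)] a(2)] by blast
  moreover have "cc S v \<union> C \<subseteq> S" using a cc_subset by blast
  moreover have "v \<in> cc S v \<union> C" using cc_self a by blast
  ultimately have "cc S v \<union> C \<subseteq> cc S v" unfolding cc_def[of S v] by blast
  then show ?thesis by blast
qed

lemma cc_step: "v \<in> S \<Longrightarrow> a \<in> cc S v \<Longrightarrow> adj a b \<Longrightarrow> b \<in> S \<Longrightarrow> b \<in> cc S v"
  using cc_max[of v S "{b}"] conn_sing adjSI[of a b "cc S v" "{b}"] by blast

lemma cc_eq: "v \<in> S \<Longrightarrow> w \<in> cc S v \<Longrightarrow> cc S w = cc S v"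
proof -
  assume a: "v \<in> S" "w \<in> cc S v"
  have wS: "w \<in> S" using a cc_subset by blast
  have "cc S w \<subseteq> cc S v"
    using cc_max[OF a(1) conn_cc[OF wS] cc_subset] cc_self[OF wS] a by blast
  moreover have "cc S v \<subseteq> cc S w"
    using cc_max[OF wS conn_cc[OF a(1)] cc_subset] cc_self[OF wS] a by blast
  ultimately show ?thesis by blast
qed

lemma cc_disjoint: "v \<in> S \<Longrightarrow> w \<in> S \<Longrightarrow> cc S v \<noteq> cc S w \<Longrightarrow> cc S v \<inter> cc S w = {}"
  using cc_eq by blast

lemma disjoint_cc: "disjoint (cc S ` S)"
  unfolding disjoint_def using cc_disjoint by blast

lemma cc_adjS_compl:
  assumes "conn T" "S \<subseteq> T" "S \<noteq> T" "v \<in> S"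
  shows "adjS (cc S v) (T - S)"
proof -
  have "cc S v \<subseteq> T" "cc S v \<noteq> {}" "cc S v \<noteq> T"
    using cc_subset[of S v] cc_self assms by blast+
  then obtain a b where ab: "a \<in> cc S v" "b \<in> T - cc S v" "adj a b"
    using conn_cut[OF assms(1)] unfolding adjS_def by blast
  then have "b \<notin> S" using cc_step assms(4) by blast
  with ab show ?thesis by (auto intro: adjSI)
qed

text \<open>Every other component of \<open>V - B\<close> is adjacent to \<open>B\<close>, so these
  components and \<open>B\<close> together stay connected when one component is removed.\<close>

lemma conn_compl_cc:
  assumes V: "conn V" and B: "conn B" "B \<subseteq> V" and a: "a \<in> V - B"
  shows "conn (V - cc (V - B) a)"
proof -
  let ?S = "V - B"
  let ?I = "cc ?S ` ?S - {cc ?S a}"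
  have "conn (B \<union> (\<Union>C\<in>?I. C))"
  proof (rule conn_UN[OF B(1)])
    fix C assume "C \<in> ?I"
    then obtain v where v: "v \<in> ?S" "C = cc ?S v" by blast
    show "conn C" using v conn_cc by blast
    have "adjS C (V - ?S)"
      using v B conn_nonempty[OF B(1)] by (auto intro!: cc_adjS_compl[OF V])
    moreover have "V - ?S = B" using B by blast
    ultimately show "B \<inter> C \<noteq> {} \<or> adjS B C" using adjS_commute by simp
  qed
  moreover have "B \<union> (\<Union>C\<in>?I. C) = V - cc ?S a"
  proof (intro equalityI subsetI)
    fix x assume "x \<in> B \<union> (\<Union>C\<in>?I. C)"
    then show "x \<in> V - cc ?S a"
    proof
      assume "x \<in> B" then show ?thesis using B cc_subset[of ?S a] by blast
    next
      assume "x \<in> (\<Union>C\<in>?I. C)"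
      then obtain v where "v \<in> ?S" "x \<in> cc ?S v" "cc ?S v \<noteq> cc ?S a" by blast
      then show ?thesis using cc_disjoint[of v ?S a] cc_subset[of ?S v] a by blast
    qed
  next
    fix x assume x: "x \<in> V - cc ?S a"
    show "x \<in> B \<union> (\<Union>C\<in>?I. C)"
    proof (cases "x \<in> B")
      case False
      then have "x \<in> cc ?S x" "x \<in> ?S" using x cc_self[of x ?S] by auto
      moreover have "cc ?S x \<noteq> cc ?S a" using calculation x by blast
      ultimately show ?thesis by blast
    qed simp
  qed
  ultimately show ?thesis by simp
qed

text \<open>The component of \<open>V - B\<close> around \<open>A\<close> is the set
  \<open>C\<close>. This turns two disjoint trees into a bipartition of all of
  \<open>V\<close>.\<close>

lemma extend_disjoint_conn:
  assumes "conn V" "conn A" "conn B" "A \<subseteq> V" "B \<subseteq> V" "A \<inter> B = {}"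
  shows "\<exists>C. C \<subseteq> V \<and> conn C \<and> conn (V - C) \<and> A \<subseteq> C \<and> B \<subseteq> V - C"
proof -
  obtain a where a: "a \<in> A" using conn_nonempty[OF assms(2)] by blast
  have aV: "a \<in> V - B" using a assms by blast
  have "A \<subseteq> cc (V - B) a"
    using cc_max[OF aV assms(2)] cc_self[OF aV] a assms by blast
  with conn_cc[OF aV] conn_compl_cc[OF assms(1,3,5) aV] show ?thesis
    using cc_subset[of "V - B" a] assms by (intro exI[of _ "cc (V - B) a"]) blast
qed

section \<open>Segments of a chain\<close>

lemma chain_seg:
  assumes "chain S n D" "a < b" "b \<le> n"
  shows "conn (\<Union>i\<in>{a..<b}. D i)"
  using assms(2,3)
proof (induction b)
  case (Suc b)
  show ?case
  proof (cases "a = b")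
    case True
    then show ?thesis using assms(1) Suc.prems unfolding chain_def by auto
  next
    case False
    then obtain c where c: "b = Suc c" using Suc by (cases b) auto
    have "conn (\<Union>i\<in>{a..<b}. D i)" using Suc False by simp
    moreover have "adjS (\<Union>i\<in>{a..<b}. D i) (D b)"
    proof (rule adjS_mono)
      show "adjS (D c) (D b)" using assms(1) Suc.prems c unfolding chain_def by auto
      show "D c \<subseteq> (\<Union>i\<in>{a..<b}. D i)" using Suc.prems False c by (intro UN_upper) auto
    qed simp
    moreover have "conn (D b)" using assms(1) Suc.prems unfolding chain_def by auto
    ultimately have "conn ((\<Union>i\<in>{a..<b}. D i) \<union> D b)" by (intro conn_Un) auto
    moreover have "(\<Union>i\<in>{a..<b}. D i) \<union> D b = (\<Union>i\<in>{a..<Suc b}. D i)"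
      using Suc.prems by (simp add: atLeastLessThanSuc Un_commute)
    ultimately show ?thesis by simp
  qed
qed simp

lemma chain_seg_disjoint:
  assumes "chain S n D" "b \<le> c" "d \<le> n"
  shows "(\<Union>i\<in>{a..<b}. D i) \<inter> (\<Union>i\<in>{c..<d}. D i) = {}"
proof -
  have "D i \<inter> D j = {}" if "i \<in> {a..<b}" "j \<in> {c..<d}" for i j
    using assms that unfolding chain_def by (intro disjoint_family_onD[of D "{..<n}"]) auto
  then show ?thesis by blast
qed

lemma chain_seg_adjS:
  assumes "chain S n D" "a < b" "b < c" "c \<le> n"
  shows "adjS (\<Union>i\<in>{a..<b}. D i) (\<Union>i\<in>{b..<c}. D i)"
proof -
  obtain k where k: "b = Suc k" using assms by (cases b) auto
  have "adjS (D k) (D b)" using assms k unfolding chain_def by auto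
  moreover have "D k \<subseteq> (\<Union>i\<in>{a..<b}. D i)" using assms k by (intro UN_upper) auto
  moreover have "D b \<subseteq> (\<Union>i\<in>{b..<c}. D i)" using assms k by (intro UN_upper) auto
  ultimately show ?thesis by (rule adjS_mono)
qed

lemma chain_seg_subset: "chain S n D \<Longrightarrow> b \<le> n \<Longrightarrow> (\<Union>i\<in>{a..<b}. D i) \<subseteq> S"
  unfolding chain_def by fastforce

text \<open>Merging pieces two by two gives blocks with two marks each; a bipartition that separates
  even from odd marks then meets every block on both sides.\<close>

lemma chain_pair:
  assumes "chain S (2 * n) D"
  shows "chain S n (\<lambda>i. D (2 * i) \<union> D (2 * i + 1))"
  unfolding chain_def
proof (intro conjI allI impI)
  have c: "\<And>i. i < 2 * n \<Longrightarrow> conn (D i)" "\<And>i. Suc i < 2 * n \<Longrightarrow> adjS (D i) (D (Suc i))"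
    "disjoint_family_on D {..<2*n}" "(\<Union>i<2*n. D i) = S"
    using assms unfolding chain_def by auto
  {
    fix i assume i: "i < n"
    show "conn (D (2 * i) \<union> D (2 * i + 1))"
      using i by (intro conn_Un c) (use c(2)[of "2*i"] in auto)
  }
  show "disjoint_family_on (\<lambda>i. D (2 * i) \<union> D (2 * i + 1)) {..<n}"
    unfolding disjoint_family_on_def
  proof (intro ballI impI)
    fix i j assume "i \<in> {..<n}" "j \<in> {..<n}" "i \<noteq> j"
    then have "D (2*i) \<inter> D (2*j) = {}" "D (2*i) \<inter> D (2*j+1) = {}"
      "D (2*i+1) \<inter> D (2*j) = {}" "D (2*i+1) \<inter> D (2*j+1) = {}"
      by (intro disjoint_family_onD[OF c(3)]; auto; presburger)+
    then show "(D (2 * i) \<union> D (2 * i + 1)) \<inter> (D (2 * j) \<union> D (2 * j + 1)) = {}" by blast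
  qed
  show "(\<Union>i<n. D (2 * i) \<union> D (2 * i + 1)) = S"
  proof (intro equalityI subsetI)
    fix x assume "x \<in> (\<Union>i<n. D (2 * i) \<union> D (2 * i + 1))"
    then obtain i where "i < n" "x \<in> D (2*i) \<or> x \<in> D (2*i+1)" by blast
    then have "\<exists>k<2*n. x \<in> D k" by (auto intro: exI[of _ "2*i"] exI[of _ "2*i+1"])
    then show "x \<in> S" using c(4) by blast
  next
    fix x assume "x \<in> S"
    then obtain k where k: "k < 2 * n" "x \<in> D k" using c(4) by blast
    have "k div 2 < n" "k = 2 * (k div 2) \<or> k = 2 * (k div 2) + 1" using k by auto
    then show "x \<in> (\<Union>i<n. D (2 * i) \<union> D (2 * i + 1))" using k by fastforce
  qed
  fix i assume "Suc i < n"
  then have "adjS (D (2*i+1)) (D (2 * Suc i))" using c(2)[of "2*i+1"] by simp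
  then show "adjS (D (2 * i) \<union> D (2 * i + 1)) (D (2 * Suc i) \<union> D (2 * Suc i + 1))"
    by (rule adjS_mono) auto
qed

section \<open>Assembling the minor from hubs and middle pieces\<close>

lemma K24I:
  assumes "conn A" "conn B" "A \<subseteq> V" "B \<subseteq> V" "A \<inter> B = {}" "4 \<le> card I"
    and "disjoint_family_on M I"
    and "\<And>i. i \<in> I \<Longrightarrow> conn (M i) \<and> M i \<subseteq> V \<and> M i \<inter> A = {} \<and> M i \<inter> B = {} \<and> adjS (M i) A \<and> adjS (M i) B"
  shows "K24 V"
proof -
  obtain J where J: "J \<subseteq> I" "card J = 4" using assms(6) by (metis obtain_subset_with_card_n)
  have dJ: "disjoint_family_on M J" using assms(7) J(1) by (rule disjoint_family_on_mono[rotated])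
  have "inj_on M J"
  proof (rule inj_onI)
    fix i j assume ij: "i \<in> J" "j \<in> J" "M i = M j"
    show "i = j"
    proof (rule ccontr)
      assume "i \<noteq> j"
      then have "M i \<inter> M j = {}" using dJ ij by (intro disjoint_family_onD)
      then show False using ij assms(8)[of i] J conn_nonempty by auto
    qed
  qed
  then have "card (M ` J) = 4" using J by (simp add: card_image)
  moreover have "disjoint (M ` J)" using dJ by (rule disjoint_family_on_disjoint_image)
  moreover have "\<forall>X\<in>M ` J. conn X \<and> X \<subseteq> V \<and> X \<inter> A = {} \<and> X \<inter> B = {} \<and> adjS X A \<and> adjS X B"
    using assms(8) J(1) by blast
  ultimately show ?thesis unfolding K24_def using assms(1-5) by metis
qed

lemma K24E:
  assumes "K24 V"
  obtains A B \<M> where "conn A" "conn B" "A \<subseteq> V" "B \<subseteq> V" "A \<inter> B = {}" "card \<M> = 4" "disjoint \<M>"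
    "\<forall>M\<in>\<M>. conn M \<and> M \<subseteq> V \<and> M \<inter> A = {} \<and> M \<inter> B = {} \<and> adjS M A \<and> adjS M B"
  using assms unfolding K24_def by (elim exE conjE) (rule that)

lemma K24_mono:
  assumes "K24 V" "V \<subseteq> W"
  shows "K24 W"
proof -
  obtain A B \<M> where h: "conn A" "conn B" "A \<subseteq> V" "B \<subseteq> V" "A \<inter> B = {}" "card \<M> = 4" "disjoint \<M>"
    "\<forall>M\<in>\<M>. conn M \<and> M \<subseteq> V \<and> M \<inter> A = {} \<and> M \<inter> B = {} \<and> adjS M A \<and> adjS M B"
    using K24E[OF assms(1)] .
  show "K24 W"
  proof (rule K24I[where M = id and I = \<M>, OF h(1,2) _ _ h(5)])
    show "A \<subseteq> W" "B \<subseteq> W" using h(3,4) assms(2) by blast+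
    show "disjoint_family_on id \<M>" using h(7) by (simp add: disjoint_image_disjoint_family_on)
    fix M assume "M \<in> \<M>"
    with h(8) have "conn M \<and> M \<subseteq> V \<and> M \<inter> A = {} \<and> M \<inter> B = {} \<and> adjS M A \<and> adjS M B" by blast
    with assms(2) show "conn (id M) \<and> id M \<subseteq> W \<and> id M \<inter> A = {} \<and> id M \<inter> B = {} \<and> adjS (id M) A \<and> adjS (id M) B"
      by auto
  qed (simp add: h(6))
qed

end

section \<open>Stars, chains and quotients\<close>

lemma disjoint_image_of:
  assumes "\<And>x y. x \<in> X \<Longrightarrow> y \<in> X \<Longrightarrow> x \<noteq> y \<Longrightarrow> F x \<inter> F y = {}" "\<And>x. x \<in> X \<Longrightarrow> F x \<noteq> {}"
  shows "inj_on F X" "disjoint (F ` X)"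
proof -
  show "inj_on F X"
    using assms by (intro inj_onI) (metis inf.idem)
  show "disjoint (F ` X)"
    using assms(1) unfolding disjoint_def by blast
qed

lemma disjoint_Union_Int:
  assumes "disjoint \<P>" "\<A> \<subseteq> \<P>" "\<B> \<subseteq> \<P>" "\<A> \<inter> \<B> = {}"
  shows "\<Union>\<A> \<inter> \<Union>\<B> = {}"
proof -
  have "A \<inter> B = {}" if "A \<in> \<A>" "B \<in> \<B>" for A B
    using assms that by (intro disjointD[OF assms(1)]) auto
  then show ?thesis by blast
qed

context symrel begin

lemma K24_family:
  assumes "conn A" "conn B" "A \<subseteq> V" "B \<subseteq> V" "A \<inter> B = {}" "4 \<le> card \<M>" "disjoint \<M>"
    and "\<And>M. M \<in> \<M> \<Longrightarrow> conn M \<and> M \<subseteq> V \<and> M \<inter> A = {} \<and> M \<inter> B = {} \<and> adjS M A \<and> adjS M B"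
  shows "K24 V"
  by (rule K24I[where M = "\<lambda>x. x" and I = \<M>, OF assms(1-6) _ assms(8)])
    (use assms(7) in \<open>auto simp: disjoint_def disjoint_family_on_def\<close>)

lemma chain_Cons:
  assumes c: "chain C n D" and A: "conn A" "A \<inter> C = {}" "0 < n" "adjS A (D 0)"
  shows "chain (A \<union> C) (Suc n) (case_nat A D)"
  unfolding chain_def
proof (intro conjI allI impI)
  have D: "\<And>i. i < n \<Longrightarrow> D i \<subseteq> C" using c unfolding chain_def by blast
  {
    fix i assume "i < Suc n"
    then show "conn (case_nat A D i)" using c A(1) unfolding chain_def by (cases i) auto
  next
    show "disjoint_family_on (case_nat A D) {..<Suc n}"
      unfolding disjoint_family_on_def
    proof (intro ballI impI)
      fix i j assume ij: "i \<in> {..<Suc n}" "j \<in> {..<Suc n}" "i \<noteq> j"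
      show "case_nat A D i \<inter> case_nat A D j = {}"
      proof (cases i)
        case 0
        then obtain j' where "j = Suc j'" using ij by (cases j) auto
        with 0 ij D[of j'] A(2) show ?thesis by auto
      next
        case (Suc i')
        show ?thesis
        proof (cases j)
          case 0 with Suc ij D[of i'] A(2) show ?thesis by auto
        next
          case (Suc j')
          with \<open>i = Suc i'\<close> ij have "D i' \<inter> D j' = {}"
            using c unfolding chain_def by (intro disjoint_family_onD[of D "{..<n}"]) auto
          with Suc \<open>i = Suc i'\<close> show ?thesis by simp
        qed
      qed
    qed
  next
    have "(\<Union>i<Suc n. case_nat A D i) = A \<union> (\<Union>i<n. D i)"
      unfolding lessThan_Suc_eq_insert_0 by simp
    then show "(\<Union>i<Suc n. case_nat A D i) = A \<union> C" using c unfolding chain_def by simp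
  next
    fix i assume "Suc i < Suc n"
    then show "adjS (case_nat A D i) (case_nat A D (Suc i))"
      using c A(4) unfolding chain_def by (cases i) auto
  }
qed

lemma chain_grow:
  assumes c: "chain C n D" and A: "conn A" "A \<inter> C = {}" "0 < n" "adjS A (D 0)"
  shows "chain (A \<union> C) n (D(0 := A \<union> D 0))"
  unfolding chain_def
proof (intro conjI allI impI)
  have D: "\<And>i. i < n \<Longrightarrow> D i \<subseteq> C" using c unfolding chain_def by blast
  {
    fix i assume "i < n"
    then show "conn ((D(0 := A \<union> D 0)) i)"
      using c A unfolding chain_def by (cases "i = 0") (auto intro: conn_Un)
  next
    show "disjoint_family_on (D(0 := A \<union> D 0)) {..<n}"
      unfolding disjoint_family_on_def
    proof (intro ballI impI)
      fix i j assume ij: "i \<in> {..<n}" "j \<in> {..<n}" "i \<noteq> j"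
      then have "D i \<inter> D j = {}"
        using c unfolding chain_def by (intro disjoint_family_onD[of D "{..<n}"]) auto
      then show "(D(0 := A \<union> D 0)) i \<inter> (D(0 := A \<union> D 0)) j = {}"
        using D[of i] D[of j] ij A(2) by (cases "i = 0"; cases "j = 0") auto
    qed
  next
    have "{..<n} = insert 0 ({..<n} - {0})" using A(3) by auto
    moreover have "(\<Union>i<n. D i) = C" using c unfolding chain_def by blast
    ultimately have "C = D 0 \<union> (\<Union>i\<in>{..<n} - {0}. D i)" by (metis UN_insert)
    moreover have "(\<Union>i<n. (D(0 := A \<union> D 0)) i) = (A \<union> D 0) \<union> (\<Union>i\<in>{..<n} - {0}. D i)"
      using A(3) by (auto split: if_splits)
    ultimately show "(\<Union>i<n. (D(0 := A \<union> D 0)) i) = A \<union> C" by auto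
  next
    fix i assume "Suc i < n"
    then have "adjS (D i) (D (Suc i))" using c unfolding chain_def by blast
    then have "adjS ((D(0 := A \<union> D 0)) i) (D (Suc i))"
      by (rule adjS_mono) auto
    then show "adjS ((D(0 := A \<union> D 0)) i) ((D(0 := A \<union> D 0)) (Suc i))" by simp
  }
qed

text \<open>Remove the root \<open>r\<close>. If \<open>N\<close> components of the rest contain
  marks, they are legs at \<open>r\<close>. Otherwise one component keeps \<open>N ^ (n - 1)\<close>
  marks, and the search goes on in it from a neighbour of \<open>r\<close>. What is left behind is
  connected and becomes, or enlarges, the first piece of the chain found there. The clause
  \<open>r \<in> D 0\<close> is what lets this piece attach.\<close>

lemma star_or_chain:
  assumes "finite S" "conn S" "r \<in> S" "M \<subseteq> S" "1 \<le> n" "2 \<le> N" "N ^ n \<le> card M"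
  shows "(\<exists>c\<in>S. \<exists>\<L>. N \<le> card \<L> \<and> disjoint \<L> \<and>
             (\<forall>L\<in>\<L>. conn L \<and> L \<subseteq> S - {c} \<and> adjS L {c} \<and> L \<inter> M \<noteq> {})) \<or>
         (\<exists>D. chain S n D \<and> r \<in> D 0 \<and> (\<forall>i<n. D i \<inter> M \<noteq> {}))"
    (is "?star S M \<or> ?chain S r M n")
  using assms
proof (induction "card S" arbitrary: S r M n rule: less_induct)
  case less
  have finM: "finite M" using less.prems finite_subset by blast
  show ?case
  proof (cases "n = 1")
    case True
    have "M \<noteq> {}" using less.prems by auto
    then have "chain S n (\<lambda>_. S) \<and> (\<forall>i<n. S \<inter> M \<noteq> {})"
      using True less.prems unfolding chain_def by (auto simp: disjoint_family_on_def)
    then show ?thesis using less.prems(3) by (intro disjI2 exI[of _ "\<lambda>_. S"]) auto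
  next
    case False
    then obtain k where k: "n = Suc k" "1 \<le> k" using less.prems by (cases n) auto
    define T where "T = S - {r}"
    define \<C> where "\<C> = {C \<in> cc T ` T. C \<inter> M \<noteq> {}}"
    have ST: "S - T = {r}" using less.prems unfolding T_def by auto
    have finT: "finite T" using less.prems unfolding T_def by simp
    have comp: "conn C \<and> C \<subseteq> T \<and> adjS C {r}" if C: "C \<in> \<C>" for C
    proof -
      from C obtain v where v: "v \<in> T" "C = cc T v" unfolding \<C>_def by blast
      have "adjS C (S - T)" using v less.prems T_def by (auto intro!: cc_adjS_compl)
      with v ST show ?thesis using conn_cc cc_subset by auto
    qed
    have fin: "finite \<C>" unfolding \<C>_def using finT by simp
    show ?thesis
    proof (cases "N \<le> card \<C>")
      case True
      have "disjoint \<C>" using disjoint_cc[of T] unfolding \<C>_def disjoint_def by blast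
      with True comp have "?star S M"
        using less.prems(3) unfolding T_def by (intro bexI[of _ r] exI[of _ \<C>]) (auto simp: \<C>_def)
      then show ?thesis by blast
    next
      case few: False
      \<comment> \<open>Fewer than \<open>N\<close> components with fewer than \<open>N ^ k\<close>
        marks each, and possibly \<open>r\<close> itself, hold at most
        \<open>(N - 1) * (N ^ k - 1) + 1\<close> marks, which is less than
        \<open>N ^ n\<close>.\<close>
      have "\<exists>C\<in>\<C>. N ^ k \<le> card (M \<inter> C)"
      proof (rule ccontr)
        assume "\<not> ?thesis"
        then have small: "\<And>C. C \<in> \<C> \<Longrightarrow> card (M \<inter> C) \<le> N ^ k - 1" by fastforce
        have "M \<subseteq> insert r (\<Union>C\<in>\<C>. M \<inter> C)"
        proof
          fix x assume x: "x \<in> M"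
          show "x \<in> insert r (\<Union>C\<in>\<C>. M \<inter> C)"
          proof (cases "x = r")
            case False
            then have "x \<in> T" using x less.prems unfolding T_def by auto
            then have "cc T x \<in> \<C>" "x \<in> cc T x" using x cc_self[of x T] unfolding \<C>_def by auto
            then show ?thesis using x by blast
          qed simp
        qed
        then have "card M \<le> card (insert r (\<Union>C\<in>\<C>. M \<inter> C))"
          using fin finM by (intro card_mono) auto
        also have "\<dots> \<le> Suc (card (\<Union>C\<in>\<C>. M \<inter> C))"
          by (rule card_insert_le_m1) auto
        also have "card (\<Union>C\<in>\<C>. M \<inter> C) \<le> (\<Sum>C\<in>\<C>. card (M \<inter> C))"
          using fin by (rule card_UN_le)
        also have "\<dots> \<le> card \<C> * (N ^ k - 1)"
          using sum_bounded_above[of \<C> "\<lambda>C. card (M \<inter> C)" "N ^ k - 1"] small by simp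
        also have "\<dots> \<le> (N - 1) * (N ^ k - 1)"
          using few by (intro mult_right_mono) auto
        finally have le: "card M \<le> Suc ((N - 1) * (N ^ k - 1))" by simp
        obtain a where a: "N = Suc (Suc a)" using less.prems(6) by (metis Suc_le_D numeral_2_eq_2 Suc_le_mono)
        obtain b where b: "N ^ k = Suc b" using less.prems(6) by (cases "N ^ k") auto
        have "N ^ n = Suc (Suc a) * Suc b" using k a b by simp
        then have "Suc ((N - 1) * (N ^ k - 1)) < N ^ n" unfolding a b using a b by simp
        with le less.prems(7) show False by simp
      qed
      then obtain C where C: "C \<in> \<C>" "N ^ k \<le> card (M \<inter> C)" by blast
      obtain r' where r': "r' \<in> C" "adj r r'" using comp[OF C(1)] sym unfolding adjS_def by blast
      have CS: "C \<subseteq> S" "r \<notin> C" using comp[OF C(1)] unfolding T_def by auto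
      have cardC: "card C < card S"
        using CS less.prems by (intro psubset_card_mono) auto
      have finC: "finite C" using CS less.prems finite_subset by blast
      obtain v where v: "v \<in> T" "C = cc T v" using C(1) unfolding \<C>_def by blast
      have SC: "conn (S - C)"
        using conn_compl_cc[of S "{r}" v] v less.prems conn_sing unfolding T_def by auto
      have disj: "(S - C) \<inter> C = {}" and un: "S - C \<union> C = S" using CS by auto
      have connC: "conn C" using comp[OF C(1)] by blast
      have star_mono: "?star S M" if st: "?star C M'" and M': "M' \<subseteq> M" for M'
      proof -
        from st obtain c \<L> where c: "c \<in> C" "N \<le> card \<L>" "disjoint \<L>"
          "\<forall>L\<in>\<L>. conn L \<and> L \<subseteq> C - {c} \<and> adjS L {c} \<and> L \<inter> M' \<noteq> {}" by blast
        then have "\<forall>L\<in>\<L>. conn L \<and> L \<subseteq> S - {c} \<and> adjS L {c} \<and> L \<inter> M \<noteq> {}"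
          using CS M' by blast
        with c CS show ?thesis by blast
      qed
      have adjD: "adjS (S - C) D0" if "r' \<in> D0" for D0
        using that r' CS less.prems(3) by (auto intro!: adjSI[of r r'])
      show ?thesis
      \<comment> \<open>If all marks lie in \<open>C\<close>, then \<open>S - C\<close> has none to
        offer as a piece of its own. It is merged into the first piece and \<open>n\<close> does not
        drop, which is why the induction is on \<open>card S\<close>.\<close>
      proof (cases "M \<subseteq> C")
        case True
        from less.hyps[OF cardC finC connC r'(1) True less.prems(5-7)]
        show ?thesis
        proof
          assume "?star C M" with star_mono[of M] show ?thesis by blast
        next
          assume "?chain C r' M n"
          then obtain D where D: "chain C n D" "r' \<in> D 0" "\<forall>i<n. D i \<inter> M \<noteq> {}" by blast
          have "chain S n (D(0 := S - C \<union> D 0))"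
            using chain_grow[OF D(1) SC disj _ adjD[OF D(2)]] less.prems un by simp
          moreover have "\<forall>i<n. (D(0 := S - C \<union> D 0)) i \<inter> M \<noteq> {}" using D(3) by auto
          moreover have "r \<in> (D(0 := S - C \<union> D 0)) 0" using less.prems(3) CS by auto
          ultimately have "?chain S r M n" by blast
          then show ?thesis ..
        qed
      next
        case False
        from less.hyps[OF cardC finC connC r'(1) _ k(2) less.prems(6) C(2)]
        have "?star C (M \<inter> C) \<or> ?chain C r' (M \<inter> C) k" by blast
        then show ?thesis
        proof
          assume "?star C (M \<inter> C)" with star_mono[of "M \<inter> C"] show ?thesis by blast
        next
          assume "?chain C r' (M \<inter> C) k"
          then obtain D where D: "chain C k D" "r' \<in> D 0" "\<forall>i<k. D i \<inter> (M \<inter> C) \<noteq> {}" by blast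
          have "chain S n (case_nat (S - C) D)"
            using chain_Cons[OF D(1) SC disj _ adjD[OF D(2)]] un k by simp
          moreover have "\<forall>i<n. case_nat (S - C) D i \<inter> M \<noteq> {}"
          proof (intro allI impI)
            fix i assume "i < n"
            then show "case_nat (S - C) D i \<inter> M \<noteq> {}"
              using D(3) k(1) False less.prems(4) by (cases i) auto
          qed
          moreover have "r \<in> case_nat (S - C) D 0" using less.prems(3) CS by auto
          ultimately have "?chain S r M n" by blast
          then show ?thesis ..
        qed
      qed
    qed
  qed
qed

section \<open>Contraction as a relation between disjoint connected sets\<close>

lemma quot_symrel: "symrel adjS"
  by unfold_locales (simp add: adjS_commute)

lemma quot_adjS: "symrel.adjS adjS \<A> \<B> \<longleftrightarrow> adjS (\<Union>\<A>) (\<Union>\<B>)"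
proof -
  interpret Q: symrel adjS by (rule quot_symrel)
  show ?thesis unfolding Q.adjS_def unfolding adjS_def by blast
qed

text \<open>A cut of the union either cuts some member, which is connected, or is a cut of the
  family, and then two members are adjacent across it.\<close>

lemma conn_Union_quot:
  assumes "symrel.conn adjS \<S>" "\<And>P. P \<in> \<S> \<Longrightarrow> conn P"
  shows "conn (\<Union>\<S>)"
proof -
  interpret Q: symrel adjS by (rule quot_symrel)
  show ?thesis
    unfolding conn_def
  proof (intro conjI allI impI)
    show "\<Union>\<S> \<noteq> {}" using Q.conn_nonempty[OF assms(1)] assms(2) conn_nonempty by blast
    fix A assume A: "A \<subseteq> \<Union>\<S>" "A \<noteq> {}" "A \<noteq> \<Union>\<S>"
    show "\<exists>a\<in>A. \<exists>b\<in>\<Union>\<S> - A. adj a b"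
    proof (cases "\<exists>P\<in>\<S>. P \<inter> A \<noteq> {} \<and> P \<inter> A \<noteq> P")
      case True
      then obtain P where P: "P \<in> \<S>" "P \<inter> A \<noteq> {}" "P \<inter> A \<noteq> P" by blast
      then have "adjS (P \<inter> A) (P - P \<inter> A)" using assms(2) by (intro conn_cut) auto
      then show ?thesis using P(1) unfolding adjS_def by blast
    next
      case False
      define \<A> where "\<A> = {P \<in> \<S>. P \<inter> A \<noteq> {}}"
      have "\<A> \<subseteq> \<S>" "\<A> \<noteq> {}" "\<A> \<noteq> \<S>" using A False unfolding \<A>_def by blast+
      from Q.conn_cut[OF assms(1) this] obtain P R where PR: "P \<in> \<A>" "R \<in> \<S> - \<A>" "adjS P R"
        unfolding Q.adjS_def by blast
      then have "P \<subseteq> A" "R \<inter> A = {}" "R \<in> \<S>" using False unfolding \<A>_def by blast+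
      with PR(3) show ?thesis unfolding adjS_def by blast
    qed
  qed
qed

lemma quot_conn:
  assumes "conn (\<Union>\<S>)" "disjoint \<S>" "\<And>P. P \<in> \<S> \<Longrightarrow> P \<noteq> {}"
  shows "symrel.conn adjS \<S>"
proof -
  interpret Q: symrel adjS by (rule quot_symrel)
  show ?thesis
    unfolding Q.conn_def
  proof (intro conjI allI impI)
    show "\<S> \<noteq> {}" using conn_nonempty[OF assms(1)] by blast
    fix \<A> assume A: "\<A> \<subseteq> \<S>" "\<A> \<noteq> {}" "\<A> \<noteq> \<S>"
    have d: "\<Union>\<A> \<inter> \<Union>(\<S> - \<A>) = {}" by (rule disjoint_Union_Int[OF assms(2)]) (use A in auto)
    have "\<Union>\<A> \<noteq> {}" "\<Union>(\<S> - \<A>) \<noteq> {}" using A assms(3) by blast+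
    with d A have "\<Union>\<A> \<subseteq> \<Union>\<S>" "\<Union>\<A> \<noteq> {}" "\<Union>\<A> \<noteq> \<Union>\<S>" by blast+
    from conn_cut[OF assms(1) this] show "\<exists>a\<in>\<A>. \<exists>b\<in>\<S> - \<A>. adjS a b"
      unfolding adjS_def by blast
  qed
qed

lemma quot_K24:
  assumes "symrel.K24 adjS \<P>" "disjoint \<P>" "\<And>P. P \<in> \<P> \<Longrightarrow> conn P"
  shows "K24 (\<Union>\<P>)"
proof -
  interpret Q: symrel adjS by (rule quot_symrel)
  obtain A B \<M> where h: "Q.conn A" "Q.conn B" "A \<subseteq> \<P>" "B \<subseteq> \<P>" "A \<inter> B = {}" "card \<M> = 4" "disjoint \<M>"
    "\<forall>M\<in>\<M>. Q.conn M \<and> M \<subseteq> \<P> \<and> M \<inter> A = {} \<and> M \<inter> B = {} \<and> Q.adjS M A \<and> Q.adjS M B"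
    using Q.K24E[OF assms(1)] .
  have cU: "conn (\<Union>\<S>)" if "Q.conn \<S>" "\<S> \<subseteq> \<P>" for \<S>
    using that assms(3) by (intro conn_Union_quot) auto
  show ?thesis
  proof (rule K24I[where I = \<M> and M = Union])
    show "conn (\<Union>A)" "conn (\<Union>B)" using cU h by auto
    show "\<Union>A \<subseteq> \<Union>\<P>" "\<Union>B \<subseteq> \<Union>\<P>" using h by auto
    show "\<Union>A \<inter> \<Union>B = {}" using h by (intro disjoint_Union_Int[OF assms(2)])
    show "4 \<le> card \<M>" using h by simp
    show "disjoint_family_on Union \<M>"
      unfolding disjoint_family_on_def
    proof (intro ballI impI)
      fix M N assume "M \<in> \<M>" "N \<in> \<M>" "M \<noteq> N"
      with h show "\<Union>M \<inter> \<Union>N = {}"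
        by (intro disjoint_Union_Int[OF assms(2)]) (auto dest: disjointD)
    qed
    fix M assume "M \<in> \<M>"
    with h(8) have M: "Q.conn M" "M \<subseteq> \<P>" "M \<inter> A = {}" "M \<inter> B = {}" "Q.adjS M A" "Q.adjS M B" by auto
    show "conn (\<Union>M) \<and> \<Union>M \<subseteq> \<Union>\<P> \<and> \<Union>M \<inter> \<Union>A = {} \<and> \<Union>M \<inter> \<Union>B = {} \<and> adjS (\<Union>M) (\<Union>A) \<and> adjS (\<Union>M) (\<Union>B)"
    proof (intro conjI)
      show "conn (\<Union>M)" using cU M by auto
      show "\<Union>M \<subseteq> \<Union>\<P>" using M by auto
      show "\<Union>M \<inter> \<Union>A = {}" using M h by (intro disjoint_Union_Int[OF assms(2)])
      show "\<Union>M \<inter> \<Union>B = {}" using M h by (intro disjoint_Union_Int[OF assms(2)])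
      show "adjS (\<Union>M) (\<Union>A)" "adjS (\<Union>M) (\<Union>B)" using M quot_adjS by auto
    qed
  qed
qed

text \<open>\<open>star_or_chain\<close> with disjoint connected marks in place of marked vertices:
  contract the marks, keep the other vertices as singletons, and take unions in the end. The centre
  of the star may be a contracted mark, so the hub \<open>H\<close> is a set.\<close>

lemma marked_star_or_chain:
  assumes "finite S" "conn S" and L: "disjoint_family_on L I" "\<And>i. i \<in> I \<Longrightarrow> conn (L i) \<and> L i \<subseteq> S"
    and n: "1 \<le> n" "2 \<le> N" "N ^ n \<le> card I"
  shows "(\<exists>H \<L>. conn H \<and> H \<subseteq> S \<and> N \<le> card \<L> \<and> disjoint \<L> \<and>
             (\<forall>P\<in>\<L>. conn P \<and> P \<subseteq> S - H \<and> adjS P H \<and> (\<exists>i\<in>I. L i \<subseteq> P))) \<or>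
         (\<exists>D. chain S n D \<and> (\<forall>k<n. \<exists>i\<in>I. L i \<subseteq> D k))"
proof -
  interpret Q: symrel adjS by (rule quot_symrel)
  define \<P> where "\<P> = L ` I \<union> (\<lambda>v. {v}) ` (S - \<Union>(L ` I))"
  have UP: "\<Union>\<P> = S" unfolding \<P>_def using L(2) by auto
  have connP: "\<And>P. P \<in> \<P> \<Longrightarrow> conn P" unfolding \<P>_def using L(2) conn_sing by auto
  have Lne: "\<And>i. i \<in> I \<Longrightarrow> L i \<noteq> {}" using L(2) conn_nonempty by blast
  have dL: "\<And>i j. i \<in> I \<Longrightarrow> j \<in> I \<Longrightarrow> i \<noteq> j \<Longrightarrow> L i \<inter> L j = {}"
    using L(1) by (simp add: disjoint_family_onD)
  have inj: "inj_on L I" and disjL: "disjoint (L ` I)"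
    using disjoint_image_of[of I L, OF dL Lne] by auto
  have disjP: "disjoint \<P>"
    using disjL unfolding \<P>_def disjoint_def by blast
  have finP: "finite \<P>"
    using assms(1) UP by (metis finite_UnionD)
  have cP: "Q.conn \<P>" by (rule quot_conn) (use UP assms(2) disjP connP conn_nonempty in auto)
  have cI: "N ^ n \<le> card (L ` I)" using n(3) inj by (simp add: card_image)
  obtain R where R: "R \<in> \<P>" using Q.conn_nonempty[OF cP] by blast
  have "L ` I \<subseteq> \<P>" unfolding \<P>_def by blast
  have cU: "conn (\<Union>\<S>)" if "Q.conn \<S>" "\<S> \<subseteq> \<P>" for \<S>
    using that connP by (intro conn_Union_quot) auto
  from Q.star_or_chain[OF finP cP R \<open>L ` I \<subseteq> \<P>\<close> n(1,2) cI] show ?thesis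
  proof (elim disjE bexE exE conjE)
    fix c \<L> assume c: "c \<in> \<P>" "N \<le> card \<L>" "disjoint \<L>"
      "\<forall>La\<in>\<L>. Q.conn La \<and> La \<subseteq> \<P> - {c} \<and> Q.adjS La {c} \<and> La \<inter> L ` I \<noteq> {}"
    have d: "\<Union>X \<inter> \<Union>Y = {}" if "X \<in> \<L>" "Y \<in> \<L>" "X \<noteq> Y" for X Y
      using that c by (intro disjoint_Union_Int[OF disjP]) (auto dest: disjointD)
    have ne: "\<Union>X \<noteq> {}" if "X \<in> \<L>" for X
    proof -
      have "Q.conn X" "X \<subseteq> \<P>" using that c(4) by auto
      then show ?thesis using cU conn_nonempty by blast
    qed
    have "N \<le> card (Union ` \<L>)" "disjoint (Union ` \<L>)"
      using disjoint_image_of[of \<L> Union, OF d ne] c(2) by (auto simp: card_image)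
    moreover have "conn P \<and> P \<subseteq> S - c \<and> adjS P c \<and> (\<exists>i\<in>I. L i \<subseteq> P)" if "P \<in> Union ` \<L>" for P
    proof -
      from that obtain X where X: "X \<in> \<L>" "P = \<Union>X" by blast
      with c have X': "Q.conn X" "X \<subseteq> \<P> - {c}" "Q.adjS X {c}" "X \<inter> L ` I \<noteq> {}" by auto
      have "\<Union>X \<inter> \<Union>{c} = {}" by (rule disjoint_Union_Int[OF disjP]) (use X' c in auto)
      with X' X show ?thesis using cU[of X] UP quot_adjS[of X "{c}"] by auto
    qed
    ultimately show ?thesis
      using connP[OF c(1)] c(1) UP by (intro disjI1 exI[of _ c] exI[of _ "Union ` \<L>"]) auto
  next
    fix D assume D: "Q.chain \<P> n D" "\<forall>i<n. D i \<inter> L ` I \<noteq> {}"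
    have sub: "\<And>i. i < n \<Longrightarrow> D i \<subseteq> \<P>" using D(1) unfolding Q.chain_def by blast
    have "chain S n (\<lambda>i. \<Union>(D i))"
      unfolding chain_def
    proof (intro conjI allI impI)
      fix i assume "i < n" then show "conn (\<Union>(D i))"
        using D(1) cU sub unfolding Q.chain_def by auto
    next
      show "disjoint_family_on (\<lambda>i. \<Union>(D i)) {..<n}"
        unfolding disjoint_family_on_def
      proof (intro ballI impI)
        fix i j assume ij: "i \<in> {..<n}" "j \<in> {..<n}" "i \<noteq> j"
        then have "D i \<inter> D j = {}"
          using D(1) unfolding Q.chain_def by (intro disjoint_family_onD[of D "{..<n}"]) auto
        with ij sub show "\<Union>(D i) \<inter> \<Union>(D j) = {}" by (intro disjoint_Union_Int[OF disjP]) auto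
      qed
    next
      have "(\<Union>i<n. D i) = \<P>" using D(1) unfolding Q.chain_def by blast
      then show "(\<Union>i<n. \<Union>(D i)) = S" using UP by blast
    next
      fix i assume "Suc i < n"
      then show "adjS (\<Union>(D i)) (\<Union>(D (Suc i)))"
        using D(1) unfolding Q.chain_def quot_adjS by blast
    qed
    moreover have "\<forall>k<n. \<exists>i\<in>I. L i \<subseteq> \<Union>(D k)" using D(2) by blast
    ultimately show ?thesis by blast
  qed
qed

text \<open>Whether \<open>A\<close> is cut into a star or into a chain, it yields four middle pieces.\<close>

lemma K24_three_hubs:
  assumes "finite A" "conn A" "conn B" "conn C" "A \<inter> B = {}" "A \<inter> C = {}" "B \<inter> C = {}"
    and L: "disjoint_family_on L I" "\<And>i. i \<in> I \<Longrightarrow> conn (L i) \<and> L i \<subseteq> A \<and> adjS (L i) B \<and> adjS (L i) C"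
    and I: "4 ^ 4 \<le> card I"
  shows "K24 (A \<union> B \<union> C)"
proof -
  have piece: "K24 (A \<union> B \<union> C)" if "4 \<le> card \<M>" "disjoint \<M>"
    "\<And>P. P \<in> \<M> \<Longrightarrow> conn P \<and> P \<subseteq> A \<and> (\<exists>i\<in>I. L i \<subseteq> P)" for \<M>
  proof (rule K24_family[OF assms(3,4) _ _ assms(7) that(1,2)])
    fix P assume "P \<in> \<M>"
    then have P: "conn P" "P \<subseteq> A" "\<exists>i\<in>I. L i \<subseteq> P" using that(3) by auto
    then have "adjS P B" "adjS P C" using L(2) adjS_mono by blast+
    with P assms show "conn P \<and> P \<subseteq> A \<union> B \<union> C \<and> P \<inter> B = {} \<and> P \<inter> C = {} \<and> adjS P B \<and> adjS P C"
      by blast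
  qed auto
  \<comment> \<open>Four legs or four chain pieces: this is the origin of \<open>4 ^ 4\<close>. Each
    of them contains a whole \<open>L i\<close> and inherits its contacts with \<open>B\<close> and
    \<open>C\<close>.\<close>
  from marked_star_or_chain[OF assms(1,2) L(1), of 4 4] L(2) I
  consider (star) H \<L> where "4 \<le> card \<L>" "disjoint \<L>"
      "\<forall>P\<in>\<L>. conn P \<and> P \<subseteq> A - H \<and> adjS P H \<and> (\<exists>i\<in>I. L i \<subseteq> P)"
    | (chain) D where "chain A 4 D" "\<forall>k<4. \<exists>i\<in>I. L i \<subseteq> D k"
    by auto
  then show ?thesis
  proof cases
    case star
    then show ?thesis by (intro piece[of \<L>]) auto
  next
    case chain
    have cD: "\<And>i. i < 4 \<Longrightarrow> conn (D i)" "disjoint_family_on D {..<4}" "(\<Union>i<4. D i) = A"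
      using chain(1) unfolding chain_def by auto
    have d: "inj_on D {..<4}" "disjoint (D ` {..<4})"
      using disjoint_image_of[of "{..<4}" D] cD conn_nonempty by (auto simp: disjoint_family_on_def)
    show ?thesis
    proof (rule piece)
      show "4 \<le> card (D ` {..<4})" using card_image[OF d(1)] by simp
      show "disjoint (D ` {..<4})" by (rule d)
      fix P assume "P \<in> D ` {..<4}"
      then obtain i where "i < 4" "P = D i" by auto
      then show "conn P \<and> P \<subseteq> A \<and> (\<exists>i\<in>I. L i \<subseteq> P)" using cD chain(2) by blast
    qed
  qed
qed

end

section \<open>Hops between a chain and its complement\<close>

lemma pigeonhole_fiber:
  assumes "finite A" "f ` A \<subseteq> B" "finite B" "card B * k < card A"
  shows "\<exists>y\<in>B. k < card {x \<in> A. f x = y}"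
proof (rule ccontr)
  assume "\<not> ?thesis"
  then have le: "\<And>y. y \<in> B \<Longrightarrow> card {x \<in> A. f x = y} \<le> k" by auto
  have "A = (\<Union>y\<in>B. {x \<in> A. f x = y})" using assms(2) by auto
  then have "card A = card (\<Union>y\<in>B. {x \<in> A. f x = y})" by simp
  also have "\<dots> \<le> (\<Sum>y\<in>B. card {x \<in> A. f x = y})" by (rule card_UN_le[OF assms(3)])
  also have "\<dots> \<le> card B * k" using sum_bounded_above[of B _ k] le by simp
  finally show False using assms(4) by simp
qed

context symrel begin

lemma K24_four:
  assumes "conn A" "conn B" "conn P" "conn Q" "conn R" "conn T"
    and "A \<subseteq> V" "B \<subseteq> V" "P \<subseteq> V" "Q \<subseteq> V" "R \<subseteq> V" "T \<subseteq> V"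
    and "A \<inter> B = {}" "P \<inter> A = {}" "P \<inter> B = {}" "Q \<inter> A = {}" "Q \<inter> B = {}"
      "R \<inter> A = {}" "R \<inter> B = {}" "T \<inter> A = {}" "T \<inter> B = {}"
    and "P \<inter> Q = {}" "P \<inter> R = {}" "P \<inter> T = {}" "Q \<inter> R = {}" "Q \<inter> T = {}" "R \<inter> T = {}"
    and "adjS P A" "adjS P B" "adjS Q A" "adjS Q B" "adjS R A" "adjS R B" "adjS T A" "adjS T B"
  shows "K24 V"
proof -
  let ?M = "\<lambda>i::nat. if i = 0 then P else if i = 1 then Q else if i = 2 then R else T"
  have i: "i = 0 \<or> i = 1 \<or> i = 2 \<or> i = 3" if "i \<in> {..<4}" for i :: nat using that by auto
  show ?thesis
  proof (rule K24I[where I = "{..<4}" and M = ?M, OF assms(1,2,7,8,13)])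
    show "disjoint_family_on ?M {..<4}"
      unfolding disjoint_family_on_def
    proof (intro ballI impI)
      fix i j :: nat assume "i \<in> {..<4}" "j \<in> {..<4}" "i \<noteq> j"
      then have "i = 0 \<or> i = 1 \<or> i = 2 \<or> i = 3" "j = 0 \<or> j = 1 \<or> j = 2 \<or> j = 3" "i \<noteq> j"
        using i by blast+
      then show "?M i \<inter> ?M j = {}"
        by (elim disjE) (use assms(22-27) in \<open>simp_all add: Int_commute\<close>)
    qed
    fix i :: nat assume "i \<in> {..<4}"
    then have "i = 0 \<or> i = 1 \<or> i = 2 \<or> i = 3" by (rule i)
    then show "conn (?M i) \<and> ?M i \<subseteq> V \<and> ?M i \<inter> A = {} \<and> ?M i \<inter> B = {} \<and> adjS (?M i) A \<and> adjS (?M i) B"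
      by (elim disjE) (use assms in simp_all)
  qed simp
qed

text \<open>\<open>Q\<close> is by convention the side of \<open>r\<close>: it keeps the contact
  with the surroundings, while \<open>P\<close> carries exactly one of \<open>c\<close> and
  \<open>d\<close>.\<close>

lemma split_at:
  assumes "conn F" "c \<in> F" "d \<in> F" "c \<noteq> d" "r \<in> F"
  obtains P Q where "conn P" "conn Q" "P \<inter> Q = {}" "P \<union> Q = F" "adjS P Q" "r \<in> Q"
    "c \<in> P \<and> d \<in> Q \<or> d \<in> P \<and> c \<in> Q"
proof -
  obtain C where C: "C \<subseteq> F" "conn C" "conn (F - C)" "c \<in> C" "d \<in> F - C"
    using extend_disjoint_conn[OF assms(1) conn_sing conn_sing, of c d] assms by auto
  have adj: "adjS C (F - C)" using C by (intro conn_cut[OF assms(1)]) auto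
  show ?thesis
  proof (cases "r \<in> C")
    case True
    show ?thesis by (rule that[of "F - C" C]) (use True C adj adjS_commute in auto)
  next
    case False
    show ?thesis by (rule that[of C "F - C"]) (use False C adj assms in auto)
  qed
qed

end

text \<open>The situation after contracting all monochromatic components: a path inside one colour
  class has to alternate between \<open>S\<close> and \<open>E\<close>. The conditions
  \<open>x \<noteq> y\<close> are there because a contracted set can be adjacent to itself. The aim
  is a bound on \<open>m\<close>.\<close>

locale two_coloured_hops = symrel adj for adj :: "'v \<Rightarrow> 'v \<Rightarrow> bool" +
  fixes S E :: "'v set" and col :: "'v \<Rightarrow> bool" and B :: "nat \<Rightarrow> 'v set" and m :: nat
  assumes finite_S: "finite S" and finite_E: "finite E" and conn_E: "conn E" and disj_SE: "S \<inter> E = {}"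
    and conn_col: "conn {x \<in> S \<union> E. col x = c}"
    and indep_S: "x \<in> S \<Longrightarrow> y \<in> S \<Longrightarrow> x \<noteq> y \<Longrightarrow> adj x y \<Longrightarrow> col x \<noteq> col y"
    and indep_E: "x \<in> E \<Longrightarrow> y \<in> E \<Longrightarrow> x \<noteq> y \<Longrightarrow> adj x y \<Longrightarrow> col x \<noteq> col y"
    and chain_B: "chain S m B"
    and col_B: "j < m \<Longrightarrow> \<exists>x\<in>B j. col x = c"
    and m2: "2 \<le> m"
    and no_K24: "\<not> K24 (S \<union> E)"
begin

section \<open>Blocks touched and cuts crossed by a hop\<close>

definition touch :: "'v \<Rightarrow> nat \<Rightarrow> bool" where
  "touch h j \<longleftrightarrow> j < m \<and> (\<exists>x\<in>B j. adj h x)"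

text \<open>Cut \<open>t\<close> separates the blocks below \<open>t\<close> from those at
  \<open>t\<close> and later. A vertex \<open>h\<close> of \<open>E\<close> that crosses it is a hop
  linking the two sides outside of \<open>S\<close>.\<close>

definition cross :: "'v \<Rightarrow> nat \<Rightarrow> bool" where
  "cross h t \<longleftrightarrow> (\<exists>j<t. touch h j) \<and> (\<exists>j\<ge>t. touch h j)"

abbreviation seg :: "nat \<Rightarrow> nat \<Rightarrow> 'v set" where
  "seg a b \<equiv> \<Union>i\<in>{a..<b}. B i"

lemma B_subset: "j < m \<Longrightarrow> B j \<subseteq> S"
  using chain_B unfolding chain_def by blast

lemma B_disjoint: "i < m \<Longrightarrow> j < m \<Longrightarrow> i \<noteq> j \<Longrightarrow> B i \<inter> B j = {}"
  using chain_B unfolding chain_def by (auto dest: disjoint_family_onD)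

lemma seg_subset: "b \<le> m \<Longrightarrow> seg a b \<subseteq> S"
  by (rule chain_seg_subset[OF chain_B])

lemma seg_all: "seg 0 m = S"
  using chain_B unfolding chain_def by (simp add: atLeast0LessThan)

lemma conn_S: "conn S"
  using chain_seg[OF chain_B, of 0 m] m2 seg_all by simp

lemma S_block: "x \<in> S \<Longrightarrow> \<exists>j<m. x \<in> B j"
  using chain_B unfolding chain_def by blast

lemma touch_seg: "touch h j \<Longrightarrow> a \<le> j \<Longrightarrow> j < b \<Longrightarrow> h \<in> X \<Longrightarrow> adjS X (seg a b)"
  unfolding touch_def adjS_def by (meson UN_I atLeastLessThan_iff)

lemma touch_lt: "touch h j \<Longrightarrow> j < m"
  unfolding touch_def by blast

lemma cross_lt: "cross h t \<Longrightarrow> 0 < t \<and> t < m"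
  unfolding cross_def using touch_lt by fastforce

lemma cross_left: "cross h t \<Longrightarrow> h \<in> X \<Longrightarrow> adjS X (seg 0 t)"
  unfolding cross_def using touch_seg by blast

lemma cross_right: "cross h t \<Longrightarrow> h \<in> X \<Longrightarrow> adjS X (seg t m)"
  unfolding cross_def using touch_seg touch_lt by blast

lemma cross_convex: "cross h s \<Longrightarrow> cross h t \<Longrightarrow> s \<le> u \<Longrightarrow> u \<le> t \<Longrightarrow> cross h u"
  unfolding cross_def by (meson le_trans less_le_trans)

text \<open>A hop with a contact left of \<open>s\<close> that does not cross the later cut
  \<open>t\<close> has all its contacts before \<open>t\<close>; the one at or after
  \<open>s\<close> thus lies in the segment.\<close>

lemma cross_right_until:
  assumes "cross h s" "\<not> cross h t" "s < t" "h \<in> X"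
  shows "adjS X (seg s t)"
proof -
  obtain i j where ij: "i < s" "touch h i" "s \<le> j" "touch h j" using assms(1) unfolding cross_def by blast
  have "j < t" using ij assms(2,3) unfolding cross_def by (meson less_trans not_le)
  then show ?thesis using ij assms(4) touch_seg by blast
qed

lemma cross_left_until:
  assumes "cross h t" "\<not> cross h s" "s < t" "h \<in> X"
  shows "adjS X (seg s t)"
proof -
  obtain i j where ij: "i < t" "touch h i" "t \<le> j" "touch h j" using assms(1) unfolding cross_def by blast
  have "s \<le> i" using ij assms(2,3) unfolding cross_def by (meson less_imp_le le_trans not_le)
  then show ?thesis using ij assms(4) touch_seg by blast
qed

text \<open>The colour class of \<open>x\<close> has a vertex in another block and is connected, so
  \<open>x\<close> has a neighbour of its own colour, and \<open>indep_S\<close> forbids that one to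
  be in \<open>S\<close>.\<close>

lemma S_adj_E:
  assumes "x \<in> S"
  shows "\<exists>e\<in>E. col e = col x \<and> adj e x"
proof -
  let ?W = "{y \<in> S \<union> E. col y = col x}"
  obtain j where j: "j < m" "x \<in> B j" using S_block assms by blast
  define i where "i = (if j = 0 then 1 else 0::nat)"
  have i: "i < m" "i \<noteq> j" unfolding i_def using m2 by auto
  obtain y where y: "y \<in> B i" "col y = col x" using col_B[OF i(1)] by blast
  have "y \<noteq> x" using B_disjoint[OF i(1) j(1) i(2)] y j by blast
  moreover have "y \<in> ?W" using y B_subset[OF i(1)] by blast
  ultimately have "{x} \<noteq> ?W" by blast
  then have "adjS {x} (?W - {x})" using assms by (intro conn_cut[OF conn_col]) auto
  then obtain z where z: "z \<in> ?W" "x \<noteq> z" "adj x z" unfolding adjS_def by blast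
  then have "z \<in> E" using indep_S[OF assms, of z] by auto
  with z sym show ?thesis by blast
qed

lemma E_touch:
  assumes "e \<in> E"
  shows "\<exists>j. touch e j"
proof -
  let ?W = "{y \<in> S \<union> E. col y = col e}"
  have "0 < m" using m2 by simp
  then obtain y where y: "y \<in> B 0" "col y = col e" using col_B[of 0 "col e"] by blast
  have "y \<in> S" using y B_subset[of 0] m2 by auto
  then have "y \<in> ?W" "y \<noteq> e" using y assms disj_SE by auto
  then have "{e} \<noteq> ?W" by blast
  then have "adjS {e} (?W - {e})" using assms by (intro conn_cut[OF conn_col]) auto
  then obtain z where z: "z \<in> ?W" "e \<noteq> z" "adj e z" unfolding adjS_def by blast
  then have "z \<in> S" using indep_E[OF assms, of z] by auto
  then show ?thesis using z S_block unfolding touch_def by blast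
qed

lemma E_adj_S: "e \<in> E \<Longrightarrow> e \<in> X \<Longrightarrow> adjS X S"
  using E_touch[of e] touch_seg[of e _ 0 m X] touch_lt unfolding seg_all by blast

text \<open>Take the vertices of colour \<open>c\<close> in the segment and all hops of that colour
  next to them. The class also has a vertex in a block outside, so one of its edges leaves this set.
  An edge starting in \<open>S\<close> would end at a hop already included; so it starts at a hop
  and ends in a block outside the segment.\<close>

lemma leaving_hop:
  assumes "a < b" "b \<le> m" "0 < a \<or> b < m"
  obtains h i j where "h \<in> E" "col h = c" "touch h i" "a \<le> i" "i < b" "touch h j" "j < a \<or> b \<le> j"
proof (rule ccontr)
  assume "\<not> thesis"
  note that' = that
  have no: False if "h \<in> E" "col h = c" "touch h i" "i \<in> {a..<b}" "touch h j" "j \<notin> {a..<b}" for h i j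
    using \<open>\<not> thesis\<close> that'[of h i j] that by auto
  let ?W = "{x \<in> S \<union> E. col x = c}"
  define P where "P = {x \<in> seg a b. col x = c}"
  define A where "A = P \<union> {h \<in> E. col h = c \<and> (\<exists>x\<in>P. adj h x)}"
  have segS: "seg a b \<subseteq> S" using seg_subset assms by blast
  have AW: "A \<subseteq> ?W" unfolding A_def P_def using segS by auto
  obtain x where x: "x \<in> B a" "col x = c" using col_B[of a c] assms by auto
  then have "x \<in> P" unfolding P_def using assms by auto
  then have Ane: "A \<noteq> {}" unfolding A_def by blast
  define i where "i = (if 0 < a then 0 else b)"
  have i: "i < m" "i \<notin> {a..<b}" unfolding i_def using assms by auto
  obtain y where y: "y \<in> B i" "col y = c" using col_B[OF i(1)] by blast
  have "B i \<inter> B k = {}" if "k \<in> {a..<b}" for k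
    using that i assms by (intro B_disjoint) auto
  then have "y \<notin> seg a b" using y(1) by blast
  moreover have "y \<in> S" using y B_subset[OF i(1)] by blast
  ultimately have "y \<in> ?W" "y \<notin> A" unfolding A_def P_def using y disj_SE by auto
  then have "A \<noteq> ?W" by blast
  with AW Ane have "adjS A (?W - A)" by (intro conn_cut[OF conn_col])
  then obtain u v where uv: "u \<in> A" "v \<in> ?W" "v \<notin> A" "adj u v" unfolding adjS_def by blast
  have uW: "u \<in> ?W" using uv AW by blast
  show False
  proof (cases "u \<in> P")
    case True
    then have "u \<in> S" using segS unfolding P_def by blast
    then have "v \<in> E" using indep_S[of u v] uv uW by auto
    then have "v \<in> A" unfolding A_def using True uv sym by blast
    with uv show False by blast
  next
    case False
    then obtain z where z: "u \<in> E" "z \<in> P" "adj u z" using uv unfolding A_def by blast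
    then have "v \<in> S" using indep_E[of u v] uv uW by auto
    then obtain j where j: "j < m" "v \<in> B j" using S_block by blast
    have "j \<notin> {a..<b}" using j uv unfolding A_def P_def by auto
    moreover obtain k where k: "k \<in> {a..<b}" "z \<in> B k" using z unfolding P_def by blast
    ultimately show False
      using no[of u k j] z uv j k assms uW unfolding touch_def by auto
  qed
qed

lemma hop_crossing:
  assumes "0 < t" "t < m"
  shows "\<exists>h\<in>E. col h = c \<and> cross h t"
proof -
  obtain h i j where "h \<in> E" "col h = c" "touch h i" "0 \<le> i" "i < t" "touch h j" "j < 0 \<or> t \<le> j"
    using leaving_hop[of 0 t c] assms by auto
  then show ?thesis unfolding cross_def by auto
qed

text \<open>The two sides of the cut would be hubs, and four crossing hops the middle
  pieces.\<close>

lemma few_crossing: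
  assumes "H \<subseteq> E" "\<And>h. h \<in> H \<Longrightarrow> cross h t"
  shows "card H \<le> 3"
proof (rule ccontr)
  assume c4: "\<not> ?thesis"
  then obtain h where "h \<in> H" by fastforce
  then have t: "0 < t" "t < m" using assms(2) cross_lt by auto
  have "K24 (S \<union> E)"
  proof (rule K24I[where I = H and M = "\<lambda>h. {h}"])
    show "conn (seg 0 t)" "conn (seg t m)" using t chain_seg[OF chain_B] by auto
    show "seg 0 t \<subseteq> S \<union> E" "seg t m \<subseteq> S \<union> E" using seg_subset[of t 0] seg_subset[of m t] t by auto
    show "seg 0 t \<inter> seg t m = {}" using chain_seg_disjoint[OF chain_B] by simp
    show "4 \<le> card H" using c4 by simp
    show "disjoint_family_on (\<lambda>h. {h}) H" by (auto simp: disjoint_family_on_def)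
    fix h assume h: "h \<in> H"
    have "h \<notin> S" using h assms(1) disj_SE by blast
    then have "h \<notin> seg 0 t" "h \<notin> seg t m" using seg_subset[of t 0] seg_subset[of m t] t by auto
    moreover have "adjS {h} (seg 0 t)" "adjS {h} (seg t m)"
      using assms(2)[OF h] cross_left cross_right by auto
    ultimately show "conn {h} \<and> {h} \<subseteq> S \<union> E \<and> {h} \<inter> seg 0 t = {} \<and> {h} \<inter> seg t m = {} \<and> adjS {h} (seg 0 t) \<and> adjS {h} (seg t m)"
      using h assms(1) conn_sing by auto
  qed
  with no_K24 show False by blast
qed

text \<open>The bound ten is \<open>3 * 3 + 1\<close>. Four components of \<open>E - {h}\<close>
  would be middle pieces between the hubs \<open>{h}\<close> and \<open>S\<close>, so there are at
  most three. A touched block has a vertex of the colour opposite to \<open>h\<close>, hence a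
  neighbour in one of these components. Of ten touched blocks, four would share a component
  \<open>C\<close> and be middle pieces between \<open>{h}\<close> and \<open>C\<close>.\<close>

lemma few_touched:
  assumes h: "h \<in> E"
  shows "card {j. touch h j} < 10"
proof (rule ccontr)
  assume ten: "\<not> ?thesis"
  let ?J = "{j. touch h j}"
  define E' where "E' = E - {h}"
  let ?C = "cc E' ` E'"
  have EE: "E - E' = {h}" using h unfolding E'_def by auto
  have "E' \<noteq> E" using h unfolding E'_def by auto
  have comp: "conn C \<and> C \<subseteq> E - {h} \<and> adjS C {h} \<and> adjS C S" if "C \<in> ?C" for C
  proof -
    from that obtain v where v: "v \<in> E'" "C = cc E' v" by blast
    have "adjS C (E - E')"
      using v conn_E \<open>E' \<noteq> E\<close> E'_def by (auto intro!: cc_adjS_compl)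
    moreover have "adjS C S" using E_adj_S[of v C] v cc_self[of v E'] E'_def by auto
    moreover have "C \<subseteq> E'" "conn C" using v cc_subset conn_cc by auto
    ultimately show ?thesis using EE E'_def by simp
  qed
  have finC: "finite ?C" using finite_E E'_def by simp
  have c3: "card ?C \<le> 3"
  proof (rule ccontr)
    assume "\<not> ?thesis"
    then have "K24 (S \<union> E)"
      by (intro K24_family[of "{h}" S _ ?C])
        (use comp h disj_SE disjoint_cc conn_sing conn_S in auto)
    with no_K24 show False by blast
  qed
  have "\<exists>e. e \<in> E \<and> col e \<noteq> col h \<and> touch e j" if "j \<in> ?J" for j
  proof -
    have j: "j < m" using that touch_lt by auto
    then obtain x where x: "x \<in> B j" "col x = (\<not> col h)" using col_B by blast
    then obtain e where "e \<in> E" "col e = col x" "adj e x" using S_adj_E[of x] B_subset[OF j] by blast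
    then show ?thesis using x j unfolding touch_def by (intro exI[of _ e]) auto
  qed
  then obtain e where e: "\<And>j. j \<in> ?J \<Longrightarrow> e j \<in> E \<and> col (e j) \<noteq> col h \<and> touch (e j) j"
    by metis
  then have eE': "\<And>j. j \<in> ?J \<Longrightarrow> e j \<in> E'" unfolding E'_def by blast
  have finJ: "finite ?J" using ten card.infinite by fastforce
  have "card ?C * 3 < card ?J" using c3 ten by simp
  then obtain C where C: "C \<in> ?C" "3 < card {j \<in> ?J. cc E' (e j) = C}"
    using pigeonhole_fiber[of ?J "\<lambda>j. cc E' (e j)" ?C 3] finJ finC eE' by blast
  have "K24 (S \<union> E)"
  proof (rule K24I[where I = "{j \<in> ?J. cc E' (e j) = C}" and M = B])
    show "conn {h}" "conn C" using conn_sing comp C by auto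
    show "{h} \<subseteq> S \<union> E" "C \<subseteq> S \<union> E" "{h} \<inter> C = {}" using h comp[OF C(1)] by auto
    show "4 \<le> card {j \<in> ?J. cc E' (e j) = C}" using C by simp
    show "disjoint_family_on B {j \<in> ?J. cc E' (e j) = C}"
      unfolding disjoint_family_on_def using B_disjoint touch_lt by blast
    fix j assume j: "j \<in> {j \<in> ?J. cc E' (e j) = C}"
    then have jm: "j < m" and tj: "touch h j" "touch (e j) j" using touch_lt e by auto
    have "conn (B j)" using chain_B jm unfolding chain_def by blast
    moreover have "adjS {h} (B j)" using tj unfolding touch_def adjS_def by blast
    moreover have "e j \<in> C" using j eE'[of j] cc_self[of "e j" E'] by auto
    then have "adjS C (B j)" using tj unfolding touch_def adjS_def by blast
    ultimately show "conn (B j) \<and> B j \<subseteq> S \<union> E \<and> B j \<inter> {h} = {} \<and> B j \<inter> C = {} \<and> adjS (B j) {h} \<and> adjS (B j) C"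
      using B_subset[OF jm] disj_SE h comp[OF C(1)] adjS_commute by blast
  qed
  with no_K24 show False by blast
qed

end

section \<open>Private pairs of hops\<close>

text \<open>Among \<open>4 ^ 6\<close> marks there is a star with four legs or a chain of six pieces.\<close>

definition num_pairs :: nat where "num_pairs = 4 ^ 6"
text \<open>Room for two disjoint runs of cuts, each \<open>num_pairs * 10\<close> steps long, so
  that one of them avoids a single bad cut.\<close>

definition region_len :: nat where "region_len = 2 * (num_pairs * 10) + 1"

text \<open>Ten regions, because a hop touches fewer than ten blocks and must miss one region. The
  summand 2 keeps the cuts from 1 to \<open>1 + num_pairs * (10 * region_len)\<close> below
  \<open>m\<close>.\<close>

definition block_bound :: nat where "block_bound = num_pairs * (10 * region_len) + 2"

context two_coloured_hops begin

text \<open>The hubs are \<open>H\<close> and the part of \<open>S\<close> between the two cuts; the parts of \<open>S\<close> outside the cuts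
  are two of the middle pieces.\<close>

lemma no_strip_crossing:
  assumes "s < t" "conn H" "conn P" "conn Q" "H \<subseteq> E" "P \<subseteq> E" "Q \<subseteq> E"
    and "P \<inter> H = {}" "Q \<inter> H = {}" "P \<inter> Q = {}" "adjS P H" "adjS Q H"
    and x: "x \<in> P" "cross x s" "\<not> cross x t" and u: "u \<in> H" "cross u s"
    and y: "y \<in> Q" "cross y t" "\<not> cross y s" and w: "w \<in> H" "cross w t"
  shows False
proof -
  have st: "0 < s" "t < m" using cross_lt x y by auto
  have E_seg: "Z \<inter> seg a b = {}" if "Z \<subseteq> E" "b \<le> m" for Z a b
    using seg_subset[OF that(2), of a] that(1) disj_SE by blast
  have seg_SE: "seg a b \<subseteq> S \<union> E" if "b \<le> m" for a b using seg_subset[OF that] by blast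
  have "K24 (S \<union> E)"
  proof (rule K24_four[of H "seg s t" P Q "seg 0 s" "seg t m"])
    show "conn H" "conn P" "conn Q" by fact+
    show "conn (seg s t)" "conn (seg 0 s)" "conn (seg t m)" using assms(1) st chain_seg[OF chain_B] by auto
    show "H \<subseteq> S \<union> E" "P \<subseteq> S \<union> E" "Q \<subseteq> S \<union> E" using assms by auto
    show "seg s t \<subseteq> S \<union> E" "seg 0 s \<subseteq> S \<union> E" "seg t m \<subseteq> S \<union> E" using seg_SE assms(1) st by auto
    show "P \<inter> H = {}" "Q \<inter> H = {}" "P \<inter> Q = {}" "adjS P H" "adjS Q H" by fact+
    show "H \<inter> seg s t = {}" "P \<inter> seg s t = {}" "Q \<inter> seg s t = {}" "P \<inter> seg 0 s = {}" "P \<inter> seg t m = {}"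
      "Q \<inter> seg 0 s = {}" "Q \<inter> seg t m = {}"
      using E_seg assms st by auto
    show "seg 0 s \<inter> H = {}" "seg t m \<inter> H = {}"
      using E_seg[OF assms(5), of s 0] E_seg[OF assms(5), of m t] assms(1) st by (auto simp: Int_commute)
    show "seg 0 s \<inter> seg s t = {}" "seg 0 s \<inter> seg t m = {}"
      using assms(1) st by (intro chain_seg_disjoint[OF chain_B]; simp)+
    have "seg s t \<inter> seg t m = {}"
      using assms(1) st by (intro chain_seg_disjoint[OF chain_B]; simp)
    then show "seg t m \<inter> seg s t = {}" by blast
    show "adjS P (seg s t)" using cross_right_until x assms(1) by blast
    show "adjS Q (seg s t)" using cross_left_until y assms(1) by blast
    show "adjS (seg 0 s) H" using cross_left[OF u(2) u(1)] adjS_commute by blast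
    show "adjS (seg t m) H" using cross_right[OF w(2) w(1)] adjS_commute by blast
    show "adjS (seg 0 s) (seg s t)" using st assms(1) by (intro chain_seg_adjS[OF chain_B]) auto
    have "adjS (seg s t) (seg t m)" using st assms(1) by (intro chain_seg_adjS[OF chain_B]) auto
    then show "adjS (seg t m) (seg s t)" using adjS_commute by blast
  qed
  with no_K24 show False by blast
qed

text \<open>The hops \<open>c k\<close> are marks in the connected set \<open>E\<close>. A star of
  them has \<open>S\<close> as its opposite hub, so a chain of six pieces of \<open>E\<close>
  remains, and the place of the partner \<open>d k\<close> in that chain decides what to build. The
  value \<open>pos 0 = 0\<close> is a sentinel: nothing crosses cut 0, so the first chosen cut has a
  predecessor like all others.\<close>

lemma no_private_pairs:
  fixes pos :: "nat \<Rightarrow> nat" and N :: nat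
  assumes pos: "strict_mono pos" "pos 0 = 0" and N: "4 ^ 6 \<le> N"
    and cd: "\<And>k. k \<in> {1..N} \<Longrightarrow> c k \<in> E \<and> d k \<in> E \<and> c k \<noteq> d k"
    and priv: "\<And>k l x. k \<in> {1..N} \<Longrightarrow> l \<in> {1..N} \<Longrightarrow> x \<in> {c k, d k} \<Longrightarrow> cross x (pos l) \<longleftrightarrow> l = k"
  shows False
proof -
  \<comment> \<open>\<open>no_strip_crossing\<close> regardless of which cut comes first; in the
    other order \<open>P\<close> and \<open>Q\<close> change roles.\<close>
  have strip: False
    if kl: "k \<in> {1..N}" "l \<in> {1..N}" "k \<noteq> l"
      and H: "conn H" "conn P" "conn Q" "H \<subseteq> E" "P \<subseteq> E" "Q \<subseteq> E"
        "P \<inter> H = {}" "Q \<inter> H = {}" "P \<inter> Q = {}" "adjS P H" "adjS Q H"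
      and x: "x \<in> P" "u \<in> H" "x \<in> {c k, d k}" "u \<in> {c k, d k}"
      and y: "y \<in> Q" "w \<in> H" "y \<in> {c l, d l}" "w \<in> {c l, d l}"
    for k l H P Q x u y w
  proof -
    have cr: "cross x (pos k)" "\<not> cross x (pos l)" "cross u (pos k)"
      "cross y (pos l)" "\<not> cross y (pos k)" "cross w (pos l)"
      using priv kl x y by auto
    have "pos k < pos l \<or> pos l < pos k" using strict_monoD[OF pos(1), of k l] strict_monoD[OF pos(1), of l k] kl(3) by linarith
    then show False
    proof
      assume "pos k < pos l"
      from no_strip_crossing[OF this H x(1) cr(1,2) x(2) cr(3) y(1) cr(4,5) y(2) cr(6)] show False .
    next
      assume "pos l < pos k"
      have "Q \<inter> P = {}" using H by blast
      from no_strip_crossing[OF \<open>pos l < pos k\<close> H(1,3,2,4,6,5,8,7) this H(11,10)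
          y(1) cr(4,5) y(2) cr(6) x(1) cr(1,2) x(2) cr(3)] show False .
    qed
  qed
  have c_inj: "k = l" if "k \<in> {1..N}" "l \<in> {1..N}" "c k = c l" for k l
    using priv[of k k "c k"] priv[of l k "c l"] that by auto
  then have card_c: "card (c ` {1..N}) = N" by (subst card_image) (auto intro: inj_onI)
  obtain e0 where "e0 \<in> E" using conn_nonempty[OF conn_E] by blast
  have cE: "c ` {1..N} \<subseteq> E" using cd by blast
  have "4 ^ 6 \<le> card (c ` {1..N})" using N card_c by simp
  from star_or_chain[OF finite_E conn_E \<open>e0 \<in> E\<close> cE _ _ this]
  consider (star) e \<L> where "e \<in> E" "4 \<le> card \<L>" "disjoint \<L>"
      "\<forall>L\<in>\<L>. conn L \<and> L \<subseteq> E - {e} \<and> adjS L {e} \<and> L \<inter> c ` {1..N} \<noteq> {}"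
    | (chain) F where "chain E 6 F" "\<forall>j<6. F j \<inter> c ` {1..N} \<noteq> {}"
    by auto
  then show False
  proof cases
    case star
    have "K24 (S \<union> E)"
    proof (rule K24_family[OF conn_sing conn_S _ _ _ star(2,3)])
      show "{e} \<subseteq> S \<union> E" "S \<subseteq> S \<union> E" "{e} \<inter> S = {}" using star(1) disj_SE by auto
      fix L assume "L \<in> \<L>"
      with star(4) have L: "conn L" "L \<subseteq> E - {e}" "adjS L {e}" "L \<inter> c ` {1..N} \<noteq> {}" by auto
      then obtain k where "c k \<in> L" "k \<in> {1..N}" by blast
      then have "adjS L S" using E_adj_S cd by blast
      with L show "conn L \<and> L \<subseteq> S \<union> E \<and> L \<inter> {e} = {} \<and> L \<inter> S = {} \<and> adjS L {e} \<and> adjS L S"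
        using disj_SE by auto
    qed
    with no_K24 show False by blast
  next
    case chain
    have F: "\<And>j. j < 6 \<Longrightarrow> conn (F j)" "\<And>j. j < 6 \<Longrightarrow> F j \<subseteq> E" "(\<Union>j<6. F j) = E"
      using chain(1) unfolding chain_def by auto
    have F_disj: "F i \<inter> F j = {}" if "i < 6" "j < 6" "i \<noteq> j" for i j
      using chain(1) that unfolding chain_def by (auto dest: disjoint_family_onD)
    have "\<forall>j<6. \<exists>k\<in>{1..N}. c k \<in> F j" using chain(2) by blast
    then obtain \<kappa> where \<kappa>: "\<And>j. j < 6 \<Longrightarrow> \<kappa> j \<in> {1..N} \<and> c (\<kappa> j) \<in> F j" by metis
    have \<kappa>_inj: "\<kappa> i \<noteq> \<kappa> j" if "i < 6" "j < 6" "i \<noteq> j" for i j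
      using \<kappa>[OF that(1)] \<kappa>[OF that(2)] F_disj[OF that] by auto
    have "\<forall>j<6. \<exists>i<6. d (\<kappa> j) \<in> F i" using \<kappa> cd F(3) by blast
    then obtain g where g: "\<And>j. j < 6 \<Longrightarrow> g j < 6 \<and> d (\<kappa> j) \<in> F (g j)" by metis
    let ?S = "\<lambda>a b. \<Union>i\<in>{a..<b}. F i"
    have F_seg: "F i \<inter> ?S a b = {}" if "i < 6" "b \<le> 6" "i < a \<or> b \<le> i" for i a b
    proof -
      have "F i \<inter> F j = {}" if "j \<in> {a..<b}" for j
        using that \<open>i < 6\<close> \<open>b \<le> 6\<close> \<open>i < a \<or> b \<le> i\<close> by (intro F_disj) auto
      then show ?thesis by blast
    qed
    have segE: "?S a b \<subseteq> E" if "b \<le> 6" for a b using chain_seg_subset[OF chain(1) that] .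
    \<comment> \<open>Of the six chosen pairs, three have both hops in one piece or four are spread
      over two pieces.\<close>
    define J0 J where "J0 = {j. j < 6 \<and> g j = j}" and "J = {j. j < 6 \<and> g j \<noteq> j}"
    have fin: "finite J0" "finite J" unfolding J0_def J_def by auto
    have "J0 \<union> J = {..<6}" "J0 \<inter> J = {}" unfolding J0_def J_def by auto
    then have "card J0 + card J = 6" using card_Un_disjoint[OF fin] by simp
    then consider "3 \<le> card J0" | "4 \<le> card J" by linarith
    then show False
    proof cases
      case 1
      then have ne: "J0 \<noteq> {}" by auto
      \<comment> \<open>Three indices leave a piece strictly between the extreme ones, so
        \<open>R\<close> is nonempty and connected. Each extreme piece is split between its two
        hops; the halves touching \<open>R\<close> join it as hub, the other halves are
        \<open>P\<close> and \<open>Q\<close> of the strip.\<close>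
      define i j where "i = Min J0" and "j = Max J0"
      have ij: "i \<in> J0" "j \<in> J0" unfolding i_def j_def using Min_in Max_in fin(1) ne by auto
      have "J0 \<subseteq> {i..j}" unfolding i_def j_def using fin(1) by auto
      then have "card J0 \<le> Suc j - i" using card_mono[of "{i..j}" J0] by simp
      with 1 have lt: "Suc i < j" by linarith
      have j6: "j < 6" "i < 6" using ij unfolding J0_def by auto
      define R where "R = ?S (Suc i) j"
      have connR: "conn R" unfolding R_def using chain_seg[OF chain(1) lt] j6 by simp
      have "adjS (?S i (Suc i)) R" unfolding R_def using lt j6 by (intro chain_seg_adjS[OF chain(1)]) auto
      then obtain r where r: "r \<in> F i" "adjS {r} R" unfolding adjS_def by auto
      have "adjS R (?S j (Suc j))" unfolding R_def using lt j6 by (intro chain_seg_adjS[OF chain(1)]) auto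
      then obtain r' where r': "r' \<in> F j" "adjS R {r'}" unfolding adjS_def by auto
      have inF: "c (\<kappa> i) \<in> F i" "d (\<kappa> i) \<in> F i" "c (\<kappa> j) \<in> F j" "d (\<kappa> j) \<in> F j"
        and k: "\<kappa> i \<in> {1..N}" "\<kappa> j \<in> {1..N}"
        using \<kappa>[of i] \<kappa>[of j] g[of i] g[of j] ij unfolding J0_def by auto
      obtain P Q where PQ: "conn P" "conn Q" "P \<inter> Q = {}" "P \<union> Q = F i" "adjS P Q" "r \<in> Q"
        "c (\<kappa> i) \<in> P \<and> d (\<kappa> i) \<in> Q \<or> d (\<kappa> i) \<in> P \<and> c (\<kappa> i) \<in> Q"
        using split_at[OF F(1)[OF j6(2)] inF(1,2) _ r(1)] cd[OF k(1)] by blast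
      obtain P' Q' where PQ': "conn P'" "conn Q'" "P' \<inter> Q' = {}" "P' \<union> Q' = F j" "adjS P' Q'" "r' \<in> Q'"
        "c (\<kappa> j) \<in> P' \<and> d (\<kappa> j) \<in> Q' \<or> d (\<kappa> j) \<in> P' \<and> c (\<kappa> j) \<in> Q'"
        using split_at[OF F(1)[OF j6(1)] inF(3,4) _ r'(1)] cd[OF k(2)] by blast
      have FR: "F i \<inter> R = {}" "F j \<inter> R = {}" "F i \<inter> F j = {}"
        unfolding R_def using j6 lt by (intro F_seg F_disj; simp)+
      have RE: "R \<subseteq> E" unfolding R_def using segE j6 by simp
      have "adjS Q R" by (rule adjS_mono[OF r(2)]) (use PQ(6) in auto)
      then have c1: "conn (Q \<union> R)" using conn_Un[OF PQ(2) connR] by blast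
      have "adjS (Q \<union> R) Q'" by (rule adjS_mono[OF r'(2)]) (use PQ'(6) in auto)
      then have c2: "conn (Q \<union> R \<union> Q')" using conn_Un[OF c1 PQ'(2)] by blast
      obtain x u where xu: "x \<in> P" "u \<in> Q" "x \<in> {c (\<kappa> i), d (\<kappa> i)}" "u \<in> {c (\<kappa> i), d (\<kappa> i)}" using PQ(7) by blast
      obtain y w where yw: "y \<in> P'" "w \<in> Q'" "y \<in> {c (\<kappa> j), d (\<kappa> j)}" "w \<in> {c (\<kappa> j), d (\<kappa> j)}" using PQ'(7) by blast
      show False
      proof (rule strip[OF k _ c2 PQ(1) PQ'(1)])
        show "\<kappa> i \<noteq> \<kappa> j" using \<kappa>_inj j6 lt by auto
        show "Q \<union> R \<union> Q' \<subseteq> E" "P \<subseteq> E" "P' \<subseteq> E" using PQ(4) PQ'(4) F(2)[OF j6(1)] F(2)[OF j6(2)] RE by auto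
        show "P \<inter> (Q \<union> R \<union> Q') = {}" "P' \<inter> (Q \<union> R \<union> Q') = {}" "P \<inter> P' = {}"
          using PQ(3,4) PQ'(3,4) FR by auto
        show "adjS P (Q \<union> R \<union> Q')" by (rule adjS_mono[OF PQ(5)]) auto
        show "adjS P' (Q \<union> R \<union> Q')" by (rule adjS_mono[OF PQ'(5)]) auto
        show "x \<in> P" "u \<in> Q \<union> R \<union> Q'" "y \<in> P'" "w \<in> Q \<union> R \<union> Q'" using xu yw by auto
        show "x \<in> {c (\<kappa> i), d (\<kappa> i)}" "u \<in> {c (\<kappa> i), d (\<kappa> i)}"
          "y \<in> {c (\<kappa> j), d (\<kappa> j)}" "w \<in> {c (\<kappa> j), d (\<kappa> j)}" by fact+
      qed
    next
      case 2
      \<comment> \<open>Each pair spans an interval of chain pieces. Two intervals shifted in the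
        same direction give a strip crossing. Otherwise all intervals contain the step from some
        \<open>p\<close> to \<open>p + 1\<close>, and cutting the chain of \<open>E\<close> there
        yields two hubs that every pair connects to.\<close>
      define lo hi where "lo = (\<lambda>j. min j (g j))" and "hi = (\<lambda>j. max j (g j))"
      have lohi: "lo j < hi j" "hi j < 6" if "j \<in> J" for j
        using that g[of j] unfolding J_def lo_def hi_def by auto
      have ends: "\<exists>x\<in>{c (\<kappa> j), d (\<kappa> j)}. x \<in> F (lo j)" "\<exists>x\<in>{c (\<kappa> j), d (\<kappa> j)}. x \<in> F (hi j)" if "j \<in> J" for j
        using that g[of j] \<kappa>[of j] unfolding J_def lo_def hi_def by (auto simp: min_def max_def)
      have kJ: "\<kappa> j \<in> {1..N}" if "j \<in> J" for j using that \<kappa> unfolding J_def by auto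
      show False
      proof (cases "\<exists>i\<in>J. \<exists>j\<in>J. lo i < lo j \<and> hi i < hi j")
        case True
        then obtain i j where ij: "i \<in> J" "j \<in> J" "lo i < lo j" "hi i < hi j" by blast
        obtain x u where xu: "x \<in> {c (\<kappa> i), d (\<kappa> i)}" "x \<in> F (lo i)" "u \<in> {c (\<kappa> i), d (\<kappa> i)}" "u \<in> F (hi i)"
          using ends[OF ij(1)] by blast
        obtain y w where yw: "w \<in> {c (\<kappa> j), d (\<kappa> j)}" "w \<in> F (lo j)" "y \<in> {c (\<kappa> j), d (\<kappa> j)}" "y \<in> F (hi j)"
          using ends[OF ij(2)] by blast
        note l = lohi[OF ij(1)] lohi[OF ij(2)]
        let ?H = "?S (Suc (lo i)) (hi j)"
        show False
        proof (rule strip[OF kJ[OF ij(1)] kJ[OF ij(2)],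
              where H = ?H and P = "F (lo i)" and Q = "F (hi j)" and x = x and u = u and y = y and w = w])
          have "i \<noteq> j" using ij by auto
          then show "\<kappa> i \<noteq> \<kappa> j" using \<kappa>_inj ij unfolding J_def by auto
          show "conn ?H" using chain_seg[OF chain(1)] ij l by simp
          show "conn (F (lo i))" "conn (F (hi j))" "F (lo i) \<subseteq> E" "F (hi j) \<subseteq> E" using F l by auto
          show "?H \<subseteq> E" using segE l by simp
          show "F (lo i) \<inter> ?H = {}" "F (hi j) \<inter> ?H = {}" "F (lo i) \<inter> F (hi j) = {}"
            using l ij by (intro F_seg F_disj; simp)+
          have "adjS (?S (lo i) (Suc (lo i))) ?H" using ij l by (intro chain_seg_adjS[OF chain(1)]) auto
          then show "adjS (F (lo i)) ?H" by simp
          have "adjS ?H (?S (hi j) (Suc (hi j)))" using ij l by (intro chain_seg_adjS[OF chain(1)]) auto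
          then show "adjS (F (hi j)) ?H" using adjS_commute by simp
          show "u \<in> ?H" using xu(4) by (rule UN_I[rotated]) (use l ij in auto)
          show "w \<in> ?H" using yw(2) by (rule UN_I[rotated]) (use l ij in auto)
        qed (use xu yw in auto)
      next
        case nest: False
        have Jne: "J \<noteq> {}" using 2 by auto
        define p where "p = Max (lo ` J)"
        have "p \<in> lo ` J" unfolding p_def using fin Jne by (intro Max_in) auto
        then obtain j0 where j0: "j0 \<in> J" "p = lo j0" by blast
        have lop: "lo j \<le> p" if "j \<in> J" for j unfolding p_def using that fin by auto
        \<comment> \<open>An interval ending by \<open>p\<close> would start before
          \<open>lo j0\<close> and end before \<open>hi j0\<close>, so it would be shifted against
          the interval of \<open>j0\<close>.\<close>
        have hip: "p < hi j" if "j \<in> J" for j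
        proof (cases "lo j = p")
          case True then show ?thesis using lohi that by metis
        next
          case False
          then have "lo j < lo j0" using lop[OF that] j0 by auto
          then have "hi j0 \<le> hi j" using nest that j0(1) by (meson not_le)
          then show ?thesis using lohi(1)[OF j0(1)] j0(2) by simp
        qed
        have p5: "p < 5" using hip[OF j0(1)] lohi[OF j0(1)] by simp
        let ?C = "?S 0 (Suc p)" and ?D = "?S (Suc p) 6"
        \<comment> \<open>The strip of \<open>S\<close> just before the cut of the pair. Both hops
          cross this cut but not the preceding one, so both touch the strip. For
          \<open>\<kappa> j = 1\<close> the preceding cut is the sentinel.\<close>
        let ?M = "\<lambda>j. seg (pos (\<kappa> j - 1)) (pos (\<kappa> j))"
        have cutm: "pos (\<kappa> j - 1) < pos (\<kappa> j)" "pos (\<kappa> j) < m" if "j \<in> J" for j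
        proof -
          show "pos (\<kappa> j - 1) < pos (\<kappa> j)" using kJ[OF that] by (intro strict_monoD[OF pos(1)]) auto
          have "cross (c (\<kappa> j)) (pos (\<kappa> j))" using priv kJ[OF that] by simp
          then show "pos (\<kappa> j) < m" using cross_lt by blast
        qed
        have touchM: "adjS (?M j) Z" if j: "j \<in> J" and x: "x \<in> {c (\<kappa> j), d (\<kappa> j)}" "x \<in> Z" for j x Z
        proof -
          have "cross x (pos (\<kappa> j))" using priv[OF kJ[OF j] kJ[OF j] x(1)] by simp
          moreover have "\<not> cross x (pos (\<kappa> j - 1))"
          proof (cases "\<kappa> j = 1")
            case True then show ?thesis using pos(2) cross_lt[of x 0] by auto
          next
            case False
            then have "\<kappa> j - 1 \<in> {1..N}" "\<kappa> j - 1 \<noteq> \<kappa> j" using kJ[OF j] by auto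
            then show ?thesis using priv[OF kJ[OF j] _ x(1)] by blast
          qed
          ultimately have "adjS Z (?M j)" using cross_left_until cutm(1)[OF j] x(2) by blast
          then show ?thesis using adjS_commute by blast
        qed
        have "K24 (S \<union> E)"
        proof (rule K24I[where I = J and M = ?M])
          show "conn ?C" "conn ?D" using chain_seg[OF chain(1)] p5 by auto
          have CE: "?C \<subseteq> E" "?D \<subseteq> E" using segE p5 by auto
          then show "?C \<subseteq> S \<union> E" "?D \<subseteq> S \<union> E" by blast+
          show "?C \<inter> ?D = {}" by (rule chain_seg_disjoint[OF chain(1)]) auto
          show "4 \<le> card J" by (rule 2)
          show "disjoint_family_on ?M J"
            unfolding disjoint_family_on_def
          proof (intro ballI impI)
            have *: "?M i \<inter> ?M j = {}" if "i \<in> J" "j \<in> J" "\<kappa> i < \<kappa> j" for i j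
            proof (rule chain_seg_disjoint[OF chain_B])
              show "pos (\<kappa> i) \<le> pos (\<kappa> j - 1)" using that strict_mono_less_eq[OF pos(1)] by simp
              show "pos (\<kappa> j) \<le> m" using cutm that by (simp add: less_imp_le)
            qed
            fix i j assume ij: "i \<in> J" "j \<in> J" "i \<noteq> j"
            then have "\<kappa> i < \<kappa> j \<or> \<kappa> j < \<kappa> i" using \<kappa>_inj[of i j] unfolding J_def by auto
            then show "?M i \<inter> ?M j = {}" using *[OF ij(1,2)] *[OF ij(2,1)] by blast
          qed
          fix j assume j: "j \<in> J"
          obtain x y where xy: "x \<in> {c (\<kappa> j), d (\<kappa> j)}" "x \<in> F (lo j)" "y \<in> {c (\<kappa> j), d (\<kappa> j)}" "y \<in> F (hi j)"
            using ends[OF j] by blast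
          have "x \<in> ?C" using xy(2) by (rule UN_I[rotated]) (use lop[OF j] in auto)
          moreover have "y \<in> ?D" using xy(4) by (rule UN_I[rotated]) (use hip[OF j] lohi[OF j] in auto)
          moreover have "?M j \<subseteq> S" using seg_subset cutm[OF j] by simp
          moreover have "conn (?M j)" using chain_seg[OF chain_B cutm(1)[OF j]] cutm(2)[OF j] by simp
          moreover have "adjS (?M j) ?C" by (rule touchM[OF j xy(1)]) fact
          moreover have "adjS (?M j) ?D" by (rule touchM[OF j xy(3)]) fact
          ultimately show "conn (?M j) \<and> ?M j \<subseteq> S \<union> E \<and> ?M j \<inter> ?C = {} \<and> ?M j \<inter> ?D = {} \<and>
              adjS (?M j) ?C \<and> adjS (?M j) ?D"
            using CE disj_SE by blast
        qed
        with no_K24 show False by blast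
      qed
    qed
  qed
qed

text \<open>A hop crossing two cuts of an arithmetic progression with step \<open>l\<close> would
  also cross the cut exactly \<open>l\<close> after the first, against \<open>short\<close>. Hence
  the two hops chosen at each of these cuts are private to it. The set \<open>H\<close> allows one
  long hop to be left out of \<open>E\<close>.\<close>

lemma no_short_pairs:
  assumes "0 < a" "0 < l" "4 ^ 6 \<le> N"
    and xy: "\<And>t. a \<le> t \<Longrightarrow> t \<le> a + N * l \<Longrightarrow>
        x t \<in> H \<and> y t \<in> H \<and> x t \<noteq> y t \<and> cross (x t) t \<and> cross (y t) t"
    and H: "H \<subseteq> E"
    and short: "\<And>h t. h \<in> H \<Longrightarrow> a \<le> t \<Longrightarrow> t + l \<le> a + N * l \<Longrightarrow> \<not> (cross h t \<and> cross h (t + l))"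
  shows False
proof -
  \<comment> \<open>Index 0 is the sentinel, so the progression starts at index 1.\<close>
  define pos where "pos = (\<lambda>k::nat. if k = 0 then 0 else a + (k - 1) * l)"
  have mono: "strict_mono pos"
    unfolding strict_mono_Suc_iff pos_def using assms(1,2) by (auto simp: gr0_conv_Suc)
  have range: "a \<le> pos k" "pos k \<le> a + N * l" "pos k + l \<le> a + N * l" if "k \<in> {1..N}" for k
  proof -
    from that obtain i where i: "k = Suc i" "i < N" by (cases k) auto
    then have "(i + 1) * l \<le> N * l" by (intro mult_right_mono) auto
    then show "a \<le> pos k" "pos k \<le> a + N * l" "pos k + l \<le> a + N * l" using i unfolding pos_def by auto
  qed
  have step: "pos i + l \<le> pos j" if "i \<in> {1..N}" "i < j" for i j
  proof -
    from that obtain i' where "i = Suc i'" by (cases i) auto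
    moreover from that obtain j' where "j = Suc j'" by (cases j) auto
    moreover have "(i' + 1) * l \<le> j' * l" using calculation that by (intro mult_right_mono) auto
    ultimately show ?thesis unfolding pos_def by auto
  qed
  have no2: "\<not> (cross h (pos i) \<and> cross h (pos j))" if "h \<in> H" "i \<in> {1..N}" "j \<in> {1..N}" "i < j" for h i j
  proof
    assume h: "cross h (pos i) \<and> cross h (pos j)"
    then have "cross h (pos i + l)" 
      using cross_convex[of h "pos i" "pos j"] step[OF that(2,4)] by simp
    with h short[OF that(1) range(1,3)[OF that(2)]] show False by blast
  qed
  show False
  proof (rule no_private_pairs[OF mono _ assms(3), of "\<lambda>k. x (pos k)" "\<lambda>k. y (pos k)"])
    show "pos 0 = 0" unfolding pos_def by simp
    fix k assume k: "k \<in> {1..N}"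
    note x = xy[OF range(1,2)[OF k]]
    then show "x (pos k) \<in> E \<and> y (pos k) \<in> E \<and> x (pos k) \<noteq> y (pos k)" using H by blast
    fix j z assume j: "j \<in> {1..N}" and z: "z \<in> {x (pos k), y (pos k)}"
    then have zz: "z \<in> H" "cross z (pos k)" using x by auto
    then show "cross z (pos j) \<longleftrightarrow> j = k"
      using no2[OF zz(1) j k] no2[OF zz(1) k j] by (metis linorder_neqE_nat)
  qed
qed

text \<open>If some hop \<open>c\<close> spans a long interval of blocks, then inside a part that \<open>c\<close> does not touch
  every cut but one is crossed by two further hops, and these are short: a second long hop would
  have to touch every block, because at most three hops cross a cut.\<close>

lemma bounded_blocks: "m < block_bound"
proof (rule ccontr)
  assume "\<not> ?thesis"
  then have big: "num_pairs * (10 * region_len) + 2 \<le> m" unfolding block_bound_def by simp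
  let ?N = num_pairs and ?w = region_len
  show False
  proof (cases "\<exists>c\<in>E. \<exists>t. cross c t \<and> cross c (t + 10 * ?w)")
    case False
    \<comment> \<open>Every hop is short compared with \<open>10 * ?w\<close>, so one hop of each
      colour at cuts with this spacing suffices; the colours keep the two apart.\<close>
    define x where "x = (\<lambda>b t. SOME h. h \<in> E \<and> col h = b \<and> cross h t)"
    have x: "x b t \<in> E \<and> col (x b t) = b \<and> cross (x b t) t" if "1 \<le> t" "t \<le> 1 + ?N * (10 * ?w)" for b t
    proof -
      have "\<exists>h. h \<in> E \<and> col h = b \<and> cross h t" using hop_crossing[of t b] that big by auto
      then show ?thesis unfolding x_def by (rule someI_ex)
    qed
    show False
    proof (rule no_short_pairs[of 1 "10 * ?w" ?N "x True" E "x False"])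
      fix t assume "1 \<le> t" "t \<le> 1 + ?N * (10 * ?w)"
      with x[of t True] x[of t False]
      show "x True t \<in> E \<and> x False t \<in> E \<and> x True t \<noteq> x False t \<and> cross (x True t) t \<and> cross (x False t) t"
        by auto
    qed (use False in \<open>auto simp: num_pairs_def region_len_def\<close>)
  next
    case True
    then obtain c t where c: "c \<in> E" "cross c t" "cross c (t + 10 * ?w)" by blast
    \<comment> \<open>Ten consecutive regions, but \<open>c\<close> touches fewer than ten
      blocks.\<close>
    have "\<exists>i<10. \<forall>j\<in>{t + i * ?w..<t + (i + 1) * ?w}. \<not> touch c j"
    proof (rule ccontr)
      assume "\<not> ?thesis"
      then have "\<forall>i<10. \<exists>j. j \<in> {t + i * ?w..<t + (i + 1) * ?w} \<and> touch c j" by blast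
      then obtain f where f: "\<And>i. i < 10 \<Longrightarrow> f i \<in> {t + i * ?w..<t + (i + 1) * ?w} \<and> touch c (f i)"
        by metis
      have lt: "f i < f j" if "i < j" "j < 10" for i j
      proof -
        have "(i + 1) * ?w \<le> j * ?w" using that by (intro mult_right_mono) auto
        then show ?thesis using f[of i] f[of j] that by auto
      qed
      have "inj_on f {..<10}" by (rule inj_onI) (metis lt lessThan_iff less_irrefl linorder_neqE_nat)
      then have "card (f ` {..<10}) = 10" by (simp add: card_image)
      moreover have "f ` {..<10} \<subseteq> {j. touch c j}" using f by auto
      moreover have "finite {j. touch c j}" by (rule finite_subset[of _ "{..<m}"]) (use touch_lt in auto)
      ultimately have "10 \<le> card {j. touch c j}" by (metis card_mono)
      with few_touched[OF c(1)] show False by simp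
    qed
    then obtain i where i: "i < 10" "\<forall>j\<in>{t + i * ?w..<t + (i + 1) * ?w}. \<not> touch c j" by blast
    define a where "a = t + i * ?w"
    have a_end: "a + ?w \<le> t + 10 * ?w"
    proof -
      have "(i + 1) * ?w \<le> 10 * ?w" using i(1) by (intro mult_right_mono) auto
      then show ?thesis unfolding a_def by simp
    qed
    have c_over: "cross c u" if "a \<le> u" "u \<le> a + ?w" for u
    proof (rule cross_convex[OF c(2,3)])
      show "t \<le> u" using that(1) unfolding a_def by simp
      show "u \<le> t + 10 * ?w" using that(2) a_end by (rule le_trans)
    qed
    have c_untouched: "\<not> touch c j" if "a \<le> j" "j < a + ?w" for j
      using i(2) that unfolding a_def by auto
    define good where "good = (\<lambda>u. \<exists>h\<in>E. h \<noteq> c \<and> col h = col c \<and> cross h u)"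
    \<comment> \<open>A hop of the colour of \<open>c\<close> leaves the segment from
      \<open>u\<close> to \<open>v\<close>. It touches a block there, so it is not \<open>c\<close>,
      and in leaving it crosses \<open>u\<close> or \<open>v\<close>.\<close>
    have one_bad: "good u \<or> good v" if uv: "a \<le> u" "u < v" "v \<le> a + ?w" for u v
    proof -
      have "cross c u" "cross c v" using c_over uv by auto
      then have "0 < u" "v < m" using cross_lt by auto
      then obtain h j k where h: "h \<in> E" "col h = col c" "touch h j" "u \<le> j" "j < v" "touch h k" "k < u \<or> v \<le> k"
        using leaving_hop[of u v "col c"] uv by auto
      have "h \<noteq> c" using c_untouched[of j] h uv by auto
      moreover have "cross h u \<or> cross h v"
        using h unfolding cross_def by (meson le_trans less_imp_le)
      ultimately show ?thesis using h unfolding good_def by blast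
    qed
    have wlen: "?w = 2 * (?N * 10) + 1" unfolding region_len_def ..
    have "\<exists>b. a \<le> b \<and> b + ?N * 10 \<le> a + ?w \<and> (\<forall>u. b \<le> u \<longrightarrow> u \<le> b + ?N * 10 \<longrightarrow> good u)"
    proof (cases "\<forall>u. a \<le> u \<longrightarrow> u \<le> a + ?N * 10 \<longrightarrow> good u")
      case True
      then show ?thesis using wlen by (intro exI[of _ a]) auto
    next
      case False
      then obtain u where u: "a \<le> u" "u \<le> a + ?N * 10" "\<not> good u" by blast
      show ?thesis
      proof (intro exI[of _ "a + ?N * 10 + 1"] conjI allI impI)
        fix v assume "a + ?N * 10 + 1 \<le> v" "v \<le> a + ?N * 10 + 1 + ?N * 10"
        then show "good v" using one_bad[of u v] u wlen by auto
      qed (use wlen in auto)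
    qed
    then obtain b where b: "a \<le> b" "b + ?N * 10 \<le> a + ?w"
      "\<And>u. b \<le> u \<Longrightarrow> u \<le> b + ?N * 10 \<Longrightarrow> good u" by blast
    let ?I = "\<lambda>u. b \<le> u \<and> u \<le> b + ?N * 10"
    have cI: "cross c u" if "?I u" for u using c_over that b by auto
    \<comment> \<open>For \<open>s\<close> true the hop has the colour of \<open>c\<close>, where a
      second one exists by \<open>good\<close>; in the other colour \<open>hop_crossing\<close> is
      enough.\<close>
    define x where "x = (\<lambda>s u. SOME h. h \<in> E - {c} \<and> col h = (col c \<longleftrightarrow> s) \<and> cross h u)"
    have ex: "\<exists>h. h \<in> E - {c} \<and> col h = (col c \<longleftrightarrow> s) \<and> cross h u" if u: "?I u" for s u
    proof (cases s)
      case True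
      then show ?thesis using b(3) u unfolding good_def by auto
    next
      case False
      have "0 < u" "u < m" using cross_lt[OF cI[OF u]] by auto
      then show ?thesis using hop_crossing[of u "\<not> col c"] False by auto
    qed
    have x: "x s u \<in> E - {c} \<and> col (x s u) = (col c \<longleftrightarrow> s) \<and> cross (x s u) u" if "?I u" for s u
      unfolding x_def by (rule someI_ex) (rule ex[OF that])
    show False
    proof (rule no_short_pairs[of b 10 ?N "x True" "E - {c}" "x False"])
      show "0 < b" using cross_lt[OF cI[of b]] by auto
      fix u assume "b \<le> u" "u \<le> b + ?N * 10"
      with x[of u True] x[of u False]
      show "x True u \<in> E - {c} \<and> x False u \<in> E - {c} \<and> x True u \<noteq> x False u \<and> cross (x True u) u \<and> cross (x False u) u"
        by auto
    next
      fix h u assume h: "h \<in> E - {c}" and u: "b \<le> u" "u + 10 \<le> b + ?N * 10"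
      show "\<not> (cross h u \<and> cross h (u + 10))"
      proof
        assume hu: "cross h u \<and> cross h (u + 10)"
        \<comment> \<open>If \<open>h\<close> skipped block \<open>j\<close>, some hop
          \<open>e\<close> of the colour of \<open>h\<close> would leave that block. It differs from
          \<open>c\<close> and \<open>h\<close>, which do not touch \<open>j\<close>. Together with
          a hop \<open>z\<close> of the colour opposite to \<open>h\<close> there would be four hops
          across a cut beside block \<open>j\<close>.\<close>
        have "touch h j" if j: "u \<le> j" "j < u + 10" for j
        proof (rule ccontr)
          assume nt: "\<not> touch h j"
          have I: "?I j" "?I (Suc j)" using u j by auto
          have "0 < j" "Suc j < m" using cross_lt[OF cI[OF I(1)]] cross_lt[OF cI[OF I(2)]] by auto
          then obtain e k l where e: "e \<in> E" "col e = col h" "touch e k" "j \<le> k" "k < Suc j" "touch e l" "l < j \<or> Suc j \<le> l"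
            using leaving_hop[of j "Suc j" "col h"] by auto
          then have tj: "touch e j" by (metis le_antisym less_Suc_eq_le)
          have ne: "e \<noteq> c" "e \<noteq> h" using tj nt c_untouched[of j] j u b by auto
          have "cross e j \<or> cross e (Suc j)" using tj e(6,7) unfolding cross_def by auto
          then obtain v where v: "?I v" "cross e v" "cross h v"
          proof
            assume "cross e j"
            moreover have "cross h j" using cross_convex[of h u "u + 10" j] hu j by simp
            ultimately show ?thesis using that I by blast
          next
            assume "cross e (Suc j)"
            moreover have "cross h (Suc j)" using cross_convex[of h u "u + 10" "Suc j"] hu j by simp
            ultimately show ?thesis using that I by blast
          qed
          define z where "z = x (col h \<noteq> col c) v"
          have z: "z \<in> E - {c}" "col z \<noteq> col h" "cross z v" using x[OF v(1), of "col h \<noteq> col c"] unfolding z_def by auto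
          have "card {c, h, e, z} \<le> 3" by (rule few_crossing[of _ v]) (use c h e z v cI in auto)
          moreover have "c \<noteq> h" "c \<noteq> e" "c \<noteq> z" "h \<noteq> e" "h \<noteq> z" "e \<noteq> z"
            using ne h z(1,2) e(2) by auto
          then have "card {c, h, e, z} = 4" by simp
          ultimately show False by simp
        qed
        then have "{u..<u + 10} \<subseteq> {j. touch h j}" by auto
        moreover have "finite {j. touch h j}" by (rule finite_subset[of _ "{..<m}"]) (use touch_lt in auto)
        ultimately have "card {u..<u + 10} \<le> card {j. touch h j}" by (metis card_mono)
        with few_touched[of h] h show False by simp
      qed
    qed (auto simp: num_pairs_def)
  qed
qed

end

section \<open>Splittable sets\<close>

text \<open>Forces four legs or \<open>2 * block_bound\<close> chain pieces, which are paired so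
  that every block contains both colours.\<close>

definition component_bound :: nat where "component_bound = 4 ^ (2 * block_bound)"
text \<open>A pigeonhole over pairs of monochromatic components, with \<open>4 ^ 4\<close> blocks
  wanted for one pair.\<close>

definition split_bound :: nat where "split_bound = component_bound * component_bound * 4 ^ 4"
text \<open>The chain pieces are paired, and one block more than \<open>split_bound\<close> is
  needed because the last one is given to \<open>E\<close>.\<close>

definition leg_bound :: nat where "leg_bound = 4 ^ (2 * (split_bound + 1))"
text \<open>Both factors 2 pay for a separation: half of the legs of a star are kept, and the pieces
  of a chain are paired.\<close>

definition agile_bound :: nat where "agile_bound = (2 * leg_bound) ^ (2 * leg_bound)"

context symrel begin

text \<open>Every vertex of \<open>S\<close> has a neighbour of its own colour in \<open>E\<close>,
  so for a star in \<open>S\<close> the set \<open>E\<close> is the second hub. In a chain, an edge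
  between consecutive pieces has ends of different colours by \<open>indep_S\<close>, so a pair of
  pieces is a block with both colours.\<close>

lemma K24_two_coloured:
  fixes col :: "'v \<Rightarrow> bool"
  assumes fin: "finite S" "finite E" and conn: "conn S" "conn E" and disj: "S \<inter> E = {}"
    and conn_col: "\<And>c. conn {x \<in> S \<union> E. col x = c}"
    and indep_S: "\<And>x y. x \<in> S \<Longrightarrow> y \<in> S \<Longrightarrow> x \<noteq> y \<Longrightarrow> adj x y \<Longrightarrow> col x \<noteq> col y"
    and indep_E: "\<And>x y. x \<in> E \<Longrightarrow> y \<in> E \<Longrightarrow> x \<noteq> y \<Longrightarrow> adj x y \<Longrightarrow> col x \<noteq> col y"
    and col_E: "\<And>c. \<exists>e\<in>E. col e = c"
    and big: "component_bound \<le> card S"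
  shows "K24 (S \<union> E)"
proof (rule ccontr)
  assume no: "\<not> K24 (S \<union> E)"
  have S_adj: "adjS X E" if "x \<in> S" "x \<in> X" for x X
  proof -
    let ?W = "{y \<in> S \<union> E. col y = col x}"
    obtain e where e: "e \<in> E" "col e = col x" using col_E by blast
    then have "e \<in> ?W" "e \<noteq> x" using that disj by auto
    then have "{x} \<noteq> ?W" by blast
    then have "adjS {x} (?W - {x})" using that by (intro conn_cut[OF conn_col]) auto
    then obtain z where z: "z \<in> ?W" "x \<noteq> z" "adj x z" unfolding adjS_def by blast
    then have "z \<in> E" using indep_S[OF that(1), of z] by auto
    with z that show ?thesis by (auto intro: adjSI)
  qed
  obtain r where r: "r \<in> S" using conn_nonempty[OF conn(1)] by blast
  have bb: "2 \<le> block_bound" unfolding block_bound_def by simp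
  have "4 ^ (2 * block_bound) \<le> card S" using big unfolding component_bound_def .
  from star_or_chain[OF fin(1) conn(1) r subset_refl _ _ this] bb
  consider (star) c \<L> where "c \<in> S" "4 \<le> card \<L>" "disjoint \<L>"
      "\<forall>L\<in>\<L>. conn L \<and> L \<subseteq> S - {c} \<and> adjS L {c} \<and> L \<inter> S \<noteq> {}"
    | (chain) D where "chain S (2 * block_bound) D"
    by auto
  then show False
  proof cases
    case star
    have "K24 (S \<union> E)"
    proof (rule K24_family[OF conn_sing conn(2) _ _ _ star(2,3)])
      show "{c} \<subseteq> S \<union> E" "E \<subseteq> S \<union> E" "{c} \<inter> E = {}" using star(1) disj by auto
      fix L assume "L \<in> \<L>"
      with star(4) have L: "conn L" "L \<subseteq> S - {c}" "adjS L {c}" "L \<inter> S \<noteq> {}" by auto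
      then have "adjS L E" using S_adj by blast
      with L show "conn L \<and> L \<subseteq> S \<union> E \<and> L \<inter> {c} = {} \<and> L \<inter> E = {} \<and> adjS L {c} \<and> adjS L E"
        using disj by auto
    qed
    with no show False by blast
  next
    case chain
    let ?B = "\<lambda>i. D (2 * i) \<union> D (2 * i + 1)"
    have "two_coloured_hops adj S E col ?B block_bound"
    proof
      show "chain S block_bound ?B" by (rule chain_pair[OF chain])
      fix j c assume j: "j < block_bound"
      have "Suc (2 * j) < 2 * block_bound" using j by simp
      then have "adjS (D (2 * j)) (D (Suc (2 * j)))" using chain unfolding chain_def by blast
      then obtain x y where xy: "x \<in> D (2 * j)" "y \<in> D (2 * j + 1)" "adj x y" unfolding adjS_def by auto
      moreover have "D (2 * j) \<inter> D (2 * j + 1) = {}"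
        using chain j unfolding chain_def by (intro disjoint_family_onD[of D "{..<2 * block_bound}"]) auto
      moreover have "D (2 * j) \<subseteq> S" "D (2 * j + 1) \<subseteq> S"
        using chain \<open>Suc (2 * j) < 2 * block_bound\<close> unfolding chain_def by fastforce+
      ultimately have "col x \<noteq> col y" using indep_S[of x y] by blast
      then show "\<exists>x\<in>?B j. col x = c" using xy by (cases "col x = c") auto
    qed (use assms no bb in auto)
    then show False using two_coloured_hops.bounded_blocks by blast
  qed
qed

lemma K24_split_blocks:
  assumes finV: "finite V" and V: "V = S \<union> E" "S \<inter> E = {}" and conn: "conn S" "conn E"
    and C: "C \<subseteq> V" "conn C" "conn (V - C)"
    and B: "\<And>j. j \<in> J \<Longrightarrow> conn (B j) \<and> B j \<subseteq> S \<and> adjS (B j) E \<and> B j \<inter> C \<noteq> {} \<and> B j - C \<noteq> {}"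
      "disjoint_family_on B J" "split_bound \<le> card J"
    and E: "E \<inter> C \<noteq> {}" "E - C \<noteq> {}"
  shows "K24 V"
proof -
  interpret Q: symrel adjS by (rule quot_symrel)
  \<comment> \<open>The points on the same side and of the same colour as \<open>v\<close>. The
    components \<open>part v\<close> of these sets partition \<open>V\<close> and are what gets
    contracted.\<close>
  define W where "W = (\<lambda>v. (if v \<in> S then S else E) \<inter> (if v \<in> C then C else - C))"
  define part where "part = (\<lambda>v. cc (W v) v)"
  have finSE: "finite S" "finite E" using finV V by auto
  have inW: "v \<in> W v" if "v \<in> V" for v using that V unfolding W_def by auto
  have part_self: "v \<in> part v" if "v \<in> V" for v unfolding part_def using cc_self[OF inW[OF that]] .
  have part_conn: "conn (part v)" if "v \<in> V" for v unfolding part_def using conn_cc[OF inW[OF that]] .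
  have part_W: "part v \<subseteq> W v" for v unfolding part_def by (rule cc_subset)
  have W_eq: "W w = W v" if "v \<in> V" "w \<in> W v" for v w
    using that V unfolding W_def by (auto split: if_splits)
  have part_eq: "part w = part v" if "v \<in> V" "w \<in> part v" for v w
    using cc_eq[OF inW[OF that(1)], of w] that W_eq[OF that(1), of w] part_W[of v] unfolding part_def by auto
  have part_max: "X \<subseteq> part v" if "v \<in> V" "conn X" "X \<subseteq> W v" "v \<in> X" for v X
    using cc_max[OF inW[OF that(1)] that(2,3)] that(4) cc_self[OF inW[OF that(1)]] unfolding part_def by blast
  have part_disj: "part v \<inter> part w = {}" if "v \<in> V" "w \<in> V" "part v \<noteq> part w" for v w
    using part_eq that by blast
  have part_S: "part v \<subseteq> S" if "v \<in> S" for v using part_W[of v] that unfolding W_def by auto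
  have part_E: "part v \<subseteq> E" if "v \<in> E" for v
  proof -
    have "v \<notin> S" using that V(2) by blast
    then show ?thesis using part_W[of v] unfolding W_def by auto
  qed
  have part_C: "part v \<subseteq> C" if "v \<in> C" for v using part_W[of v] that unfolding W_def by auto
  have part_nC: "part v \<inter> C = {}" if "v \<notin> C" for v using part_W[of v] that unfolding W_def by auto
  let ?SQ = "part ` S" and ?EQ = "part ` E"
  have SV: "S \<subseteq> V" and EV: "E \<subseteq> V" using V by auto
  show ?thesis
  proof (cases "component_bound \<le> card ?SQ")
    case True
    let ?col = "\<lambda>P. P \<inter> C \<noteq> {}"
    have US: "\<Union>?SQ = S" using part_self part_S SV by blast
    have UE: "\<Union>?EQ = E" using part_self part_E EV by blast
    have disjP: "disjoint (?SQ \<union> ?EQ)"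
      unfolding disjoint_def using part_disj SV EV by blast
    have connP: "\<And>P. P \<in> ?SQ \<union> ?EQ \<Longrightarrow> conn P" using part_conn SV EV by blast
    have ne: "\<And>P. P \<in> ?SQ \<union> ?EQ \<Longrightarrow> P \<noteq> {}" using connP conn_nonempty by blast
    have qc: "Q.conn \<S>" if "\<S> \<subseteq> ?SQ \<union> ?EQ" "conn (\<Union>\<S>)" for \<S>
    proof (rule quot_conn[OF that(2)])
      show "disjoint \<S>" using pairwise_subset[OF disjP that(1)] .
      show "\<And>P. P \<in> \<S> \<Longrightarrow> P \<noteq> {}" using that(1) ne by blast
    qed
    \<comment> \<open>Adjacent parts of the same side and the same colour would be one
      component.\<close>
    have indep: "?col P \<noteq> ?col R" if "T = S \<or> T = E" "P \<in> part ` T" "R \<in> part ` T" "P \<noteq> R" "adjS P R" for P R T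
    proof
      assume eq: "?col P = ?col R"
      from that(2,3) obtain v w where vw: "v \<in> T" "P = part v" "w \<in> T" "R = part w" by blast
      from that(5) obtain x y where xy: "x \<in> P" "y \<in> R" "adj x y" unfolding adjS_def by blast
      have VV: "v \<in> V" "w \<in> V" using vw that(1) SV EV by auto
      have sameC: "v \<in> C \<longleftrightarrow> ?col P" "w \<in> C \<longleftrightarrow> ?col R"
        using vw part_nC part_self[OF VV(1)] part_self[OF VV(2)] by blast+
      have "v \<in> S \<longleftrightarrow> w \<in> S" using vw(1,3) that(1) V(2) by blast
      moreover have "v \<in> C \<longleftrightarrow> w \<in> C" using sameC eq by simp
      ultimately have "W w = W v" unfolding W_def by simp
      then have "y \<in> W v" using xy(2) vw(4) part_W[of w] by auto
      then have "y \<in> part v" using cc_step[OF inW[OF VV(1)], of x y] xy vw unfolding part_def by blast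
      then have "part y = part v" using part_eq[OF VV(1)] by blast
      moreover have "part y = part w" using part_eq[OF VV(2), of y] xy(2) vw(4) by blast
      ultimately show False using vw(2,4) that(4) by simp
    qed
    have "Q.K24 (?SQ \<union> ?EQ)"
    proof (rule Q.K24_two_coloured[where col = ?col])
      show "finite ?SQ" "finite ?EQ" using finSE by auto
      show "Q.conn ?SQ" "Q.conn ?EQ" using qc US UE conn by auto
      show "?SQ \<inter> ?EQ = {}"
      proof -
        have "part v \<noteq> part w" if "v \<in> S" "w \<in> E" for v w
          using part_S[OF that(1)] part_E[OF that(2)] part_self[of v] that SV V(2) by blast
        then show ?thesis by blast
      qed
      show "component_bound \<le> card ?SQ" by fact
      fix c
      have "\<Union>{P \<in> ?SQ \<union> ?EQ. ?col P = c} = (if c then C else V - C)"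
      proof (intro equalityI subsetI)
        fix x assume "x \<in> \<Union>{P \<in> ?SQ \<union> ?EQ. ?col P = c}"
        then obtain v where v: "v \<in> V" "x \<in> part v" "?col (part v) = c" using SV EV by blast
        have "x \<in> V" using v part_S part_E V by blast
        moreover have "x \<in> C \<longleftrightarrow> c" using v part_C[of v] part_nC[of v] by (cases "v \<in> C") auto
        ultimately show "x \<in> (if c then C else V - C)" by auto
      next
        fix x assume x: "x \<in> (if c then C else V - C)"
        then have xV: "x \<in> V" using C by (auto split: if_splits)
        then have "part x \<in> ?SQ \<union> ?EQ" "x \<in> part x" using V part_self by auto
        moreover have "?col (part x) = c" using x part_nC[of x] part_self[OF xV] by (auto split: if_splits)
        ultimately show "x \<in> \<Union>{P \<in> ?SQ \<union> ?EQ. ?col P = c}" by blast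
      qed
      then show "Q.conn {P \<in> ?SQ \<union> ?EQ. ?col P = c}" using C by (intro qc) auto
      show "\<exists>e\<in>?EQ. ?col e = c"
      proof (cases c)
        case True
        obtain v where "v \<in> E" "v \<in> C" using E by blast
        then show ?thesis using True part_self[of v] EV by (intro bexI[of _ "part v"]) auto
      next
        case False
        obtain v where "v \<in> E" "v \<notin> C" using E by blast
        then show ?thesis using False part_nC[of v] by (intro bexI[of _ "part v"]) auto
      qed
    next
      fix P R assume "P \<in> ?SQ" "R \<in> ?SQ" "P \<noteq> R" "adjS P R"
      then show "?col P \<noteq> ?col R" using indep[of S P R] by blast
    next
      fix P R assume "P \<in> ?EQ" "R \<in> ?EQ" "P \<noteq> R" "adjS P R"
      then show "?col P \<noteq> ?col R" using indep[of E P R] by blast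
    qed
    from quot_K24[OF this disjP connP] show ?thesis using US UE V by simp
  next
    case False
    let ?Y = "\<lambda>v. if v \<in> C then C else - C"
    \<comment> \<open>Start at a contact \<open>e\<close> of the block with \<open>E\<close>. Its
      monochromatic component inside the block is not the whole block, so it is adjacent to some
      \<open>y\<close> of the other colour. That component is the future piece of the hub
      \<open>part e\<close>, touching both \<open>E\<close> and \<open>part y\<close>.\<close>
    have "\<exists>e y. e \<in> B j \<and> adjS {e} E \<and> y \<in> B j \<and> (y \<in> C \<longleftrightarrow> e \<notin> C) \<and> adjS (cc (B j \<inter> ?Y e) e) {y}"
      if j: "j \<in> J" for j
    proof -
      obtain e where e: "e \<in> B j" "adjS {e} E" using B(1)[OF j] unfolding adjS_def by blast
      have "adjS (cc (B j \<inter> ?Y e) e) (B j - B j \<inter> ?Y e)"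
        using B(1)[OF j] e by (intro cc_adjS_compl) (auto split: if_splits)
      then obtain y where "y \<in> B j - B j \<inter> ?Y e" "adjS (cc (B j \<inter> ?Y e) e) {y}"
        unfolding adjS_def by blast
      with e show ?thesis by (intro exI[of _ e] exI[of _ y]) (auto split: if_splits)
    qed
    then obtain e y where ey: "\<And>j. j \<in> J \<Longrightarrow> e j \<in> B j \<and> adjS {e j} E \<and> y j \<in> B j \<and> (y j \<in> C \<longleftrightarrow> e j \<notin> C) \<and>
        adjS (cc (B j \<inter> ?Y (e j)) (e j)) {y j}"
      by metis
    define L where "L = (\<lambda>j. cc (B j \<inter> ?Y (e j)) (e j))"
    let ?f = "\<lambda>j. (part (e j), part (y j))"
    have eyS: "e j \<in> S" "y j \<in> S" if "j \<in> J" for j using ey[OF that] B(1)[OF that] by auto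
    have "0 < split_bound" unfolding split_bound_def component_bound_def by simp
    then have finJ: "finite J" using B(3) by (metis card.infinite not_le)
    have "card (?SQ \<times> ?SQ) * (4 ^ 4 - 1) < card J"
    proof -
      have "card (?SQ \<times> ?SQ) * (4 ^ 4 - 1) \<le> component_bound * component_bound * (4 ^ 4 - 1)"
        unfolding card_cartesian_product using False by (intro mult_right_mono mult_mono) auto
      also have "\<dots> < split_bound" unfolding split_bound_def component_bound_def by simp
      finally show ?thesis using B(3) by simp
    qed
    moreover have "?f ` J \<subseteq> ?SQ \<times> ?SQ" using eyS by auto
    ultimately obtain p where p: "4 ^ 4 - 1 < card {j \<in> J. ?f j = p}"
      using pigeonhole_fiber[of J ?f "?SQ \<times> ?SQ" "4 ^ 4 - 1"] finJ finSE by blast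
    let ?I = "{j \<in> J. ?f j = p}"
    obtain A A' where pA: "p = (A, A')" by (cases p)
    have "?I \<noteq> {}" using p by (metis card.empty not_less0)
    then obtain j0 where j0: "j0 \<in> J" "part (e j0) = A" "part (y j0) = A'" using pA by blast
    note eyj = eyS[OF j0(1)]
    have AV: "e j0 \<in> V" "y j0 \<in> V" using eyj SV by auto
    have AS: "A \<subseteq> S" "A' \<subseteq> S" using part_S eyj j0 by auto
    have "K24 (A \<union> A' \<union> E)"
    proof (rule K24_three_hubs[where L = L and I = ?I])
      show "finite A" using AS finSE finite_subset by blast
      show "conn A" "conn A'" using part_conn AV j0 by auto
      show "conn E" by fact
      show "A \<inter> A' = {}"
        using part_C[of "e j0"] part_nC[of "e j0"] part_C[of "y j0"] part_nC[of "y j0"] ey[OF j0(1)] j0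
        by (cases "e j0 \<in> C") auto
      show "A \<inter> E = {}" "A' \<inter> E = {}" using AS V by auto
      show "4 ^ 4 \<le> card ?I" using p by simp
      have LB: "L j \<subseteq> B j" for j unfolding L_def using cc_subset by blast
      show "disjoint_family_on L ?I"
        unfolding disjoint_family_on_def
      proof (intro ballI impI)
        fix i j assume "i \<in> ?I" "j \<in> ?I" "i \<noteq> j"
        then have "B i \<inter> B j = {}" using B(2) by (auto dest: disjoint_family_onD)
        then show "L i \<inter> L j = {}" using LB[of i] LB[of j] by blast
      qed
      fix j assume "j \<in> ?I"
      then have j: "j \<in> J" "part (e j) = A" "part (y j) = A'" using pA by auto
      have ein: "e j \<in> B j \<inter> ?Y (e j)" using ey[OF j(1)] by auto
      have L: "conn (L j)" "e j \<in> L j" unfolding L_def using conn_cc[OF ein] cc_self[OF ein] by auto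
      have "L j \<subseteq> W (e j)"
        using cc_subset[of "B j \<inter> ?Y (e j)" "e j"] B(1)[OF j(1)] eyS[OF j(1)] unfolding L_def W_def by auto
      then have "L j \<subseteq> A" using part_max[of "e j" "L j"] L eyS[OF j(1)] SV j(2) by auto
      moreover have "adjS (L j) A'"
        by (rule adjS_mono[of "L j" "{y j}"])
          (use ey[OF j(1)] part_self[of "y j"] eyS[OF j(1)] SV j(3) in \<open>auto simp: L_def\<close>)
      moreover have "adjS (L j) E" by (rule adjS_mono[of "{e j}" E]) (use ey[OF j(1)] L in auto)
      ultimately show "conn (L j) \<and> L j \<subseteq> A \<and> adjS (L j) A' \<and> adjS (L j) E" using L by auto
    qed
    then show ?thesis by (rule K24_mono) (use AS V in auto)
  qed
qed

text \<open>What agility becomes inside one component of the graph, with the two trees extended to a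
  bipartition of \<open>V\<close>. Trivial partitions are left out: for \<open>X = V\<close> they
  would ask for an empty connected side.\<close>

definition splittable :: "'v set \<Rightarrow> 'v set \<Rightarrow> bool" where
  "splittable V X \<longleftrightarrow> X \<subseteq> V \<and> (\<forall>Y\<subseteq>X. Y \<noteq> {} \<longrightarrow> Y \<noteq> X \<longrightarrow>
     (\<exists>C\<subseteq>V. conn C \<and> conn (V - C) \<and> Y \<subseteq> C \<and> X - Y \<subseteq> V - C))"

lemma splittableE:
  assumes "splittable V X" "Y \<subseteq> X" "y \<in> Y" "x \<in> X - Y"
  obtains C where "C \<subseteq> V" "conn C" "conn (V - C)" "Y \<subseteq> C" "X - Y \<subseteq> V - C"
proof -
  have "Y \<noteq> {}" "Y \<noteq> X" using assms by auto
  with assms(1,2) have "\<exists>C\<subseteq>V. conn C \<and> conn (V - C) \<and> Y \<subseteq> C \<and> X - Y \<subseteq> V - C"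
    unfolding splittable_def by blast
  with that show thesis by blast
qed

text \<open>For a star, \<open>E\<close> is its centre \<open>c\<close>: separate the marks of half
  the legs from the others; the side without \<open>c\<close>, united with the legs whose marks it
  contains, is \<open>S\<close>. For a chain, separate the even marks from the odd ones: the two
  sides are \<open>S\<close> and \<open>E\<close>, and in each pair of pieces the component of the
  even mark within its side has an edge to the other side.\<close>

lemma splittable_legs:
  assumes V: "finite V" "conn V" and X: "splittable V X" and n: "1 \<le> n" "(2 * n) ^ (2 * n) \<le> card X"
  shows "\<exists>S E \<L>. conn S \<and> conn E \<and> S \<subseteq> V \<and> E \<subseteq> V \<and> S \<inter> E = {} \<and> n \<le> card \<L> \<and> disjoint \<L> \<and>
    (\<forall>L\<in>\<L>. conn L \<and> L \<subseteq> S \<and> adjS L E \<and> L \<inter> X \<noteq> {})"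
proof -
  have XV: "X \<subseteq> V" using X unfolding splittable_def by blast
  obtain r where r: "r \<in> V" using conn_nonempty[OF V(2)] by blast
  from star_or_chain[OF V r XV _ _ n(2)] n(1)
  consider (star) c \<L> where "c \<in> V" "2 * n \<le> card \<L>" "disjoint \<L>"
      "\<forall>L\<in>\<L>. conn L \<and> L \<subseteq> V - {c} \<and> adjS L {c} \<and> L \<inter> X \<noteq> {}"
    | (chain) D where "chain V (2 * n) D" "\<forall>i<2 * n. D i \<inter> X \<noteq> {}"
    by auto
  then show ?thesis
  proof cases
    case star
    have "\<forall>L\<in>\<L>. \<exists>x. x \<in> L \<inter> X" using star(4) by blast
    then obtain x where x: "\<And>L. L \<in> \<L> \<Longrightarrow> x L \<in> L \<inter> X" by metis
    have finL: "finite \<L>" using star(2) n(1) by (metis card.infinite le_zero_eq mult_eq_0_iff not_one_le_zero numeral_2_eq_2 Suc_neq_Zero)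
    obtain \<L>1 where L1: "\<L>1 \<subseteq> \<L>" "card \<L>1 = n" using star(2) by (metis obtain_subset_with_card_n le_trans le_add1 mult_2)
    have cL2: "n \<le> card (\<L> - \<L>1)" using L1 star(2) finL by (simp add: card_Diff_subset finite_subset)
    obtain A where A: "A \<in> \<L>1" using L1 n(1) by fastforce
    have "card (\<L> - \<L>1) \<noteq> 0" using cL2 n(1) by simp
    then have "\<L> - \<L>1 \<noteq> {}" by (metis card.empty)
    then obtain A' where A': "A' \<in> \<L> - \<L>1" by blast
    have xneq: "x P \<noteq> x P'" if "P \<in> \<L>" "P' \<in> \<L>" "P \<noteq> P'" for P P'
      using x[OF that(1)] x[OF that(2)] disjointD[OF star(3) that] by auto
    have "x ` \<L>1 \<subseteq> X" using x L1 by blast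
    moreover have "x A \<in> x ` \<L>1" using A by blast
    moreover have xd: "x P \<in> X - x ` \<L>1" if "P \<in> \<L> - \<L>1" for P using x that xneq L1 by blast
    moreover note xd[OF A']
    ultimately obtain C where C: "C \<subseteq> V" "conn C" "conn (V - C)" "x ` \<L>1 \<subseteq> C" "X - x ` \<L>1 \<subseteq> V - C"
      using splittableE[OF X] by metis
    have "\<exists>W \<I>. conn W \<and> W \<subseteq> V - {c} \<and> \<I> \<subseteq> \<L> \<and> n \<le> card \<I> \<and> x ` \<I> \<subseteq> W"
    proof (cases "c \<in> C")
      case True
      then show ?thesis using C cL2 xd by (intro exI[of _ "V - C"] exI[of _ "\<L> - \<L>1"]) blast
    next
      case False
      then show ?thesis using C L1 by (intro exI[of _ C] exI[of _ \<L>1]) auto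
    qed
    then obtain W \<I> where W: "conn W" "W \<subseteq> V - {c}" "\<I> \<subseteq> \<L>" "n \<le> card \<I>" "x ` \<I> \<subseteq> W" by blast
    have "conn (W \<union> (\<Union>P\<in>\<I>. P))"
    proof (rule conn_UN[OF W(1)])
      fix P assume P: "P \<in> \<I>"
      then show "conn P" using star(4) W(3) by blast
      have "x P \<in> W \<inter> P" using P W x by blast
      then show "W \<inter> P \<noteq> {} \<or> adjS W P" by blast
    qed
    moreover have "W \<union> (\<Union>P\<in>\<I>. P) \<subseteq> V - {c}" using W star(4) by blast
    moreover have "disjoint \<I>" using star(3) W(3) by (auto simp: disjoint_def)
    moreover have "\<forall>L\<in>\<I>. conn L \<and> L \<subseteq> W \<union> (\<Union>P\<in>\<I>. P) \<and> adjS L {c} \<and> L \<inter> X \<noteq> {}"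
      using star(4) W(3) by blast
    ultimately show ?thesis using W(4) star(1) conn_sing[of c]
      by (intro exI[of _ "W \<union> (\<Union>P\<in>\<I>. P)"] exI[of _ "{c}"] exI[of _ \<I>]) auto
  next
    case chain
    have "\<forall>i\<in>{..<2*n}. \<exists>x. x \<in> D i \<inter> X" using chain(2) by blast
    then obtain x where x: "\<And>i. i < 2 * n \<Longrightarrow> x i \<in> D i \<inter> X" by (metis lessThan_iff)
    have D_disj: "D i \<inter> D j = {}" if "i < 2 * n" "j < 2 * n" "i \<noteq> j" for i j
      using chain(1) that unfolding chain_def by (auto dest: disjoint_family_onD)
    let ?B = "\<lambda>i. D (2 * i) \<union> D (2 * i + 1)"
    have cB: "chain V n ?B" by (rule chain_pair[OF chain(1)])
    let ?Y = "(\<lambda>i. x (2 * i)) ` {..<n}"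
    have YX: "?Y \<subseteq> X" using x by auto
    have odd: "x (2 * i + 1) \<in> X - ?Y" if "i < n" for i
    proof -
      have "x (2 * i + 1) \<noteq> x (2 * k)" if "k < n" for k
      proof -
        have "2 * i + 1 \<noteq> 2 * k" by presburger
        then have "D (2 * i + 1) \<inter> D (2 * k) = {}" using \<open>i < n\<close> that by (intro D_disj) auto
        then show ?thesis using x[of "2 * i + 1"] x[of "2 * k"] \<open>i < n\<close> that by auto
      qed
      then show ?thesis using x[of "2 * i + 1"] that by auto
    qed
    have "x (2 * 0) \<in> ?Y" using n(1) by (intro imageI) auto
    from splittableE[OF X YX this odd[of 0]] n(1)
    obtain C where C: "C \<subseteq> V" "conn C" "conn (V - C)" "?Y \<subseteq> C" "X - ?Y \<subseteq> V - C" by auto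
    define L where "L = (\<lambda>i. cc (?B i \<inter> C) (x (2 * i)))"
    have L: "conn (L i) \<and> L i \<subseteq> ?B i \<inter> C \<and> adjS (L i) (V - C) \<and> x (2 * i) \<in> L i \<inter> X" if i: "i < n" for i
    proof -
      have xi: "x (2 * i) \<in> ?B i \<inter> C" using x[of "2 * i"] i C(4) by auto
      have yi: "x (2 * i + 1) \<in> ?B i - C" using x[of "2 * i + 1"] odd[OF i] i C(5) by auto
      have "conn (?B i)" using cB i unfolding chain_def by blast
      then have "adjS (L i) (?B i - ?B i \<inter> C)"
        unfolding L_def using xi yi by (intro cc_adjS_compl) auto
      moreover have "?B i \<subseteq> V" using cB i unfolding chain_def by blast
      ultimately have "adjS (L i) (V - C)" by (elim adjS_mono) auto
      then show ?thesis using conn_cc[OF xi] cc_subset cc_self[OF xi] x[of "2 * i"] i unfolding L_def by auto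
    qed
    have d: "L i \<inter> L j = {}" if "i \<in> {..<n}" "j \<in> {..<n}" "i \<noteq> j" for i j
    proof -
      have "disjoint_family_on ?B {..<n}" using cB unfolding chain_def by blast
      then have "?B i \<inter> ?B j = {}" using that by (rule disjoint_family_onD)
      then show ?thesis using L[of i] L[of j] that by blast
    qed
    have ne: "L i \<noteq> {}" if "i \<in> {..<n}" for i using L[of i] that by auto
    have dd: "inj_on L {..<n}" "disjoint (L ` {..<n})"
      by (rule disjoint_image_of[of "{..<n}" L, OF d ne]; assumption)+
    have "n \<le> card (L ` {..<n})" using card_image[OF dd(1)] by simp
    moreover have "\<forall>P\<in>L ` {..<n}. conn P \<and> P \<subseteq> C \<and> adjS P (V - C) \<and> P \<inter> X \<noteq> {}" using L by blast
    ultimately show ?thesis using C dd(2)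
      by (intro exI[of _ C] exI[of _ "V - C"] exI[of _ "L ` {..<n}"]) auto
  qed
qed

text \<open>Splitting is used twice: through \<open>splittable_legs\<close> for \<open>S\<close> and
  \<open>E\<close>, and again for the colours once the legs have been arranged along a chain. Each
  block contains a leg, and so inherits its contact with \<open>E\<close>.\<close>

theorem splittable_K24:
  assumes V: "finite V" "conn V" and X: "splittable V X" and big: "agile_bound \<le> card X"
  shows "K24 V"
proof -
  have n1: "1 \<le> leg_bound" unfolding leg_bound_def by simp
  from splittable_legs[OF V X n1 big[unfolded agile_bound_def]]
  obtain S E \<L> where SE: "conn S" "conn E" "S \<subseteq> V" "E \<subseteq> V" "S \<inter> E = {}"
    and L: "leg_bound \<le> card \<L>" "disjoint \<L>" "\<forall>L\<in>\<L>. conn L \<and> L \<subseteq> S \<and> adjS L E \<and> L \<inter> X \<noteq> {}" by blast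
  let ?k = split_bound
  have k0: "0 < ?k" unfolding split_bound_def component_bound_def by simp
  have finS: "finite S" using V SE finite_subset by blast
  have dfL: "disjoint_family_on (\<lambda>L. L) \<L>" using L(2) by (auto simp: disjoint_def disjoint_family_on_def)
  have LI: "\<And>L. L \<in> \<L> \<Longrightarrow> conn L \<and> L \<subseteq> S" using L(3) by blast
  from marked_star_or_chain[OF finS SE(1) dfL LI _ _ L(1)[unfolded leg_bound_def]]
  consider (star) H \<M> where "conn H" "H \<subseteq> S" "4 \<le> card \<M>" "disjoint \<M>"
      "\<forall>P\<in>\<M>. conn P \<and> P \<subseteq> S - H \<and> adjS P H \<and> (\<exists>L\<in>\<L>. L \<subseteq> P)"
    | (chain) D where "chain S (2 * (?k + 1)) D" "\<forall>i<2 * (?k + 1). \<exists>L\<in>\<L>. L \<subseteq> D i"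
    by auto
  then show ?thesis
  proof cases
    case star
    show ?thesis
    proof (rule K24_family[OF star(1) SE(2) _ SE(4) _ star(3,4)])
      show "H \<subseteq> V" "H \<inter> E = {}" using star(2) SE by auto
      fix P assume "P \<in> \<M>"
      with star(5) obtain L' where P: "conn P" "P \<subseteq> S - H" "adjS P H" "L' \<in> \<L>" "L' \<subseteq> P" by blast
      have "adjS P E" by (rule adjS_mono[of L' E]) (use P L(3) in auto)
      with P SE show "conn P \<and> P \<subseteq> V \<and> P \<inter> H = {} \<and> P \<inter> E = {} \<and> adjS P H \<and> adjS P E" by blast
    qed
  next
    case chain
    let ?B = "\<lambda>i. D (2 * i) \<union> D (2 * i + 1)"
    have cB: "chain S (?k + 1) ?B" by (rule chain_pair[OF chain(1)])
    have D_disj: "D i \<inter> D j = {}" if "i < 2 * (?k + 1)" "j < 2 * (?k + 1)" "i \<noteq> j" for i j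
      using chain(1) that unfolding chain_def by (auto dest: disjoint_family_onD)
    have DX: "\<exists>x. x \<in> D i \<inter> X" and DE: "adjS (D i) E" if i: "i < 2 * (?k + 1)" for i
    proof -
      obtain L' where L': "L' \<in> \<L>" "L' \<subseteq> D i" using chain(2) i by blast
      then show "\<exists>x. x \<in> D i \<inter> X" using L(3) by blast
      show "adjS (D i) E" by (rule adjS_mono[of L' E]) (use L' L(3) in auto)
    qed
    define x where "x = (\<lambda>i. SOME x. x \<in> D i \<inter> X)"
    have x: "x i \<in> D i \<inter> X" if "i < 2 * (?k + 1)" for i
      unfolding x_def by (rule someI_ex) (rule DX[OF that])
    have BE: "adjS (?B i) E" if "i < ?k + 1" for i
      by (rule adjS_mono[of "D (2 * i)" E]) (use DE[of "2 * i"] that in auto)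
    have connB: "conn (?B i)" if "i < ?k + 1" for i using cB that unfolding chain_def by blast
    let ?S = "\<Union>i\<in>{0..<?k}. ?B i"
    have S': "conn ?S" "?S \<subseteq> S" using chain_seg[OF cB k0] chain_seg_subset[OF cB, of ?k 0] by auto
    \<comment> \<open>The last block joins \<open>E\<close>, so that this side meets both colours as
      well.\<close>
    have E': "conn (E \<union> ?B ?k)"
      using conn_Un[OF SE(2) connB[of ?k]] BE[of ?k] adjS_commute by simp
    have BkS: "?B ?k \<subseteq> S" using chain_seg_subset[OF cB, of "?k + 1" ?k] by simp
    have "?S \<inter> (\<Union>i\<in>{?k..<?k+1}. ?B i) = {}" by (rule chain_seg_disjoint[OF cB]) auto
    then have dEB: "(E \<union> ?B ?k) \<inter> ?S = {}" using S'(2) SE(5) by auto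
    have EBV: "E \<union> ?B ?k \<subseteq> V" by (rule Un_least[OF SE(4) subset_trans[OF BkS SE(3)]])
    have SV: "?S \<subseteq> V" by (rule subset_trans[OF S'(2) SE(3)])
    \<comment> \<open>\<open>S\<close> and \<open>E\<close> need not cover \<open>V\<close>, but the
      two colours do; hence this extension to a bipartition.\<close>
    obtain F where F: "F \<subseteq> V" "conn F" "conn (V - F)" "E \<union> ?B ?k \<subseteq> F" "?S \<subseteq> V - F"
      using extend_disjoint_conn[OF V(2) E' S'(1) EBV SV dEB] by (elim exE conjE) (rule that)
    let ?Y = "(\<lambda>i. x (2 * i)) ` {..<?k + 1}"
    have YX: "?Y \<subseteq> X" using x by auto
    have odd: "x (2 * i + 1) \<in> X - ?Y" if "i < ?k + 1" for i
    proof -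
      have "x (2 * i + 1) \<noteq> x (2 * j)" if "j < ?k + 1" for j
      proof -
        have "2 * i + 1 \<noteq> 2 * j" by presburger
        then have "D (2 * i + 1) \<inter> D (2 * j) = {}" using \<open>i < ?k + 1\<close> that by (intro D_disj) auto
        then show ?thesis using x[of "2 * i + 1"] x[of "2 * j"] \<open>i < ?k + 1\<close> that by auto
      qed
      then show ?thesis using x[of "2 * i + 1"] that by auto
    qed
    have "x (2 * 0) \<in> ?Y" by (intro imageI) auto
    from splittableE[OF X YX this odd[of 0]]
    obtain C where C: "C \<subseteq> V" "conn C" "conn (V - C)" "?Y \<subseteq> C" "X - ?Y \<subseteq> V - C" by auto
    have meets: "x (2 * i) \<in> ?B i \<inter> C" "x (2 * i + 1) \<in> ?B i - C" if "i < ?k + 1" for i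
      using x[of "2 * i"] x[of "2 * i + 1"] odd[OF that] C(4,5) that by auto
    show ?thesis
    proof (rule K24_split_blocks[of V "V - F" F C "{..<?k}" ?B])
      show "finite V" "C \<subseteq> V" "conn C" "conn (V - C)" "conn F" "conn (V - F)" by fact+
      show "V = V - F \<union> F" "(V - F) \<inter> F = {}" using F(1) by auto
      show "?k \<le> card {..<?k}" by simp
      show "disjoint_family_on ?B {..<?k}"
        using cB unfolding chain_def by (auto elim: disjoint_family_on_mono[rotated])
      show "F \<inter> C \<noteq> {}" "F - C \<noteq> {}" using meets[of ?k] F(4) by auto
      fix j assume j: "j \<in> {..<?k}"
      have "adjS (?B j) F" by (rule adjS_mono[of "?B j" E]) (use BE[of j] j F(4) in auto)
      moreover have "?B j \<subseteq> V - F" using F(5) j by fastforce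
      ultimately show "conn (?B j) \<and> ?B j \<subseteq> V - F \<and> adjS (?B j) F \<and> ?B j \<inter> C \<noteq> {} \<and> ?B j - C \<noteq> {}"
        using meets[of j] connB[of j] j by auto
    qed
  qed
qed

end

section \<open>Graphs\<close>

lemma symrel_adjacent: "symrel (adjacent G)"
  by unfold_locales (simp add: adjacent_def insert_commute)

lemma conn_walk:
  assumes "p \<noteq> []" "successively (adjacent G) p"
  shows "symrel.conn (adjacent G) (set p)"
  using assms
proof (induction p)
  case (Cons x q)
  interpret symrel "adjacent G" by (rule symrel_adjacent)
  show ?case
  proof (cases "q = []")
    case True
    then show ?thesis using conn_sing by simp
  next
    case False
    then have "conn (set q)" "adjacent G x (hd q)" "hd q \<in> set q"
      using Cons by (auto simp: successively_Cons)
    then have "conn ({x} \<union> set q)" by (intro conn_Un conn_sing) (auto intro: adjSI)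
    then show ?thesis by simp
  qed
qed simp

lemma conn_graph_connected:
  assumes "graph_connected T" "edges T \<subseteq> edges G"
  shows "symrel.conn (adjacent G) (verts T)"
proof -
  interpret symrel "adjacent G" by (rule symrel_adjacent)
  show ?thesis
    unfolding conn_def
  proof (intro conjI allI impI)
    show "verts T \<noteq> {}" using assms(1) unfolding graph_connected_def by blast
    fix A assume A: "A \<subseteq> verts T" "A \<noteq> {}" "A \<noteq> verts T"
    then obtain u v where uv: "u \<in> A" "v \<in> verts T" "v \<notin> A" by blast
    then obtain p where p: "walk T p" "hd p = u" "last p = v"
      using assms(1) A(1) unfolding graph_connected_def by blast
    have succ: "successively (adjacent G) p"
      by (rule successively_mono[of "adjacent T"])
        (use p(1) assms(2) in \<open>auto simp: walk_def adjacent_def\<close>)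
    have ne: "p \<noteq> []" using p(1) unfolding walk_def by blast
    have hl: "u \<in> set p" "v \<in> set p" using p ne by auto
    have "adjS (A \<inter> set p) (set p - A \<inter> set p)"
      using hl uv by (intro conn_cut[OF conn_walk[OF ne succ]]) auto
    then show "\<exists>a\<in>A. \<exists>b\<in>verts T - A. adjacent G a b"
      using p(1) unfolding adjS_def walk_def by blast
  qed
qed

lemma graph_connected_induced:
  assumes "symrel.conn (adjacent G) U" "U \<subseteq> verts G"
  shows "graph_connected (induced G U)"
proof -
  interpret symrel "adjacent G" by (rule symrel_adjacent)
  have vU: "verts (induced G U) = U" using assms(2) unfolding induced_def by auto
  have "\<exists>p. walk (induced G U) p \<and> hd p = u \<and> last p = v" if "u \<in> U" "v \<in> U" for u v
  proof (rule ccontr)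
    assume no: "\<not> ?thesis"
    define A where "A = {w \<in> U. \<exists>p. walk (induced G U) p \<and> hd p = u \<and> last p = w}"
    have "walk (induced G U) [u]" using that vU unfolding walk_def by auto
    then have "u \<in> A" unfolding A_def using that(1) by (auto intro: exI[of _ "[u]"])
    moreover have "v \<notin> A" using no unfolding A_def by blast
    ultimately have "adjS A (U - A)" using that by (intro conn_cut[OF assms(1)]) (auto simp: A_def)
    then obtain a b where ab: "a \<in> A" "b \<in> U" "b \<notin> A" "adjacent G a b" unfolding adjS_def by blast
    then obtain p where p: "walk (induced G U) p" "hd p = u" "last p = a" "a \<in> U" unfolding A_def by blast
    have "adjacent (induced G U) a b"
      using ab p(4) unfolding adjacent_def induced_def by auto
    then have "walk (induced G U) (p @ [b])"
      using p ab(2) vU unfolding walk_def by (auto simp: successively_append_iff)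
    moreover have "hd (p @ [b]) = u" using p unfolding walk_def by auto
    ultimately have "b \<in> A" unfolding A_def using ab(2) by (auto intro: exI[of _ "p @ [b]"])
    with ab show False by blast
  qed
  then show ?thesis unfolding graph_connected_def vU using conn_nonempty[OF assms(1)] by blast
qed

lemma minor_K24:
  assumes "symrel.K24 (adjacent G) (verts G)"
  shows "minor (complete_bipartite 2 4) G"
proof -
  interpret symrel "adjacent G" by (rule symrel_adjacent)
  obtain A B \<M> where h: "conn A" "conn B" "A \<subseteq> verts G" "B \<subseteq> verts G" "A \<inter> B = {}" "card \<M> = 4" "disjoint \<M>"
    and M: "\<forall>M\<in>\<M>. conn M \<and> M \<subseteq> verts G \<and> M \<inter> A = {} \<and> M \<inter> B = {} \<and> adjS M A \<and> adjS M B"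
    using K24E[OF assms] .
  have "finite \<M>" using h(6) by (metis card.infinite zero_neq_numeral)
  then obtain \<mu> where \<mu>: "bij_betw \<mu> {..<4::nat} \<M>"
    using ex_bij_betw_nat_finite[of \<M>] h(6) by (auto simp: atLeast0LessThan)
  define \<beta> :: "nat + nat \<Rightarrow> 'a set" where "\<beta> = case_sum (\<lambda>i. if i = 0 then A else B) \<mu>"
  have \<mu>M: "\<mu> i \<in> \<M>" if "i < 4" for i using \<mu> that by (auto simp: bij_betw_def)
  have \<mu>_disj: "\<mu> i \<inter> \<mu> j = {}" if "i < 4" "j < 4" "i \<noteq> j" for i j
  proof -
    have "\<mu> i \<noteq> \<mu> j" using \<mu> that unfolding bij_betw_def inj_on_def by auto
    then show ?thesis using disjointD[OF h(7) \<mu>M \<mu>M] that by blast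
  qed
  let ?H = "complete_bipartite 2 4"
  have vH: "x \<in> verts ?H \<longleftrightarrow> x = Inl 0 \<or> x = Inl 1 \<or> (\<exists>i<4. x = Inr i)" for x
    unfolding complete_bipartite_def by (auto simp: numeral_2_eq_2 less_Suc_eq)
  have sides: "\<beta> (Inl 0) = A" "\<beta> (Inl 1) = B" "\<beta> (Inl (Suc 0)) = B" "\<beta> (Inr i) = \<mu> i" for i unfolding \<beta>_def by auto
  have piece: "conn (\<mu> i) \<and> \<mu> i \<subseteq> verts G \<and> \<mu> i \<inter> A = {} \<and> \<mu> i \<inter> B = {} \<and> adjS (\<mu> i) A \<and> adjS (\<mu> i) B"
    if "i < 4" for i using M \<mu>M[OF that] by blast
  have conn_\<beta>: "conn (\<beta> x) \<and> \<beta> x \<subseteq> verts G" if "x \<in> verts ?H" for x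
    using that[unfolded vH] by (elim disjE exE conjE) (use h(1-4) piece in \<open>simp_all add: sides\<close>)
  have disj_\<beta>: "\<beta> x \<inter> \<beta> y = {}" if "x \<in> verts ?H" "y \<in> verts ?H" "x \<noteq> y" for x y
    using that(3) that(1,2)[unfolded vH]
  proof (elim disjE exE conjE)
    fix i j assume "i < 4" "j < 4" "x = Inr i" "y = Inr j" "x \<noteq> y"
    then show ?thesis using \<mu>_disj by (auto simp: sides)
  next
    fix i assume "i < 4" "x = Inr i" "y = Inl 0" then show ?thesis using piece[of i] by (auto simp: sides)
  next
    fix i assume "i < 4" "x = Inr i" "y = Inl 1" then show ?thesis using piece[of i] by (auto simp: sides)
  next
    fix i assume "i < 4" "x = Inl 0" "y = Inr i" then show ?thesis using piece[of i] by (auto simp: sides)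
  next
    fix i assume "i < 4" "x = Inl 1" "y = Inr i" then show ?thesis using piece[of i] by (auto simp: sides)
  qed (use h(5) in \<open>auto simp: sides\<close>)
  have adj_H: "adjS (\<beta> x) (\<beta> y)" if "adjacent ?H x y" for x y
  proof -
    from that obtain i j where ij: "i < 2" "j < 4" "{x, y} = {Inl i, Inr j}"
      unfolding adjacent_def complete_bipartite_def by auto
    have "\<beta> (Inl i) = A \<or> \<beta> (Inl i) = B" unfolding \<beta>_def by auto
    then have "adjS (\<beta> (Inr j)) (\<beta> (Inl i))" using piece[OF ij(2)] by (auto simp: sides)
    moreover have "x = Inl i \<and> y = Inr j \<or> x = Inr j \<and> y = Inl i" using ij(3) by (auto simp: doubleton_eq_iff)
    ultimately show ?thesis using adjS_commute by blast
  qed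
  show ?thesis
    unfolding minor_def
  proof (intro exI[of _ \<beta>] conjI ballI impI)
    fix x y
    show "\<exists>u\<in>\<beta> x. \<exists>v\<in>\<beta> y. adjacent G u v" if "adjacent ?H x y"
      using adj_H[OF that] unfolding adjS_def .
  qed (use conn_\<beta> disj_\<beta> graph_connected_induced in blast)+
qed

lemma independent_pairI:
  assumes "X\<^sub>1 \<subseteq> verts G" "X\<^sub>2 \<subseteq> verts G" "X\<^sub>1 \<inter> X\<^sub>2 = {}" "subgraph T\<^sub>1 G" "subgraph T\<^sub>2 G"
    "tree T\<^sub>1 \<or> X\<^sub>1 = {} \<and> verts T\<^sub>1 = {}" "tree T\<^sub>2 \<or> X\<^sub>2 = {} \<and> verts T\<^sub>2 = {}"
    "verts T\<^sub>1 \<inter> verts T\<^sub>2 = {}" "X\<^sub>1 \<subseteq> verts T\<^sub>1" "X\<^sub>2 \<subseteq> verts T\<^sub>2"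
  shows "independent_pair G X\<^sub>1 X\<^sub>2"
  unfolding independent_pair_def using assms by blast

lemma agile_trees:
  assumes "agile G X" "Y \<subseteq> X"
  obtains T\<^sub>1 T\<^sub>2 where "subgraph T\<^sub>1 G" "subgraph T\<^sub>2 G" "tree T\<^sub>1 \<or> Y = {} \<and> verts T\<^sub>1 = {}"
    "tree T\<^sub>2 \<or> X - Y = {} \<and> verts T\<^sub>2 = {}" "verts T\<^sub>1 \<inter> verts T\<^sub>2 = {}" "Y \<subseteq> verts T\<^sub>1" "X - Y \<subseteq> verts T\<^sub>2"
proof -
  have "Y \<union> (X - Y) = X \<and> Y \<inter> (X - Y) = {}" using assms(2) by auto
  then have "independent_pair G Y (X - Y)" using assms(1) unfolding agile_def by blast
  with that show thesis unfolding independent_pair_def by blast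
qed

text \<open>The tree for the partition into \<open>X\<close> and the empty set shows that
  \<open>X\<close> lies in one component \<open>V\<close>. The trees for the other partitions stay
  in \<open>V\<close> and extend to connected bipartitions.\<close>

lemma finite_agile_minor:
  assumes fin: "finite (verts G)" and X: "agile G X" "agile_bound \<le> card X"
  shows "minor (complete_bipartite 2 4) G"
proof -
  interpret symrel "adjacent G" by (rule symrel_adjacent)
  have "0 < agile_bound" unfolding agile_bound_def leg_bound_def by simp
  then obtain x where x: "x \<in> X" using X(2) by fastforce
  have XG: "X \<subseteq> verts G" using X(1) unfolding agile_def by blast
  define V where "V = cc (verts G) x"
  have xG: "x \<in> verts G" using x XG by blast
  have V: "conn V" "V \<subseteq> verts G" "x \<in> V" unfolding V_def using conn_cc[OF xG] cc_subset cc_self[OF xG] by auto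
  have treeV: "conn (verts T) \<and> verts T \<subseteq> V" if T: "subgraph T G" "tree T" "y \<in> verts T" "y \<in> V" for T y
  proof -
    have c: "conn (verts T)"
      using T(1,2) unfolding tree_def subgraph_def by (intro conn_graph_connected) auto
    moreover have "verts T \<subseteq> V"
      unfolding V_def by (rule cc_max[OF xG c]) (use T V_def in \<open>auto simp: subgraph_def\<close>)
    ultimately show ?thesis by blast
  qed
  have XV: "X \<subseteq> V"
  proof -
    obtain T1 T2 where T: "subgraph T1 G" "tree T1 \<or> X = {} \<and> verts T1 = {}" "X \<subseteq> verts T1"
      using agile_trees[OF X(1) subset_refl] by metis
    then show ?thesis using treeV[of T1 x] x V(3) by blast
  qed
  have "splittable V X"
    unfolding splittable_def
  proof (intro conjI allI impI)
    show "X \<subseteq> V" by (rule XV)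
    fix Y assume Y: "Y \<subseteq> X" "Y \<noteq> {}" "Y \<noteq> X"
    obtain y z where yz: "y \<in> Y" "z \<in> X - Y" using Y by blast
    obtain T1 T2 where T: "subgraph T1 G" "subgraph T2 G" "tree T1 \<or> Y = {} \<and> verts T1 = {}"
      "tree T2 \<or> X - Y = {} \<and> verts T2 = {}" "verts T1 \<inter> verts T2 = {}" "Y \<subseteq> verts T1" "X - Y \<subseteq> verts T2"
      using agile_trees[OF X(1) Y(1)] .
    have T1: "conn (verts T1)" "verts T1 \<subseteq> V" using treeV[of T1 y] T yz Y(1) XV by blast+
    have T2: "conn (verts T2)" "verts T2 \<subseteq> V" using treeV[of T2 z] T yz XV by blast+
    obtain C where "C \<subseteq> V" "conn C" "conn (V - C)" "verts T1 \<subseteq> C" "verts T2 \<subseteq> V - C"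
      using extend_disjoint_conn[OF V(1) T1(1) T2(1) T1(2) T2(2) T(5)] by blast
    then show "\<exists>C\<subseteq>V. conn C \<and> conn (V - C) \<and> Y \<subseteq> C \<and> X - Y \<subseteq> V - C" using T(6,7) by blast
  qed
  then have "K24 V" using V(2) fin finite_subset X(2) by (intro splittable_K24[OF _ V(1)]) auto
  then show ?thesis using minor_K24 K24_mono V(2) by blast
qed

section \<open>Reduction to finite induced subgraphs\<close>

lemma simple_induced: "simple_graph G \<Longrightarrow> simple_graph (induced G U)"
  unfolding simple_graph_def induced_def by fastforce

lemma induced_subset: "W \<subseteq> U \<Longrightarrow> induced (induced G U) W = induced G W"
  unfolding induced_def by auto

lemma minor_induced:
  assumes "minor H (induced G U)"
  shows "minor H G"
proof -
  obtain \<beta> where \<beta>: "\<forall>x\<in>verts H. \<beta> x \<subseteq> verts (induced G U) \<and> graph_connected (induced (induced G U) (\<beta> x))"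
    "\<forall>x\<in>verts H. \<forall>y\<in>verts H. x \<noteq> y \<longrightarrow> \<beta> x \<inter> \<beta> y = {}"
    "\<forall>x\<in>verts H. \<forall>y\<in>verts H. adjacent H x y \<longrightarrow> (\<exists>u\<in>\<beta> x. \<exists>v\<in>\<beta> y. adjacent (induced G U) u v)"
    using assms unfolding minor_def by blast
  have v: "verts (induced G U) \<subseteq> verts G" "verts (induced G U) \<subseteq> U" unfolding induced_def by auto
  have a: "adjacent (induced G U) u w \<Longrightarrow> adjacent G u w" for u w
    unfolding adjacent_def induced_def by auto
  have "\<forall>x\<in>verts H. \<beta> x \<subseteq> verts G \<and> graph_connected (induced G (\<beta> x))"
    using \<beta>(1) v induced_subset[of _ U G] by (metis subset_trans)
  moreover have "\<forall>x\<in>verts H. \<forall>y\<in>verts H. adjacent H x y \<longrightarrow> (\<exists>u\<in>\<beta> x. \<exists>v\<in>\<beta> y. adjacent G u v)"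
    using \<beta>(3) a by meson
  ultimately show ?thesis using \<beta>(2) unfolding minor_def by blast
qed

text \<open>Walks from one point of \<open>Y\<close> to all the others span a finite connected set,
  and an induced subgraph of a tree has no cycle.\<close>

lemma finite_subtree:
  assumes T: "tree T" and Y: "finite Y" "Y \<subseteq> verts T" "Y \<noteq> {}"
  shows "\<exists>U. finite U \<and> Y \<subseteq> U \<and> U \<subseteq> verts T \<and> tree (induced T U)"
proof -
  interpret symrel "adjacent T" by (rule symrel_adjacent)
  obtain y where y: "y \<in> Y" using Y by blast
  have "\<forall>z\<in>Y. \<exists>p. walk T p \<and> hd p = y \<and> last p = z"
    using T Y y unfolding tree_def graph_connected_def by blast
  then obtain p where p: "\<And>z. z \<in> Y \<Longrightarrow> walk T (p z) \<and> hd (p z) = y \<and> last (p z) = z" by metis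
  have yp: "y \<in> set (p z)" and zp: "z \<in> set (p z)" if "z \<in> Y" for z
    using p[OF that] hd_in_set[of "p z"] last_in_set[of "p z"] unfolding walk_def by auto
  let ?U = "{y} \<union> (\<Union>z\<in>Y. set (p z))"
  have "conn ?U"
  proof (rule conn_UN[OF conn_sing])
    fix z assume z: "z \<in> Y"
    show "conn (set (p z))" using p[OF z] unfolding walk_def by (intro conn_walk) auto
    show "{y} \<inter> set (p z) \<noteq> {} \<or> adjS {y} (set (p z))" using yp[OF z] by blast
  qed
  moreover have UT: "?U \<subseteq> verts T" using p y Y(2) unfolding walk_def by blast
  ultimately have "graph_connected (induced T ?U)" by (rule graph_connected_induced)
  moreover have "simple_graph (induced T ?U)" using T unfolding tree_def by (simp add: simple_induced)
  moreover have "\<not> is_cycle (induced T ?U) c" for c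
  proof
    assume c: "is_cycle (induced T ?U) c"
    have a: "adjacent (induced T ?U) u w \<Longrightarrow> adjacent T u w" for u w
      unfolding adjacent_def induced_def by auto
    have "successively (adjacent T) c"
      by (rule successively_mono[of "adjacent (induced T ?U)"])
        (use c a in \<open>auto simp: is_cycle_def walk_def\<close>)
    then have "is_cycle T c" using c a UT unfolding is_cycle_def walk_def by (auto simp: induced_def)
    with T show False unfolding tree_def by blast
  qed
  ultimately have "tree (induced T ?U)" unfolding tree_def by blast
  moreover have "finite ?U" using Y(1) by simp
  moreover have "Y \<subseteq> ?U" using zp by blast
  ultimately show ?thesis using UT by blast
qed

lemma finite_subtree':
  assumes T: "subgraph T G" "tree T \<or> Y = {} \<and> verts T = {}" and Y: "finite Y" "Y \<subseteq> verts T"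
  shows "\<exists>T'. subgraph T' G \<and> finite (verts T') \<and> verts T' \<subseteq> verts T \<and> (tree T' \<or> Y = {} \<and> verts T' = {}) \<and> Y \<subseteq> verts T'"
proof (cases "Y = {}")
  case True
  have "subgraph ({}, {}) G" unfolding subgraph_def simple_graph_def by auto
  with True show ?thesis by (intro exI[of _ "({}, {})"]) auto
next
  case False
  with T have "tree T" by blast
  from finite_subtree[OF this Y False] obtain U
    where U: "finite U" "Y \<subseteq> U" "U \<subseteq> verts T" "tree (induced T U)" by blast
  have "subgraph (induced T U) G"
    using T(1) U(4) unfolding subgraph_def tree_def induced_def by auto
  with U show ?thesis by (intro exI[of _ "induced T U"]) (auto simp: induced_def)
qed

text \<open>A finite set has finitely many partitions; \<open>U\<close> collects the vertices of
  finite witnessing trees for all of them.\<close>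

lemma finite_agile_induced:
  assumes G: "agile G X" and X: "finite X"
  shows "\<exists>U. finite U \<and> agile (induced G U) X"
proof -
  have "\<exists>T. subgraph (fst T) G \<and> subgraph (snd T) G \<and> finite (verts (fst T)) \<and> finite (verts (snd T)) \<and>
      (tree (fst T) \<or> Y = {} \<and> verts (fst T) = {}) \<and> (tree (snd T) \<or> X - Y = {} \<and> verts (snd T) = {}) \<and>
      verts (fst T) \<inter> verts (snd T) = {} \<and> Y \<subseteq> verts (fst T) \<and> X - Y \<subseteq> verts (snd T)"
    if Y: "Y \<in> Pow X" for Y
  proof -
    have YX: "Y \<subseteq> X" using Y by simp
    obtain T1 T2 where T: "subgraph T1 G" "subgraph T2 G" "tree T1 \<or> Y = {} \<and> verts T1 = {}"
      "tree T2 \<or> X - Y = {} \<and> verts T2 = {}" "verts T1 \<inter> verts T2 = {}" "Y \<subseteq> verts T1" "X - Y \<subseteq> verts T2"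
      using agile_trees[OF G YX] .
    have fY: "finite Y" "finite (X - Y)" using X YX finite_subset by auto
    from finite_subtree'[OF T(1,3) fY(1) T(6)] finite_subtree'[OF T(2,4) fY(2) T(7)]
    obtain T1' T2' where "subgraph T1' G \<and> finite (verts T1') \<and> verts T1' \<subseteq> verts T1 \<and> (tree T1' \<or> Y = {} \<and> verts T1' = {}) \<and> Y \<subseteq> verts T1'"
      "subgraph T2' G \<and> finite (verts T2') \<and> verts T2' \<subseteq> verts T2 \<and> (tree T2' \<or> X - Y = {} \<and> verts T2' = {}) \<and> X - Y \<subseteq> verts T2'"
      by blast
    with T(5) show ?thesis by (intro exI[of _ "(T1', T2')"]) auto
  qed
  then obtain T where T: "\<And>Y. Y \<in> Pow X \<Longrightarrow> subgraph (fst (T Y)) G \<and> subgraph (snd (T Y)) G \<and>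
      finite (verts (fst (T Y))) \<and> finite (verts (snd (T Y))) \<and>
      (tree (fst (T Y)) \<or> Y = {} \<and> verts (fst (T Y)) = {}) \<and> (tree (snd (T Y)) \<or> X - Y = {} \<and> verts (snd (T Y)) = {}) \<and>
      verts (fst (T Y)) \<inter> verts (snd (T Y)) = {} \<and> Y \<subseteq> verts (fst (T Y)) \<and> X - Y \<subseteq> verts (snd (T Y))"
    by metis
  define U where "U = (\<Union>Y\<in>Pow X. verts (fst (T Y)) \<union> verts (snd (T Y)))"
  have finU: "finite U" unfolding U_def using X T by auto
  have sub: "subgraph T' (induced G U)" if "subgraph T' G" "verts T' \<subseteq> U" for T'
    using that unfolding subgraph_def induced_def simple_graph_def by fastforce
  have XU: "X \<subseteq> U" unfolding U_def using T[of X] by auto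
  have ind: "independent_pair (induced G U) X1 X2" if "X1 \<union> X2 = X" "X1 \<inter> X2 = {}" for X1 X2
  proof -
    have X12: "X1 \<in> Pow X" "X2 = X - X1" using that by auto
    note t = T[OF X12(1)]
    have "X1 \<subseteq> verts (induced G U)" "X2 \<subseteq> verts (induced G U)"
      using that G XU unfolding agile_def induced_def by auto
    moreover have "verts (fst (T X1)) \<subseteq> U" "verts (snd (T X1)) \<subseteq> U" unfolding U_def using X12(1) by auto
    ultimately show ?thesis using t that(2) sub X12(2)
      by (intro independent_pairI[of _ _ _ "fst (T X1)" "snd (T X1)"]) auto
  qed
  have "agile (induced G U) X"
    unfolding agile_def using ind G XU by (auto simp: agile_def induced_def)
  with finU show ?thesis by blast
qed

section \<open>Transfer along injective vertex maps\<close>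

definition image_graph :: "('a \<Rightarrow> 'b) \<Rightarrow> 'a ugraph \<Rightarrow> 'b ugraph" where
  "image_graph f G = (f ` verts G, (`) f ` edges G)"

lemma edge_subset: "simple_graph G \<Longrightarrow> e \<in> edges G \<Longrightarrow> e \<subseteq> verts G"
  unfolding simple_graph_def by fastforce

lemma simple_image:
  assumes "simple_graph G" "inj_on f (verts G)"
  shows "simple_graph (image_graph f G)"
  unfolding simple_graph_def
proof
  fix e assume "e \<in> edges (image_graph f G)"
  then obtain e' where e': "e' \<in> edges G" "e = f ` e'" unfolding image_graph_def by auto
  then obtain u v where "u \<in> verts G" "v \<in> verts G" "u \<noteq> v" "e' = {u, v}"
    using assms(1) unfolding simple_graph_def by blast
  then show "\<exists>u\<in>verts (image_graph f G). \<exists>v\<in>verts (image_graph f G). u \<noteq> v \<and> e = {u, v}"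
    using e' assms(2) unfolding image_graph_def inj_on_def
    by (intro bexI[of _ "f u"] bexI[of _ "f v"]) auto
qed

lemma adjacent_image: "adjacent G u v \<Longrightarrow> adjacent (image_graph f G) (f u) (f v)"
  unfolding adjacent_def image_graph_def using imageI[of "{u, v}" "edges G" "(`) f"] by simp

lemma walk_image:
  assumes "walk G p"
  shows "walk (image_graph f G) (map f p)"
proof -
  have "successively (\<lambda>x y. adjacent (image_graph f G) (f x) (f y)) p"
  proof (rule successively_mono)
    show "successively (adjacent G) p" using assms unfolding walk_def by blast
  qed (rule adjacent_image)
  then show ?thesis using assms unfolding walk_def successively_map by (auto simp: image_graph_def)
qed

lemma cycle_image:
  assumes "is_cycle G p" "inj_on f (verts G)"
  shows "is_cycle (image_graph f G) (map f p)"
proof -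
  have p: "walk G p" "distinct p" "3 \<le> length p" "adjacent G (last p) (hd p)"
    using assms(1) unfolding is_cycle_def by auto
  then have "set p \<subseteq> verts G" "p \<noteq> []" unfolding walk_def by auto
  then show ?thesis
    unfolding is_cycle_def using walk_image[OF p(1), of f] p adjacent_image[OF p(4), of f] inj_on_subset[OF assms(2)]
    by (auto simp: distinct_map last_map hd_map)
qed

lemma connected_image:
  assumes "graph_connected G"
  shows "graph_connected (image_graph f G)"
  unfolding graph_connected_def
proof (intro conjI ballI)
  show "verts (image_graph f G) \<noteq> {}" using assms unfolding graph_connected_def image_graph_def by auto
  fix a b assume "a \<in> verts (image_graph f G)" "b \<in> verts (image_graph f G)"
  then obtain u v where uv: "u \<in> verts G" "v \<in> verts G" "a = f u" "b = f v" unfolding image_graph_def by auto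
  then obtain p where p: "walk G p" "hd p = u" "last p = v" using assms unfolding graph_connected_def by blast
  then have "p \<noteq> []" unfolding walk_def by blast
  then show "\<exists>p. walk (image_graph f G) p \<and> hd p = a \<and> last p = b"
    using walk_image[OF p(1), of f] p uv by (intro exI[of _ "map f p"]) (auto simp: hd_map last_map)
qed

lemma image_image_graph:
  assumes "simple_graph G" "inj_on f (verts G)" "\<And>v. v \<in> verts G \<Longrightarrow> g (f v) = v"
  shows "image_graph g (image_graph f G) = G"
proof -
  have inv: "g ` f ` U = U" if "U \<subseteq> verts G" for U
  proof -
    have "g ` f ` U = (\<lambda>v. g (f v)) ` U" by (rule image_image)
    also have "\<dots> = (\<lambda>v. v) ` U" using that assms(3) by (intro image_cong) auto
    finally show ?thesis by simp
  qed
  have "(`) g ` (`) f ` edges G = (\<lambda>e. g ` f ` e) ` edges G" by (rule image_image)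
  also have "\<dots> = (\<lambda>e. e) ` edges G"
    by (rule image_cong[OF refl]) (rule inv[OF edge_subset[OF assms(1)]])
  finally have "(`) g ` (`) f ` edges G = edges G" by simp
  moreover have "g ` f ` verts G = verts G" by (rule inv) simp
  ultimately show ?thesis unfolding image_graph_def by simp
qed

text \<open>Acyclicity is the point: a cycle in the image is carried back to \<open>T\<close> by the
  inverse map.\<close>

lemma tree_image:
  assumes "tree T" "inj_on f (verts T)"
  shows "tree (image_graph f T)"
proof -
  have T: "simple_graph T" "graph_connected T" "\<And>p. \<not> is_cycle T p" using assms(1) unfolding tree_def by auto
  let ?g = "inv_into (verts T) f"
  have "\<not> is_cycle (image_graph f T) p" for p
  proof
    assume "is_cycle (image_graph f T) p"
    moreover have "inj_on ?g (verts (image_graph f T))"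
      unfolding image_graph_def by (simp add: inj_on_inv_into)
    ultimately have "is_cycle (image_graph ?g (image_graph f T)) (map ?g p)" by (rule cycle_image)
    moreover have "image_graph ?g (image_graph f T) = T"
      using assms(2) by (intro image_image_graph[OF T(1)]) auto
    ultimately show False using T(3) by simp
  qed
  then show ?thesis unfolding tree_def using simple_image[OF T(1) assms(2)] connected_image[OF T(2)] by blast
qed

lemma subgraph_image:
  assumes "subgraph H G" "inj_on f (verts G)"
  shows "subgraph (image_graph f H) (image_graph f G)"
proof -
  have H: "simple_graph H" "verts H \<subseteq> verts G" "edges H \<subseteq> edges G" using assms(1) unfolding subgraph_def by auto
  then have "simple_graph (image_graph f H)" using simple_image inj_on_subset[OF assms(2)] by blast
  then show ?thesis using H unfolding subgraph_def image_graph_def by auto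
qed

lemma agile_image:
  assumes G: "agile G X" and f: "inj_on f (verts G)"
  shows "agile (image_graph f G) (f ` X)"
  unfolding agile_def
proof (intro conjI allI impI)
  have XG: "X \<subseteq> verts G" using G unfolding agile_def by blast
  then show "f ` X \<subseteq> verts (image_graph f G)" unfolding image_graph_def by auto
  fix Z1 Z2 assume Z: "Z1 \<union> Z2 = f ` X \<and> Z1 \<inter> Z2 = {}"
  define Y where "Y = {x \<in> X. f x \<in> Z1}"
  have "Z1 \<subseteq> f ` X" "Z2 \<subseteq> f ` X" "f ` X \<subseteq> Z1 \<union> Z2" "Z1 \<inter> Z2 = {}" using Z by auto
  note Zs = this
  have Z12: "Z1 = f ` Y" "Z2 = f ` (X - Y)"
  proof -
    show "Z1 = f ` Y" unfolding Y_def using Zs(1) by auto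
    have "z \<in> f ` (X - Y)" if z: "z \<in> Z2" for z
    proof -
      from z Zs(2) obtain x where "x \<in> X" "z = f x" by auto
      then show ?thesis using z Zs(4) unfolding Y_def by auto
    qed
    moreover have "f ` (X - Y) \<subseteq> Z2" unfolding Y_def using Zs(3) by auto
    ultimately show "Z2 = f ` (X - Y)" by auto
  qed
  have YX: "Y \<subseteq> X" unfolding Y_def by blast
  obtain T1 T2 where T: "subgraph T1 G" "subgraph T2 G" "tree T1 \<or> Y = {} \<and> verts T1 = {}"
    "tree T2 \<or> X - Y = {} \<and> verts T2 = {}" "verts T1 \<inter> verts T2 = {}" "Y \<subseteq> verts T1" "X - Y \<subseteq> verts T2"
    using agile_trees[OF G YX] .
  have sub: "verts T1 \<subseteq> verts G" "verts T2 \<subseteq> verts G" using T unfolding subgraph_def by auto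
  have disj: "f ` verts T1 \<inter> f ` verts T2 = {}"
    using inj_on_image_Int[OF f sub] T(5) by simp
  have trees: "tree T1 \<Longrightarrow> tree (image_graph f T1)" "tree T2 \<Longrightarrow> tree (image_graph f T2)"
    using tree_image inj_on_subset[OF f] sub by blast+
  have v: "verts (image_graph f H) = f ` verts H" for H :: "'a ugraph" unfolding image_graph_def by simp
  show "independent_pair (image_graph f G) Z1 Z2"
  proof (rule independent_pairI)
    show "Z1 \<subseteq> verts (image_graph f G)" "Z2 \<subseteq> verts (image_graph f G)"
      unfolding v Z12 using XG YX by (intro image_mono; blast)+
    show "Z1 \<inter> Z2 = {}" by (rule Zs(4))
    show "subgraph (image_graph f T1) (image_graph f G)" "subgraph (image_graph f T2) (image_graph f G)"
      by (rule subgraph_image[OF T(1) f], rule subgraph_image[OF T(2) f])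
    show "tree (image_graph f T1) \<or> Z1 = {} \<and> verts (image_graph f T1) = {}"
      unfolding v Z12 using T(3) trees(1) by blast
    show "tree (image_graph f T2) \<or> Z2 = {} \<and> verts (image_graph f T2) = {}"
      unfolding v Z12 using T(4) trees(2) by blast
    show "verts (image_graph f T1) \<inter> verts (image_graph f T2) = {}" unfolding v by (rule disj)
    show "Z1 \<subseteq> verts (image_graph f T1)" "Z2 \<subseteq> verts (image_graph f T2)"
      unfolding v Z12 using T(6,7) by (intro image_mono; blast)+
  qed
qed

lemma minor_image:
  assumes H: "minor H G" and G: "simple_graph G" and f: "inj_on f (verts G)"
  shows "minor H (image_graph f G)"
proof -
  obtain \<beta> where \<beta>: "\<forall>x\<in>verts H. \<beta> x \<subseteq> verts G \<and> graph_connected (induced G (\<beta> x))"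
    "\<forall>x\<in>verts H. \<forall>y\<in>verts H. x \<noteq> y \<longrightarrow> \<beta> x \<inter> \<beta> y = {}"
    "\<forall>x\<in>verts H. \<forall>y\<in>verts H. adjacent H x y \<longrightarrow> (\<exists>u\<in>\<beta> x. \<exists>v\<in>\<beta> y. adjacent G u v)"
    using H unfolding minor_def by blast
  have ind: "induced (image_graph f G) (f ` U) = image_graph f (induced G U)" if "U \<subseteq> verts G" for U
  proof -
    have "f ` e \<subseteq> f ` U \<longleftrightarrow> e \<subseteq> U" if "e \<in> edges G" for e
    proof -
      have "e \<subseteq> verts G" by (rule edge_subset[OF G that])
      then show ?thesis using f \<open>U \<subseteq> verts G\<close> unfolding inj_on_def by blast
    qed
    then have "{e \<in> (`) f ` edges G. e \<subseteq> f ` U} = (`) f ` {e \<in> edges G. e \<subseteq> U}" by blast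
    moreover have "f ` verts G \<inter> f ` U = f ` (verts G \<inter> U)" using that by blast
    ultimately show ?thesis unfolding induced_def image_graph_def by simp
  qed
  show ?thesis
    unfolding minor_def
  proof (intro exI[of _ "\<lambda>x. f ` \<beta> x"] conjI ballI impI)
    fix x assume x: "x \<in> verts H"
    then show "f ` \<beta> x \<subseteq> verts (image_graph f G)" using \<beta>(1) unfolding image_graph_def by auto
    show "graph_connected (induced (image_graph f G) (f ` \<beta> x))"
      using \<beta>(1) x ind[of "\<beta> x"] connected_image[of "induced G (\<beta> x)" f] by simp
    fix y assume y: "y \<in> verts H"
    show "f ` \<beta> x \<inter> f ` \<beta> y = {}" if "x \<noteq> y"
      using inj_on_image_Int[OF f, of "\<beta> x" "\<beta> y"] \<beta>(1,2) x y that by simp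
    show "\<exists>u\<in>f ` \<beta> x. \<exists>v\<in>f ` \<beta> y. adjacent (image_graph f G) u v" if "adjacent H x y"
    proof -
      from \<beta>(3) x y that obtain u v where "u \<in> \<beta> x" "v \<in> \<beta> y" "adjacent G u v" by blast
      then show ?thesis using adjacent_image[of G u v f] by (intro bexI[of _ "f u"] bexI[of _ "f v"]) auto
    qed
  qed
qed

theorem proposition3p2:
  "(\<exists>m. excludes_agile_size TYPE(nat) m) \<and>
   (\<forall>m. excludes_agile_size TYPE(nat) m \<longrightarrow> excludes_agile_size TYPE('a) m)"
proof (intro conjI allI impI)
  have "excludes_agile_size TYPE(nat) agile_bound"
    unfolding excludes_agile_size_def
  proof (intro allI impI notI)
    fix G :: "nat ugraph"
    assume G: "simple_graph G \<and> \<not> minor (complete_bipartite 2 4) G"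
    assume "\<exists>X. finite X \<and> card X = agile_bound \<and> agile G X"
    then obtain X where X: "finite X" "card X = agile_bound" "agile G X" by blast
    obtain U where U: "finite U" "agile (induced G U) X" using finite_agile_induced[OF X(3,1)] by blast
    have "minor (complete_bipartite 2 4) (induced G U)"
      by (rule finite_agile_minor[OF _ U(2)]) (use U(1) X(2) in \<open>auto simp: induced_def\<close>)
    with G minor_induced show False by blast
  qed
  then show "\<exists>m. excludes_agile_size TYPE(nat) m" ..
next
  fix m assume m: "excludes_agile_size TYPE(nat) m"
  show "excludes_agile_size TYPE('a) m"
    unfolding excludes_agile_size_def
  proof (intro allI impI notI)
    fix G :: "'a ugraph"
    assume G: "simple_graph G \<and> \<not> minor (complete_bipartite 2 4) G"
    assume "\<exists>X. finite X \<and> card X = m \<and> agile G X"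
    then obtain X where X: "finite X" "card X = m" "agile G X" by blast
    obtain U where U: "finite U" "agile (induced G U) X" using finite_agile_induced[OF X(3,1)] by blast
    let ?G = "induced G U"
    have fin: "finite (verts ?G)" using U(1) by (simp add: induced_def)
    have simple: "simple_graph ?G" using G simple_induced by blast
    have XG: "X \<subseteq> verts ?G" using U(2) unfolding agile_def by blast
    \<comment> \<open>Only a finite subgraph has to be copied, so any vertex type embeds into
      \<open>nat\<close>; the minor found in the copy returns along the inverse of
      \<open>f\<close>.\<close>
    obtain f :: "'a \<Rightarrow> nat" where f: "inj_on f (verts ?G)"
      using finite_imp_inj_to_nat_seg[OF fin] by blast
    have "agile (image_graph f ?G) (f ` X)" by (rule agile_image[OF U(2) f])
    moreover have "card (f ` X) = m" using X(2) inj_on_subset[OF f XG] by (simp add: card_image)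
    moreover have sf: "simple_graph (image_graph f ?G)" by (rule simple_image[OF simple f])
    ultimately have "minor (complete_bipartite 2 4) (image_graph f ?G)"
      using m X(1) unfolding excludes_agile_size_def by blast
    then have "minor (complete_bipartite 2 4) (image_graph (inv_into (verts ?G) f) (image_graph f ?G))"
      by (rule minor_image[OF _ sf]) (simp add: image_graph_def inj_on_inv_into)
    also have "image_graph (inv_into (verts ?G) f) (image_graph f ?G) = ?G"
      using f by (intro image_image_graph[OF simple]) auto
    finally show False using G minor_induced by blast
  qed
qed

end
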